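(* Let $T>0$. Let $\phi\colon\mathbb{R}\to\mathbb{R}$ be an increasing homeomorphism with $\phi(\mathbb{R})=\mathbb{R}$ and $\phi(0)=0$, let $f,q\colon\mathbb{R}\to\mathbb{R}$ be continuous, and let $a,e\in L^{\infty}(0,T)$ with $a(t)\ge 0$ for a.e. $t\in[0,T]$, $\frac1T\int_0^T a(t)\,dt=1$ and $\frac1T\int_0^T e(t)\,dt=0$. Assume $\lim_{u\to-\infty}q(u)=+\infty$ and $q(u)\nearrow\omega_+\in\mathbb{R}$ as $u\to+\infty$ (i.e. $q(u)$ increases to the finite limit $\omega_+$ as $u\to+\infty$). For $s\in\mathbb{R}$ consider $$(\phi(u'))'+f(u)u'+a(t)q(u)=s+e(t). \qquad (\mathscr{W\!E}_s)$$ Then there exists $s_0\in\,]-\infty,\omega_+[$ such that: for $s<s_0$, $(\mathscr{W\!E}_s)$ has no $T$-periodic solutions; for $s=s_0$, it has at least one $T$-periodic solution; for $s_0<s<\omega_+$, it has at least two $T$-periodic solutions; for $s\ge\omega_+$, it has at least one $T$-periodic solution.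
   Context: A $T$-periodic solution of $(\mathscr{W\!E}_s)$ is a function $u\in\mathcal{C}^1([0,T])$ with $u(0)=u(T)$, $u'(0)=u'(T)$, such that $\phi(u')$ is absolutely continuous and the equation holds for a.e. $t\in[0,T]$. *)

theory Defs
  imports "HOL-Analysis.Analysis"
begin

definition absolutely_continuous_on :: "real \<Rightarrow> real \<Rightarrow> (real \<Rightarrow> real) \<Rightarrow> bool" where
  "absolutely_continuous_on a b g \<longleftrightarrow>
     (\<forall>\<epsilon>>0. \<exists>\<delta>>0. \<forall>(n::nat) (l::nat \<Rightarrow> real) (r::nat \<Rightarrow> real).
        (\<forall>i<n. a \<le> l i \<and> l i \<le> r i \<and> r i \<le> b) \<and>
        (\<forall>i<n. \<forall>j<n. i \<noteq> j \<longrightarrow> {l i<..<r i} \<inter> {l j<..<r j} = {}) \<and>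
        (\<Sum>i<n. r i - l i) < \<delta>
        \<longrightarrow> (\<Sum>i<n. \<bar>g (r i) - g (l i)\<bar>) < \<epsilon>)"

definition Linfty_on :: "real \<Rightarrow> (real \<Rightarrow> real) \<Rightarrow> bool" where
  "Linfty_on T g \<longleftrightarrow>
     set_borel_measurable lebesgue {0..T} g \<and>
     (\<exists>M. AE t in lebesgue. t \<in> {0..T} \<longrightarrow> \<bar>g t\<bar> \<le> M)"

definition periodic_solution ::
  "(real \<Rightarrow> real) \<Rightarrow> (real \<Rightarrow> real) \<Rightarrow> (real \<Rightarrow> real) \<Rightarrow> (real \<Rightarrow> real) \<Rightarrow>
   (real \<Rightarrow> real) \<Rightarrow> real \<Rightarrow> real \<Rightarrow> (real \<Rightarrow> real) \<Rightarrow> bool" where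
  "periodic_solution \<phi> f a q e T s u \<longleftrightarrow>
     (\<exists>u'. (\<forall>t\<in>{0..T}. (u has_real_derivative u' t) (at t within {0..T})) \<and>
           continuous_on {0..T} u' \<and>
           u 0 = u T \<and> u' 0 = u' T \<and>
           absolutely_continuous_on 0 T (\<lambda>t. \<phi> (u' t)) \<and>
           (AE t in lebesgue. t \<in> {0..T} \<longrightarrow>
              (\<exists>d. ((\<lambda>\<tau>. \<phi> (u' \<tau>)) has_real_derivative d) (at t within {0..T}) \<and>
                   d + f (u t) * u' t + a t * q (u t) = s + e t)))"

end

theory Submission
  imports Defs "HOL-Complex_Analysis.Great_Picard"
begin

text \<open>
  Let \<open>F' = f\<close>, \<open>E' = e\<close> and let \<open>\<psi>\<close> be the inverse of \<open>\<phi>\<close>. A periodic solution is a periodic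
  \<open>u\<close> with \<open>u' = \<psi> (y - F u + E)\<close>, \<open>y' = s - a * q u\<close>; here \<open>s\<close> is the mean of \<open>a * q u\<close>, and
  the oscillation of \<open>u\<close> is bounded in terms of \<open>s\<close> and a lower bound of \<open>q\<close> only.
  Let \<open>s0\<close> be the infimum of all \<open>s\<close> that admit a solution; it is attained by compactness, say by
  \<open>\<beta>\<close>. No degree theory is needed for the remaining solutions: leave \<open>s\<close> free and prescribe the
  level \<open>c = sup (u - \<beta>)\<close> instead. For \<open>c\<close> near \<open>-\<infinity>\<close> the resulting mean exceeds any given \<open>s > s0\<close>, for
  \<open>c = 0\<close> it is at most \<open>s0\<close> because \<open>u\<close> touches \<open>\<beta>\<close> from below, and for \<open>c\<close> near \<open>+\<infinity>\<close> it exceeds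
  any given \<open>s < \<omega>\<close>. The intermediate value argument in \<open>c\<close> is a Schauder fixed point of a map
  that updates \<open>u\<close> and \<open>c\<close> simultaneously. It yields one solution with \<open>c < 0\<close> for every
  \<open>s > s0\<close> and a second one with \<open>c > 0\<close> if \<open>s < \<omega>\<close>.
\<close>

section \<open>Absolutely continuous functions\<close>

text \<open>Several solutions may share one level, so the mean of \<open>a * q u\<close> is not a
  function of \<open>c\<close> and the intermediate value theorem does not apply to it directly. The
  joint update moves \<open>c\<close> by plus or minus the difference of the mean and
  \<open>s\<close> and clips the result to an interval: at a fixed point either \<open>c\<close> is
  an end of the interval or the mean equals \<open>s\<close>. The sign is chosen so that both ends
  are pushed inwards, which leaves the second case. Compactness of the map requires bounded
  nonlinearities. \<open>F\<close> is therefore cut off outside a range fixed in advance, and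
  \<open>q\<close> from above only; both cuts can be undone because the oscillation bound depends on
  neither. A solution with mean \<open>s\<close> cannot lie wholly where \<open>q\<close> exceeds
  \<open>s\<close>. This bounds one of its values from below, and for \<open>s < \<omega>\<close>
  also from above; the oscillation bound does the rest. Strict monotonicity of \<open>q\<close> near
  +infinity puts \<open>s0\<close> below \<omega>, since a solution far to the right has a mean less
  than \<omega>.\<close>

lemma indefinite_integral_has_real_derivative_AE:
  fixes g :: "real \<Rightarrow> real"
  assumes g: "g integrable_on {a..b}"
  shows "AE t in lebesgue. t \<in> {a..b} \<longrightarrow>
    ((\<lambda>x. integral {a..x} g) has_real_derivative g t) (at t within {a..b})"
proof -
  define g0 where "g0 = (\<lambda>x. if x \<in> {a..b} then g x else 0)"
  have g0_UNIV: "g0 integrable_on UNIV"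
    using g unfolding g0_def integrable_restrict_UNIV .
  have g0: "g0 integrable_on cbox c d" for c d
    by (rule integrable_on_subcbox[OF g0_UNIV]) simp
  \<comment> \<open>Averages over \<open>{x..x + h}\<close> control only the right difference
    quotient; the reflected function supplies the left one.\<close>
  have g1: "(\<lambda>x. g0 (- x)) integrable_on cbox c d" for c d
    using g0[of "-d" "-c"] Henstock_Kurzweil_Integration.integrable_reflect_real[where f = g0 and a = "-d" and b = "-c"]
    by (simp add: cbox_interval)
  obtain N1 where N1: "negligible N1"
    "\<And>x e. \<lbrakk>x \<notin> N1; 0 < e\<rbrakk> \<Longrightarrow> \<exists>d>0. \<forall>h. 0 < h \<and> h < d \<longrightarrow>
        norm(integral (cbox x (x + h *\<^sub>R One)) g0 /\<^sub>R h ^ DIM(real) - g0 x) < e"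
    by (rule integrable_ccontinuous_explicit[of g0]) (use g0 in auto)
  obtain N2 where N2: "negligible N2"
    "\<And>x e. \<lbrakk>x \<notin> N2; 0 < e\<rbrakk> \<Longrightarrow> \<exists>d>0. \<forall>h. 0 < h \<and> h < d \<longrightarrow>
        norm(integral (cbox x (x + h *\<^sub>R One)) (\<lambda>x. g0 (- x)) /\<^sub>R h ^ DIM(real) - g0 (- x)) < e"
    by (rule integrable_ccontinuous_explicit[of "\<lambda>x. g0 (- x)"]) (use g1 in auto)
  have "negligible (uminus ` N2)"
    by (rule negligible_differentiable_image_negligible[OF _ N2(1)])
      (auto intro: differentiable_on_minus differentiable_on_ident)
  then have N: "negligible (N1 \<union> uminus ` N2)"
    using N1(1) by simp
  have "((\<lambda>x. integral {a..x} g) has_real_derivative g t) (at t within {a..b})"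
    if t: "t \<in> {a..b}" "t \<notin> N1 \<union> uminus ` N2" for t
  proof -
    have t2: "-t \<notin> N2" using t(2) by (metis UnCI imageI minus_minus)
    have gt: "g0 t = g t" using t by (simp add: g0_def)
    have seg: "integral {x..y} g0 = integral {a..y} g - integral {a..x} g"
      if "a \<le> x" "x \<le> y" "y \<le> b" for x y
    proof -
      have "integral {x..y} g0 = integral {x..y} g"
        by (rule integral_cong) (use that in \<open>auto simp: g0_def\<close>)
      moreover have "integral {a..x} g + integral {x..y} g = integral {a..y} g"
        by (rule Henstock_Kurzweil_Integration.integral_combine)
          (use that in \<open>auto intro: integrable_subinterval_real[OF g]\<close>)
      ultimately show ?thesis by simp
    qed
    show ?thesis
      unfolding has_field_derivative_iff Lim_within
    proof (intro allI impI)
      fix e :: real assume e: "e > 0"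
      obtain d1 where d1: "d1 > 0" "\<And>h. 0 < h \<Longrightarrow> h < d1 \<Longrightarrow>
          \<bar>integral {t..t + h} g0 / h - g t\<bar> < e"
        using N1(2)[of t e] t(2) e by (auto simp: gt field_simps)
      obtain d2 where d2: "d2 > 0" "\<And>h. 0 < h \<Longrightarrow> h < d2 \<Longrightarrow>
          \<bar>integral {-t..-t + h} (\<lambda>x. g0 (-x)) / h - g t\<bar> < e"
        using N2(2)[of "-t" e] t2 e by (auto simp: gt field_simps)
      show "\<exists>d>0. \<forall>x\<in>{a..b}. 0 < dist x t \<and> dist x t < d \<longrightarrow>
          dist ((integral {a..x} g - integral {a..t} g) / (x - t)) (g t) < e"
      proof (intro exI[of _ "min d1 d2"] conjI ballI impI)
        fix x assume x: "x \<in> {a..b}" and "0 < dist x t \<and> dist x t < min d1 d2"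
        then have xt: "x \<noteq> t" "\<bar>x - t\<bar> < d1" "\<bar>x - t\<bar> < d2"
          by (auto simp: dist_real_def)
        consider "x > t" | "x < t" using xt by linarith
        then show "dist ((integral {a..x} g - integral {a..t} g) / (x - t)) (g t) < e"
        proof cases
          case 1
          then show ?thesis
            using d1(2)[of "x - t"] xt seg[of t x] t(1) x by (simp add: dist_real_def)
        next
          case 2
          have "integral {-t..-x} (\<lambda>x. g0 (-x)) = integral {x..t} g0"
            by (simp add: integral_reflect_real)
          then have eq: "integral {-t..-x} (\<lambda>x. g0 (-x)) / (t - x) =
              (integral {a..x} g - integral {a..t} g) / (x - t)"
            using seg[of x t] t(1) x 2 by (metis atLeastAtMost_iff less_imp_le minus_diff_eq minus_divide_divide)
          have "\<bar>integral {-t..-t + (t - x)} (\<lambda>x. g0 (-x)) / (t - x) - g t\<bar> < e"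
            by (rule d2(2)) (use 2 xt in auto)
          then show ?thesis using eq by (simp add: dist_real_def)
        qed
      qed (use d1 d2 in auto)
    qed
  qed
  moreover have "N1 \<union> uminus ` N2 \<in> null_sets lebesgue"
    using N negligible_iff_null_sets by blast
  ultimately show ?thesis
    by (intro AE_I'[of "N1 \<union> uminus ` N2"]) auto
qed

text \<open>Tagged divisions are sets of pairs, so the intervals must be indexed by an arbitrary
  finite set instead of an initial segment of the naturals.\<close>

lemma absolutely_continuous_onD_finite:
  assumes ac: "absolutely_continuous_on a b h" and "\<epsilon> > 0"
  shows "\<exists>\<delta>>0. \<forall>I l r. finite I \<and> (\<forall>i\<in>I. a \<le> l i \<and> l i \<le> r i \<and> r i \<le> b) \<and>
       pairwise (\<lambda>i j. {l i<..<r i} \<inter> {l j<..<r j} = {}) I \<and> (\<Sum>i\<in>I. r i - l i) < \<delta>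
      \<longrightarrow> (\<Sum>i\<in>I. \<bar>h (r i) - h (l i)\<bar>) < \<epsilon>"
proof -
  obtain \<delta> where \<delta>: "\<delta> > 0" "\<And>(n::nat) l r.
        (\<forall>i<n. a \<le> l i \<and> l i \<le> r i \<and> r i \<le> b) \<and>
        (\<forall>i<n. \<forall>j<n. i \<noteq> j \<longrightarrow> {l i<..<r i} \<inter> {l j<..<r j} = {}) \<and>
        (\<Sum>i<n. r i - l i) < \<delta>
        \<Longrightarrow> (\<Sum>i<n. \<bar>h (r i) - h (l i)\<bar>) < \<epsilon>"
    using ac[unfolded absolutely_continuous_on_def, rule_format, OF \<open>\<epsilon> > 0\<close>] by blast
  show ?thesis
  proof (intro exI[of _ \<delta>] conjI allI impI, rule \<delta>(1), elim conjE)
    fix I :: "'a set" and l r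
    assume I: "finite I" "\<forall>i\<in>I. a \<le> l i \<and> l i \<le> r i \<and> r i \<le> b"
      "pairwise (\<lambda>i j. {l i<..<r i} \<inter> {l j<..<r j} = {}) I" "(\<Sum>i\<in>I. r i - l i) < \<delta>"
    obtain g where g: "bij_betw g {..<card I} I"
      using ex_bij_betw_nat_finite[OF I(1)] by (auto simp: atLeast0LessThan)
    have gI: "g i \<in> I" if "i < card I" for i
      using bij_betwE[OF g] that by auto
    have ginj: "g i \<noteq> g j" if "i < card I" "j < card I" "i \<noteq> j" for i j
      using g that unfolding bij_betw_def inj_on_def by blast
    have "(\<Sum>i<card I. \<bar>h (r (g i)) - h (l (g i))\<bar>) < \<epsilon>"
    proof (rule \<delta>(2)[of "card I" "l \<circ> g" "r \<circ> g", unfolded comp_def], intro conjI allI impI)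
      show "(\<Sum>i<card I. r (g i) - l (g i)) < \<delta>"
        using I(4) sum.reindex_bij_betw[OF g, of "\<lambda>i. r i - l i"] by simp
    next
      fix i j assume "i < card I" "j < card I" "i \<noteq> j"
      then show "{l (g i)<..<r (g i)} \<inter> {l (g j)<..<r (g j)} = {}"
        using I(3) gI ginj unfolding pairwise_def by metis
    qed (use I(2) gI in auto)
    then show "(\<Sum>i\<in>I. \<bar>h (r i) - h (l i)\<bar>) < \<epsilon>"
      using sum.reindex_bij_betw[OF g, of "\<lambda>i. \<bar>h (r i) - h (l i)\<bar>"] by simp
  qed
qed

text \<open>Cousin's lemma replaces the usual Vitali covering argument: a tag in the exceptional null
  set gets a small open neighbourhood of that set as its gauge, any other tag one on which the
  increment of the function is small compared with the length.\<close>

lemma absolutely_continuous_zero_derivative_AE: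
  fixes h :: "real \<Rightarrow> real"
  assumes ac: "absolutely_continuous_on a b h" and ab: "a \<le> b"
    and der: "AE t in lebesgue. t \<in> {a..b} \<longrightarrow> (h has_real_derivative 0) (at t within {a..b})"
  shows "h b = h a"
proof -
  have small: "\<bar>h b - h a\<bar> \<le> \<epsilon> * (b - a) + \<epsilon>" if \<epsilon>: "\<epsilon> > 0" for \<epsilon>
  proof -
    obtain \<delta> where \<delta>: "\<delta> > 0"
      "\<forall>(I :: (real \<times> real set) set) l r.
        finite I \<and> (\<forall>i\<in>I. a \<le> l i \<and> l i \<le> r i \<and> r i \<le> b) \<and>
         pairwise (\<lambda>i j. {l i<..<r i} \<inter> {l j<..<r j} = {}) I \<and> (\<Sum>i\<in>I. r i - l i) < \<delta>
        \<longrightarrow> (\<Sum>i\<in>I. \<bar>h (r i) - h (l i)\<bar>) < \<epsilon>"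
      using absolutely_continuous_onD_finite[OF ac \<epsilon>] by blast
    obtain N where N: "N \<in> null_sets lebesgue"
      "\<And>t. t \<in> {a..b} \<Longrightarrow> t \<notin> N \<Longrightarrow> (h has_real_derivative 0) (at t within {a..b})"
      using der unfolding completion.AE_iff_null_sets by auto
    obtain U where U: "open U" "N \<subseteq> U" "U - N \<in> lmeasurable" "emeasure lebesgue (U - N) < ennreal \<delta>"
      using sets_lebesgue_outer_open[of N \<delta>] N(1) \<delta>(1) by blast
    have U_set: "U \<in> sets lebesgue" using U(1) by simp
    have "emeasure lebesgue U = emeasure lebesgue (U - N)"
      using emeasure_Diff_null_set[OF N(1) U_set] by simp
    then have eU: "emeasure lebesgue U < ennreal \<delta>" using U(4) by simp
    then have Um: "U \<in> lmeasurable"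
      using U_set by (intro fmeasurableI) (auto intro: less_trans)
    have mU: "measure lebesgue U < \<delta>"
      using eU emeasure_eq_measure2[OF Um] \<delta>(1) by (simp add: ennreal_less_iff)
    have "\<exists>d>0. \<forall>y\<in>{a..b}. \<bar>y - t\<bar> < d \<longrightarrow> \<bar>h y - h t\<bar> \<le> \<epsilon> * \<bar>y - t\<bar>"
      if t: "t \<in> {a..b}" "t \<notin> N" for t
    proof -
      obtain d where "d > 0"
        "\<And>y. y \<in> {a..b} \<Longrightarrow> 0 < \<bar>y - t\<bar> \<Longrightarrow> \<bar>y - t\<bar> < d \<Longrightarrow> \<bar>(h y - h t) / (y - t)\<bar> < \<epsilon>"
        using N(2)[OF t] \<epsilon> unfolding has_field_derivative_iff Lim_within dist_real_def
        by (metis diff_zero)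
      then show ?thesis
        by (intro exI[of _ d] conjI ballI impI) (auto simp: field_simps abs_divide,
          metis abs_0 abs_ge_zero diff_self eq_iff_diff_eq_0 less_eq_real_def mult_zero_right
            pos_divide_less_eq zero_less_abs_iff)
    qed
    then obtain d where d: "\<And>t. t \<in> {a..b} \<Longrightarrow> t \<notin> N \<Longrightarrow> d t > 0"
      "\<And>t y. t \<in> {a..b} \<Longrightarrow> t \<notin> N \<Longrightarrow> y \<in> {a..b} \<Longrightarrow> \<bar>y - t\<bar> < d t \<Longrightarrow> \<bar>h y - h t\<bar> \<le> \<epsilon> * \<bar>y - t\<bar>"
      by metis
    define \<gamma> where "\<gamma> t = (if t \<in> N then U else if t \<in> {a..b} then ball t (d t) else UNIV)" for t
    have "gauge \<gamma>"
      using U(1,2) d(1) by (auto simp: gauge_def \<gamma>_def)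
    then obtain p where p: "p tagged_division_of {a..b}" "\<gamma> fine p"
      using fine_division_exists_real by blast
    note pD = tagged_division_ofD[OF p(1)]
    have K: "fst z \<in> {a..b} \<and> Inf (snd z) \<in> {a..b} \<and> Sup (snd z) \<in> {a..b} \<and>
        Inf (snd z) \<le> fst z \<and> fst z \<le> Sup (snd z) \<and> snd z = {Inf (snd z)..Sup (snd z)} \<and>
        Inf (snd z) \<in> snd z \<and> Sup (snd z) \<in> snd z \<and> snd z \<subseteq> \<gamma> (fst z)"
      if "z \<in> p" for z
    proof -
      obtain t K where z: "z = (t, K)" by fastforce
      with that have tK: "(t, K) \<in> p" by simp
      obtain c e where ce: "K = cbox c e" using pD(4)[OF tK] by blast
      moreover have "t \<in> K" "K \<subseteq> {a..b}" using pD(2,3)[OF tK] by auto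
      moreover have "K \<subseteq> \<gamma> t" using p(2) tK by (auto simp: fine_def)
      ultimately show ?thesis using z by (auto simp: cbox_interval)
    qed
    define P1 where "P1 = {z \<in> p. fst z \<in> N}"
    define P2 where "P2 = {z \<in> p. fst z \<notin> N}"
    have P: "p = P1 \<union> P2" "P1 \<inter> P2 = {}" "finite P1" "finite P2" "P1 \<subseteq> p" "P2 \<subseteq> p"
      using pD(1) by (auto simp: P1_def P2_def)
    define D where "D z = h (Sup (snd z)) - h (Inf (snd z))" for z :: "real \<times> real set"
    have tot: "(\<Sum>z\<in>p. D z) = h b - h a"
      using additive_tagged_division_1[OF ab p(1), of h] by (simp add: D_def case_prod_unfold)
    have tot_len: "(\<Sum>z\<in>p. Sup (snd z) - Inf (snd z)) = b - a"
      using additive_tagged_division_1[OF ab p(1), of "\<lambda>x. x"] by (simp add: case_prod_unfold)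
    have disj: "pairwise (\<lambda>i j. {Inf (snd i)<..<Sup (snd i)} \<inter> {Inf (snd j)<..<Sup (snd j)} = {}) p"
    proof (rule pairwiseI)
      fix i j assume ij: "i \<in> p" "j \<in> p" "i \<noteq> j"
      have "interior (snd i) \<inter> interior (snd j) = {}"
        using ij pD(5)[of "fst i" "snd i" "fst j" "snd j"] by auto
      moreover have "interior (snd z) = {Inf (snd z)<..<Sup (snd z)}" if "z \<in> p" for z
        using K[OF that] by (metis interior_atLeastAtMost_real)
      ultimately show "{Inf (snd i)<..<Sup (snd i)} \<inter> {Inf (snd j)<..<Sup (snd j)} = {}"
        using ij by auto
    qed
    \<comment> \<open>The intervals tagged in \<open>N\<close> lie in \<open>U\<close> and have
      disjoint interiors, so their total length is at most the measure of \<open>U\<close>.\<close>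
    have "(\<Sum>z\<in>P1. Sup (snd z) - Inf (snd z)) < \<delta>"
    proof -
      have "(\<Sum>z\<in>P1. Sup (snd z) - Inf (snd z)) =
          (\<Sum>z\<in>P1. measure lebesgue {Inf (snd z)<..<Sup (snd z)})"
      proof (rule sum.cong)
        fix z assume "z \<in> P1"
        then have "Inf (snd z) \<le> Sup (snd z)" using K[of z] P(5) by auto
        then show "Sup (snd z) - Inf (snd z) = measure lebesgue {Inf (snd z)<..<Sup (snd z)}"
          by simp
      qed simp
      also have "\<dots> = measure lebesgue (\<Union>z\<in>P1. {Inf (snd z)<..<Sup (snd z)})"
      proof (rule measure_negligible_finite_Union_image[symmetric, OF P(3)])
        show "pairwise (\<lambda>x y. negligible ({Inf (snd x)<..<Sup (snd x)} \<inter>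
            {Inf (snd y)<..<Sup (snd y)})) P1"
          using disj P(5) unfolding pairwise_def by (metis negligible_empty subsetD)
      qed simp
      also have "\<dots> \<le> measure lebesgue U"
      proof (rule measure_mono_fmeasurable[OF _ _ Um])
        show "(\<Union>z\<in>P1. {Inf (snd z)<..<Sup (snd z)}) \<subseteq> U"
        proof (rule UN_least)
          fix z assume z: "z \<in> P1"
          then have "\<gamma> (fst z) = U" by (simp add: P1_def \<gamma>_def)
          moreover have "{Inf (snd z)<..<Sup (snd z)} \<subseteq> {Inf (snd z)..Sup (snd z)}" by auto
          ultimately show "{Inf (snd z)<..<Sup (snd z)} \<subseteq> U"
            using K[of z] z P(5) by auto
        qed
      qed (use P(3) in auto)
      finally show ?thesis using mU by simp
    qed
    then have s1: "(\<Sum>z\<in>P1. \<bar>D z\<bar>) < \<epsilon>"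
      unfolding D_def
    proof (intro \<delta>(2)[rule_format] conjI ballI P(3))
      show "pairwise (\<lambda>i j. {Inf (snd i)<..<Sup (snd i)} \<inter> {Inf (snd j)<..<Sup (snd j)} = {}) P1"
        using disj P(5) by (rule pairwise_subset)
      fix z assume "z \<in> P1"
      then show "a \<le> Inf (snd z)" "Inf (snd z) \<le> Sup (snd z)" "Sup (snd z) \<le> b"
        using K[of z] P(5) by auto
    qed
    have "(\<Sum>z\<in>P2. \<bar>D z\<bar>) \<le> (\<Sum>z\<in>P2. \<epsilon> * (Sup (snd z) - Inf (snd z)))"
    proof (rule sum_mono)
      fix z assume z: "z \<in> P2"
      then have zp: "z \<in> p" and zN: "fst z \<notin> N" by (auto simp: P2_def)
      have Kz: "snd z \<subseteq> ball (fst z) (d (fst z))"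
        using K[OF zp] zN by (auto simp: \<gamma>_def)
      have "\<bar>h y - h (fst z)\<bar> \<le> \<epsilon> * \<bar>y - fst z\<bar>" if "y \<in> snd z" "y \<in> {a..b}" for y
        using d(2)[of "fst z" y] K[OF zp] zN that Kz by (auto simp: dist_real_def)
      then have "\<bar>h (Sup (snd z)) - h (fst z)\<bar> \<le> \<epsilon> * (Sup (snd z) - fst z)"
        "\<bar>h (Inf (snd z)) - h (fst z)\<bar> \<le> \<epsilon> * (fst z - Inf (snd z))"
        using K[OF zp] by (metis abs_of_nonneg diff_ge_0_iff_ge abs_minus_commute)+
      then show "\<bar>D z\<bar> \<le> \<epsilon> * (Sup (snd z) - Inf (snd z))"
        unfolding D_def by (simp add: algebra_simps)
    qed
    also have "\<dots> \<le> (\<Sum>z\<in>p. \<epsilon> * (Sup (snd z) - Inf (snd z)))"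
      by (rule sum_mono2) (use pD(1) P(6) K \<epsilon> in \<open>force+\<close>)
    also have "\<dots> = \<epsilon> * (b - a)"
      using tot_len by (simp add: sum_distrib_left[symmetric])
    finally have s2: "(\<Sum>z\<in>P2. \<bar>D z\<bar>) \<le> \<epsilon> * (b - a)" .
    have "h b - h a = (\<Sum>z\<in>P1. D z) + (\<Sum>z\<in>P2. D z)"
      unfolding tot[symmetric] P(1) by (rule sum.union_disjoint[OF P(3,4,2)])
    then have "\<bar>h b - h a\<bar> \<le> (\<Sum>z\<in>P1. \<bar>D z\<bar>) + (\<Sum>z\<in>P2. \<bar>D z\<bar>)"
      using sum_abs[of D P1] sum_abs[of D P2] by linarith
    with s1 s2 show ?thesis by linarith
  qed
  have "\<bar>h b - h a\<bar> \<le> 0"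
  proof (rule field_le_epsilon)
    fix e :: real assume "e > 0"
    have "\<bar>h b - h a\<bar> \<le> e / (b - a + 1) * (b - a) + e / (b - a + 1)"
      by (rule small) (use \<open>e > 0\<close> ab in auto)
    also have "\<dots> = e * ((b - a + 1) / (b - a + 1))"
      by (simp add: field_simps add_divide_distrib[symmetric])
    finally show "\<bar>h b - h a\<bar> \<le> 0 + e" using ab by simp
  qed
  then show ?thesis by simp
qed

lemma absolutely_continuous_on_Lipschitz:
  assumes L: "\<And>x y. x \<in> {a..b} \<Longrightarrow> y \<in> {a..b} \<Longrightarrow> \<bar>h x - h y\<bar> \<le> L * \<bar>x - y\<bar>"
  shows "absolutely_continuous_on a b h"
  unfolding absolutely_continuous_on_def
proof (intro allI impI)
  fix \<epsilon> :: real assume \<epsilon>: "\<epsilon> > 0"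
  define L' where "L' = \<bar>L\<bar> + 1"
  have L': "L' > 0" "L \<le> L'" by (auto simp: L'_def)
  show "\<exists>\<delta>>0. \<forall>(n::nat) l r.
        (\<forall>i<n. a \<le> l i \<and> l i \<le> r i \<and> r i \<le> b) \<and>
        (\<forall>i<n. \<forall>j<n. i \<noteq> j \<longrightarrow> {l i<..<r i} \<inter> {l j<..<r j} = {}) \<and>
        (\<Sum>i<n. r i - l i) < \<delta> \<longrightarrow> (\<Sum>i<n. \<bar>h (r i) - h (l i)\<bar>) < \<epsilon>"
  proof (intro exI[of _ "\<epsilon> / L'"] conjI allI impI)
    show "\<epsilon> / L' > 0" using \<epsilon> L' by simp
    fix n :: nat and l r :: "nat \<Rightarrow> real"
    assume "(\<forall>i<n. a \<le> l i \<and> l i \<le> r i \<and> r i \<le> b) \<and>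
      (\<forall>i<n. \<forall>j<n. i \<noteq> j \<longrightarrow> {l i<..<r i} \<inter> {l j<..<r j} = {}) \<and> (\<Sum>i<n. r i - l i) < \<epsilon> / L'"
    then have lr: "\<forall>i<n. a \<le> l i \<and> l i \<le> r i \<and> r i \<le> b" and s: "(\<Sum>i<n. r i - l i) < \<epsilon> / L'"
      by blast+
    have "(\<Sum>i<n. \<bar>h (r i) - h (l i)\<bar>) \<le> (\<Sum>i<n. L' * (r i - l i))"
    proof (rule sum_mono)
      fix i assume "i \<in> {..<n}"
      then have i: "a \<le> l i" "l i \<le> r i" "r i \<le> b" using lr by auto
      then have "\<bar>h (r i) - h (l i)\<bar> \<le> L * \<bar>r i - l i\<bar>" by (intro L) auto
      also have "\<dots> \<le> L' * (r i - l i)" using i L' by (auto intro: mult_right_mono)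
      finally show "\<bar>h (r i) - h (l i)\<bar> \<le> L' * (r i - l i)" .
    qed
    also have "\<dots> = L' * (\<Sum>i<n. r i - l i)" by (simp add: sum_distrib_left)
    also have "\<dots> < \<epsilon>" using s L' by (simp add: field_simps)
    finally show "(\<Sum>i<n. \<bar>h (r i) - h (l i)\<bar>) < \<epsilon>" .
  qed
qed

lemma absolutely_continuous_on_diff:
  assumes g: "absolutely_continuous_on a b g" and h: "absolutely_continuous_on a b h"
  shows "absolutely_continuous_on a b (\<lambda>x. g x - h x)"
  unfolding absolutely_continuous_on_def
proof (intro allI impI)
  fix \<epsilon> :: real assume "\<epsilon> > 0"
  then have \<epsilon>: "\<epsilon> / 2 > 0" by simp
  obtain d1 where d1: "d1 > 0" "\<And>(n::nat) l r.
        (\<forall>i<n. a \<le> l i \<and> l i \<le> r i \<and> r i \<le> b) \<and>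
        (\<forall>i<n. \<forall>j<n. i \<noteq> j \<longrightarrow> {l i<..<r i} \<inter> {l j<..<r j} = {}) \<and>
        (\<Sum>i<n. r i - l i) < d1 \<Longrightarrow> (\<Sum>i<n. \<bar>g (r i) - g (l i)\<bar>) < \<epsilon> / 2"
    using g[unfolded absolutely_continuous_on_def, rule_format, OF \<epsilon>] by blast
  obtain d2 where d2: "d2 > 0" "\<And>(n::nat) l r.
        (\<forall>i<n. a \<le> l i \<and> l i \<le> r i \<and> r i \<le> b) \<and>
        (\<forall>i<n. \<forall>j<n. i \<noteq> j \<longrightarrow> {l i<..<r i} \<inter> {l j<..<r j} = {}) \<and>
        (\<Sum>i<n. r i - l i) < d2 \<Longrightarrow> (\<Sum>i<n. \<bar>h (r i) - h (l i)\<bar>) < \<epsilon> / 2"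
    using h[unfolded absolutely_continuous_on_def, rule_format, OF \<epsilon>] by blast
  show "\<exists>\<delta>>0. \<forall>(n::nat) l r.
        (\<forall>i<n. a \<le> l i \<and> l i \<le> r i \<and> r i \<le> b) \<and>
        (\<forall>i<n. \<forall>j<n. i \<noteq> j \<longrightarrow> {l i<..<r i} \<inter> {l j<..<r j} = {}) \<and>
        (\<Sum>i<n. r i - l i) < \<delta> \<longrightarrow> (\<Sum>i<n. \<bar>(g (r i) - h (r i)) - (g (l i) - h (l i))\<bar>) < \<epsilon>"
  proof (intro exI[of _ "min d1 d2"] conjI allI impI)
    show "min d1 d2 > 0" using d1 d2 by simp
    fix n :: nat and l r :: "nat \<Rightarrow> real"
    assume lr: "(\<forall>i<n. a \<le> l i \<and> l i \<le> r i \<and> r i \<le> b) \<and>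
      (\<forall>i<n. \<forall>j<n. i \<noteq> j \<longrightarrow> {l i<..<r i} \<inter> {l j<..<r j} = {}) \<and>
      (\<Sum>i<n. r i - l i) < min d1 d2"
    have "(\<Sum>i<n. \<bar>(g (r i) - h (r i)) - (g (l i) - h (l i))\<bar>)
        \<le> (\<Sum>i<n. \<bar>g (r i) - g (l i)\<bar> + \<bar>h (r i) - h (l i)\<bar>)"
      by (rule sum_mono) linarith
    also have "\<dots> = (\<Sum>i<n. \<bar>g (r i) - g (l i)\<bar>) + (\<Sum>i<n. \<bar>h (r i) - h (l i)\<bar>)"
      by (rule sum.distrib)
    also have "\<dots> < \<epsilon> / 2 + \<epsilon> / 2"
      by (rule add_strict_mono; (rule d1(2) | rule d2(2))) (use lr in auto)
    finally show "(\<Sum>i<n. \<bar>(g (r i) - h (r i)) - (g (l i) - h (l i))\<bar>) < \<epsilon>" by simp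
  qed
qed

lemma absolutely_continuous_on_subset:
  assumes ac: "absolutely_continuous_on a b h" and "b' \<le> b"
  shows "absolutely_continuous_on a b' h"
  unfolding absolutely_continuous_on_def
proof (intro allI impI)
  fix \<epsilon> :: real assume \<epsilon>: "\<epsilon> > 0"
  obtain d where d: "d > 0" "\<And>(n::nat) l r.
        (\<forall>i<n. a \<le> l i \<and> l i \<le> r i \<and> r i \<le> b) \<and>
        (\<forall>i<n. \<forall>j<n. i \<noteq> j \<longrightarrow> {l i<..<r i} \<inter> {l j<..<r j} = {}) \<and>
        (\<Sum>i<n. r i - l i) < d \<Longrightarrow> (\<Sum>i<n. \<bar>h (r i) - h (l i)\<bar>) < \<epsilon>"
    using ac[unfolded absolutely_continuous_on_def, rule_format, OF \<epsilon>] by blast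
  show "\<exists>\<delta>>0. \<forall>(n::nat) l r.
        (\<forall>i<n. a \<le> l i \<and> l i \<le> r i \<and> r i \<le> b') \<and>
        (\<forall>i<n. \<forall>j<n. i \<noteq> j \<longrightarrow> {l i<..<r i} \<inter> {l j<..<r j} = {}) \<and>
        (\<Sum>i<n. r i - l i) < \<delta> \<longrightarrow> (\<Sum>i<n. \<bar>h (r i) - h (l i)\<bar>) < \<epsilon>"
  proof (intro exI[of _ d] conjI allI impI)
    show "d > 0" by (rule d(1))
    fix n :: nat and l r :: "nat \<Rightarrow> real"
    assume "(\<forall>i<n. a \<le> l i \<and> l i \<le> r i \<and> r i \<le> b') \<and>
      (\<forall>i<n. \<forall>j<n. i \<noteq> j \<longrightarrow> {l i<..<r i} \<inter> {l j<..<r j} = {}) \<and>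
      (\<Sum>i<n. r i - l i) < d"
    then show "(\<Sum>i<n. \<bar>h (r i) - h (l i)\<bar>) < \<epsilon>"
      using \<open>b' \<le> b\<close> by (intro d(2)) force
  qed
qed

section \<open>A Schauder fixed point theorem on an interval\<close>

definition hat :: "real \<Rightarrow> nat \<Rightarrow> real \<Rightarrow> real" where
  "hat h i t = max 0 (1 - \<bar>t / h - real i\<bar>)"

text \<open>On \<open>{0..h * n}\<close> the hats with indices up to \<open>n\<close> sum to 1, so
  for \<open>m = Suc n\<close> this is piecewise linear interpolation at the nodes
  \<open>h * i\<close>. In quotient form it is a weighted average as soon as the sum is positive,
  and the estimates rest on that alone.\<close>

definition hat_interp :: "real \<Rightarrow> nat \<Rightarrow> (nat \<Rightarrow> real) \<Rightarrow> real \<Rightarrow> real" where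
  "hat_interp h m v t = (\<Sum>i<m. v i * hat h i t) / (\<Sum>i<m. hat h i t)"

lemma sum_hat_pos:
  assumes h: "h > 0" and t: "t \<in> {0..h * real n}"
  shows "(\<Sum>i<Suc n. hat h i t) > 0"
proof -
  define k where "k = nat \<lfloor>t / h\<rfloor>"
  have t0: "0 \<le> t / h" "t / h \<le> n" using h t by (auto simp: field_simps)
  then have k: "real k \<le> t / h" "t / h < real k + 1"
    unfolding k_def by linarith+
  then have "k < Suc n" using t0 by linarith
  moreover have "hat h k t > 0" using k by (auto simp: hat_def)
  ultimately show ?thesis
    by (intro sum_pos2[of _ k]) (auto simp: hat_def)
qed

text \<open>Only nodes within distance \<open>h\<close> of \<open>t\<close> can have positive
  weight, and an average of values within \<open>e\<close> of \<open>c\<close> is itself within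
  \<open>e\<close> of \<open>c\<close>.\<close>

lemma hat_interp_minus_le:
  assumes h: "h > 0" and t: "t \<in> {0..h * real n}"
    and e: "\<And>i. i \<le> n \<Longrightarrow> \<bar>t - h * real i\<bar> \<le> h \<Longrightarrow> \<bar>v i - c\<bar> \<le> e"
  shows "\<bar>hat_interp h (Suc n) v t - c\<bar> \<le> e"
proof -
  let ?S = "\<Sum>i<Suc n. hat h i t"
  have S: "?S > 0" by (rule sum_hat_pos[OF h t])
  have "\<bar>(\<Sum>i<Suc n. (v i - c) * hat h i t)\<bar> \<le> (\<Sum>i<Suc n. e * hat h i t)"
  proof (rule sum_abs[THEN order_trans], rule sum_mono)
    fix i assume "i \<in> {..<Suc n}"
    show "\<bar>(v i - c) * hat h i t\<bar> \<le> e * hat h i t"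
    proof (cases "hat h i t = 0")
      case False
      then have "\<bar>t / h - real i\<bar> \<le> 1" by (auto simp: hat_def max_def split: if_splits)
      then have "\<bar>t - h * real i\<bar> \<le> h" using h by (simp add: abs_le_iff field_simps)
      then have "\<bar>v i - c\<bar> \<le> e" using e[of i] \<open>i \<in> {..<Suc n}\<close> by simp
      then show ?thesis by (simp add: abs_mult hat_def mult_right_mono)
    qed simp
  qed
  also have "\<dots> = e * ?S" by (rule sum_distrib_left[symmetric])
  finally have "\<bar>(\<Sum>i<Suc n. (v i - c) * hat h i t) / ?S\<bar> \<le> e"
    using S by (simp add: abs_divide divide_le_eq del: sum.lessThan_Suc)
  moreover have "hat_interp h (Suc n) v t - c = (\<Sum>i<Suc n. (v i - c) * hat h i t) / ?S"
    using S by (simp add: hat_interp_def left_diff_distrib sum_subtractf sum_distrib_left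
        field_simps del: sum.lessThan_Suc)
  ultimately show ?thesis by simp
qed

lemma hat_interp_diff_le:
  assumes h: "h > 0" and t: "t \<in> {0..h * real n}"
    and e: "\<And>i. i \<le> n \<Longrightarrow> \<bar>v i - w i\<bar> \<le> e"
  shows "\<bar>hat_interp h (Suc n) v t - hat_interp h (Suc n) w t\<bar> \<le> e"
proof -
  have "hat_interp h (Suc n) v t - hat_interp h (Suc n) w t = hat_interp h (Suc n) (\<lambda>i. v i - w i) t"
    by (simp add: hat_interp_def left_diff_distrib sum_subtractf diff_divide_distrib del: sum.lessThan_Suc)
  then show ?thesis using hat_interp_minus_le[OF h t, of "\<lambda>i. v i - w i" 0 e] e by simp
qed

lemma continuous_on_hat_interp:
  assumes h: "h > 0"
  shows "continuous_on {0..h * real n} (hat_interp h (Suc n) v)"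
proof -
  have "(\<Sum>i<Suc n. hat h i t) \<noteq> 0" if "t \<in> {0..h * real n}" for t
    using sum_hat_pos[OF h that] by simp
  then show ?thesis
    unfolding hat_interp_def hat_def using h
    by (intro continuous_intros) (auto simp del: sum.lessThan_Suc)
qed

definition cball_C :: "real \<Rightarrow> real \<Rightarrow> (real \<Rightarrow> real) set" where
  "cball_C T B = {u. continuous_on {0..T} u \<and> (\<forall>t\<in>{0..T}. \<bar>u t\<bar> \<le> B)}"

text \<open>Kuhn's combinatorial lemma is applied directly to functions that interpolate grid values
  at the nodes, one coordinate per node. The error is \<open>2 * e\<close> at the nodes, and the
  common Lipschitz constant of the images adds \<open>e\<close> between them.\<close>

lemma schauder_Lipschitz_approx:
  fixes N :: "(real \<Rightarrow> real) \<Rightarrow> real \<Rightarrow> real"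
  assumes T: "T > 0" and B: "B > 0" and e: "e > 0"
    and bound: "\<And>u t. \<lbrakk>u \<in> cball_C T B; t \<in> {0..T}\<rbrakk> \<Longrightarrow> \<bar>N u t\<bar> \<le> B"
    and lip: "\<And>u t t'. \<lbrakk>u \<in> cball_C T B; t \<in> {0..T}; t' \<in> {0..T}\<rbrakk>
        \<Longrightarrow> \<bar>N u t - N u t'\<bar> \<le> \<Lambda> * \<bar>t - t'\<bar>"
    and \<delta>: "\<delta> > 0" and uc: "\<And>u v t.
          \<lbrakk>u \<in> cball_C T B; v \<in> cball_C T B;
           \<And>t. t \<in> {0..T} \<Longrightarrow> \<bar>u t - v t\<bar> \<le> \<delta>; t \<in> {0..T}\<rbrakk> \<Longrightarrow> \<bar>N u t - N v t\<bar> \<le> e"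
  shows "\<exists>u\<in>cball_C T B. \<forall>t\<in>{0..T}. \<bar>N u t - u t\<bar> \<le> 3 * e"
proof -
  have \<Lambda>: "\<Lambda> \<ge> 0"
    using lip[of "\<lambda>_. 0" T 0] T B by (auto simp: cball_C_def zero_le_mult_iff dest: order_trans[OF abs_ge_zero])
  \<comment> \<open>The mesh \<open>h\<close> is so fine that images vary by at most
    \<open>e\<close> over one step; below, \<open>p\<close> makes one step in the grid of values at
    most both \<delta> and \<open>e\<close>.\<close>
  define n where "n = Suc (nat \<lceil>\<Lambda> * T / e\<rceil>)"
  define h where "h = T / real n"
  have n: "n > 0" by (simp add: n_def)
  have h: "h > 0" "h * real n = T" using T n by (auto simp: h_def)
  have "\<Lambda> * T / e \<le> real n" unfolding n_def by linarith
  then have \<Lambda>h: "\<Lambda> * h \<le> e" using e n by (simp add: h_def field_simps)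
  define m where "m = min \<delta> e"
  have m: "m > 0" "m \<le> \<delta>" "m \<le> e" using \<delta> e by (auto simp: m_def)
  define p where "p = Suc (nat \<lceil>2 * B / m\<rceil>)"
  have p: "p > 0" by (simp add: p_def)
  have "2 * B / m \<le> real p" unfolding p_def by linarith
  then have "2 * B / real p \<le> m" using m(1) p by (simp add: field_simps)
  then have Bp: "2 * B / real p \<le> \<delta>" "2 * B / real p \<le> e" using m by auto
  define v where "v x i = - B + 2 * B * real (x i) / real p" for x :: "nat \<Rightarrow> nat" and i
  define P where "P x = hat_interp h (Suc n) (v x)" for x
  define \<tau> where "\<tau> i = h * real i" for i
  have \<tau>: "\<tau> i \<in> {0..T}" if "i < Suc n" for i
  proof -
    have "h * real i \<le> h * real n" using that h by (intro mult_left_mono) auto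
    then show ?thesis using h by (simp add: \<tau>_def)
  qed
  have vB: "\<bar>v x i\<bar> \<le> B" if "x i \<le> p" for x i
  proof -
    have "2 * B * real (x i) / real p \<le> 2 * B" using that B p by (simp add: field_simps)
    moreover have "0 \<le> 2 * B * real (x i) / real p" using B by simp
    ultimately show ?thesis unfolding v_def by linarith
  qed
  have Pcont: "continuous_on {0..T} (P x)" for x
    using continuous_on_hat_interp[OF h(1), of n] h(2) by (simp add: P_def)
  have PB: "\<bar>P x t\<bar> \<le> B" if "\<forall>i<Suc n. x i \<le> p" "t \<in> {0..T}" for x t
    using hat_interp_minus_le[OF h(1), of t n "v x" 0 B] vB that h(2) by (simp add: P_def less_Suc_eq_le)
  have Pc: "P x \<in> cball_C T B" if "\<forall>i<Suc n. x i \<le> p" for x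
    using Pcont PB that by (simp add: cball_C_def)
  \<comment> \<open>Label 0 says that the image lies above the interpolated value at the node, label
    1 that it lies below. At \<open>x i = p\<close>, where Kuhn's lemma demands 1, the value is
    \<open>B\<close>, an upper bound of the image, so the reading stays correct.\<close>
  define label where "label x i = (if x i = p then 1 else if N (P x) (\<tau> i) \<ge> v x i then 0 else (1::nat))" for x i
  have NB: "\<bar>N (P x) (\<tau> i)\<bar> \<le> B" if "\<forall>i<Suc n. x i \<le> p" "i < Suc n" for x i
    using bound[OF Pc, of x "\<tau> i"] that \<tau> by auto
  obtain q where q: "\<forall>i<Suc n. q i < p"
    "\<forall>i<Suc n. \<exists>r s. (\<forall>j<Suc n. q j \<le> r j \<and> r j \<le> q j + 1) \<and> (\<forall>j<Suc n. q j \<le> s j \<and> s j \<le> q j + 1) \<and> label r i \<noteq> label s i"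
  proof (rule kuhn_lemma[of p "Suc n" label])
    show "\<forall>x. (\<forall>i<Suc n. x i \<le> p) \<longrightarrow> (\<forall>i<Suc n. x i = 0 \<longrightarrow> label x i = 0)"
    proof (intro allI impI)
      fix x i assume x: "\<forall>i<Suc n. x i \<le> p" "i < Suc n" "x i = 0"
      then have "v x i \<le> N (P x) (\<tau> i)" using NB[OF x(1,2)] by (simp add: v_def)
      then show "label x i = 0" using x p by (simp add: label_def)
    qed
  qed (use p in \<open>auto simp: label_def\<close>)
  have near: "\<bar>v r j - v q j\<bar> \<le> 2 * B / real p" if "q j \<le> r j \<and> r j \<le> q j + 1" for r j
  proof -
    have "r j = q j \<or> r j = q j + 1" using that by auto
    then show ?thesis using B p by (auto simp: v_def field_simps)
  qed
  have qp: "\<forall>i<Suc n. q i \<le> p" using q(1) by auto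
  have NN: "\<bar>N (P q) t - N (P r) t\<bar> \<le> e"
    if r: "\<forall>j<Suc n. q j \<le> r j \<and> r j \<le> q j + 1" and t: "t \<in> {0..T}" for r t
  proof (rule uc[OF Pc Pc _ t])
    show "\<forall>i<Suc n. q i \<le> p" by (rule qp)
    show "\<forall>i<Suc n. r i \<le> p" using r q(1) by (metis Suc_eq_plus1 Suc_leI order_trans)
    fix s assume s: "s \<in> {0..T}"
    show "\<bar>P q s - P r s\<bar> \<le> \<delta>"
      unfolding P_def
    proof (rule hat_interp_diff_le[OF h(1)])
      fix i assume "i \<le> n"
      then show "\<bar>v q i - v r i\<bar> \<le> \<delta>"
        using near[of i r] r Bp(1) by (simp add: abs_minus_commute less_Suc_eq_le)
    qed (use s h in simp)
  qed
  \<comment> \<open>Among the neighbours of \<open>q\<close> one has its image above its value at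
    node \<open>i\<close> and another below. Passing from either to \<open>q\<close> costs
    \<open>e\<close> in the image and \<open>e\<close> in the value.\<close>
  have key: "\<bar>N (P q) (\<tau> i) - v q i\<bar> \<le> 2 * e" if i: "i < Suc n" for i
  proof -
    have *: "\<exists>r s. (\<forall>j<Suc n. q j \<le> r j \<and> r j \<le> q j + 1) \<and> (\<forall>j<Suc n. q j \<le> s j \<and> s j \<le> q j + 1)
      \<and> label r i = 0 \<and> label s i = 1"
    proof -
      obtain r s where rs: "\<forall>j<Suc n. q j \<le> r j \<and> r j \<le> q j + 1" "\<forall>j<Suc n. q j \<le> s j \<and> s j \<le> q j + 1"
        "label r i \<noteq> label s i"
        using q(2) i by blast
      have "label x i = 0 \<or> label x i = 1" for x by (simp add: label_def)
      then show ?thesis using rs by metis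
    qed
    then obtain r s where r: "\<forall>j<Suc n. q j \<le> r j \<and> r j \<le> q j + 1" "label r i = 0"
      and s: "\<forall>j<Suc n. q j \<le> s j \<and> s j \<le> q j + 1" "label s i = 1"
      by blast
    have "N (P r) (\<tau> i) \<ge> v r i" using r(2) by (auto simp: label_def split: if_splits)
    then have 1: "N (P q) (\<tau> i) \<ge> v q i - 2 * e"
      using NN[OF r(1) \<tau>[OF i]] near[of i r] r(1) i Bp(2) by fastforce
    have sp: "\<forall>i<Suc n. s i \<le> p" using s(1) q(1) by (metis Suc_eq_plus1 Suc_leI order_trans)
    have "N (P s) (\<tau> i) \<le> v s i"
    proof (cases "s i = p")
      case True
      then have "v s i = B" using p by (simp add: v_def)
      then show ?thesis using NB[OF sp i] by simp
    qed (use s(2) in \<open>auto simp: label_def split: if_splits\<close>)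
    then have 2: "N (P q) (\<tau> i) \<le> v q i + 2 * e"
      using NN[OF s(1) \<tau>[OF i]] near[of i s] s(1) i Bp(2) by fastforce
    show ?thesis using 1 2 by linarith
  qed
  show ?thesis
  proof (intro bexI[of _ "P q"] ballI)
    show "\<bar>N (P q) t - P q t\<bar> \<le> 3 * e" if t: "t \<in> {0..T}" for t
    proof -
      have "\<bar>P q t - N (P q) t\<bar> \<le> 3 * e"
        unfolding P_def
      proof (rule hat_interp_minus_le[OF h(1)])
        fix i assume i: "i \<le> n" "\<bar>t - h * real i\<bar> \<le> h"
        have "\<bar>N (P q) t - N (P q) (\<tau> i)\<bar> \<le> \<Lambda> * \<bar>t - \<tau> i\<bar>"
          by (rule lip[OF Pc[OF qp] t]) (use \<tau> i in auto)
        also have "\<dots> \<le> \<Lambda> * h" using i(2) \<Lambda> by (intro mult_left_mono) (auto simp: \<tau>_def)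
        finally show "\<bar>v q i - N (hat_interp h (Suc n) (v q)) t\<bar> \<le> 3 * e"
          using key[of i] i(1) \<Lambda>h unfolding P_def by linarith
      qed (use t h in simp)
      then show ?thesis by (simp add: abs_minus_commute)
    qed
  qed (rule Pc[OF qp])
qed

theorem schauder_Lipschitz:
  fixes N :: "(real \<Rightarrow> real) \<Rightarrow> real \<Rightarrow> real"
  assumes T: "T > 0" and B: "B > 0"
    and bound: "\<And>u t. \<lbrakk>u \<in> cball_C T B; t \<in> {0..T}\<rbrakk> \<Longrightarrow> \<bar>N u t\<bar> \<le> B"
    and lip: "\<And>u t t'. \<lbrakk>u \<in> cball_C T B; t \<in> {0..T}; t' \<in> {0..T}\<rbrakk>
        \<Longrightarrow> \<bar>N u t - N u t'\<bar> \<le> \<Lambda> * \<bar>t - t'\<bar>"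
    and uc: "\<And>e. e > 0 \<Longrightarrow> \<exists>\<delta>>0. \<forall>u v. u \<in> cball_C T B \<and> v \<in> cball_C T B \<and>
           (\<forall>t\<in>{0..T}. \<bar>u t - v t\<bar> \<le> \<delta>) \<longrightarrow> (\<forall>t\<in>{0..T}. \<bar>N u t - N v t\<bar> \<le> e)"
  shows "\<exists>u\<in>cball_C T B. \<forall>t\<in>{0..T}. N u t = u t"
proof -
  have "\<exists>u\<in>cball_C T B. \<forall>t\<in>{0..T}. \<bar>N u t - u t\<bar> \<le> 3 / real (Suc k)" for k
  proof -
    have k: "1 / real (Suc k) > 0" by simp
    obtain \<delta> where \<delta>: "\<delta> > 0" "\<And>u v. u \<in> cball_C T B \<and> v \<in> cball_C T B \<and>
           (\<forall>t\<in>{0..T}. \<bar>u t - v t\<bar> \<le> \<delta>) \<Longrightarrow> (\<forall>t\<in>{0..T}. \<bar>N u t - N v t\<bar> \<le> 1 / real (Suc k))"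
      using uc[OF k] by blast
    have "\<exists>u\<in>cball_C T B. \<forall>t\<in>{0..T}. \<bar>N u t - u t\<bar> \<le> 3 * (1 / real (Suc k))"
      by (rule schauder_Lipschitz_approx[OF T B k bound lip \<delta>(1)]) (use \<delta>(2) in auto)
    then show ?thesis by simp
  qed
  then obtain U where U: "\<And>k. U k \<in> cball_C T B"
    "\<And>k t. t \<in> {0..T} \<Longrightarrow> \<bar>N (U k) t - U k t\<bar> \<le> 3 / real (Suc k)"
    by metis
  have \<Lambda>: "\<Lambda> \<ge> 0"
    using lip[of "\<lambda>_. 0" T 0] T B by (auto simp: cball_C_def zero_le_mult_iff dest: order_trans[OF abs_ge_zero])
  \<comment> \<open>The approximate fixed points have no common modulus of continuity, but their
    images do. Since the two differ by \<open>3 / Suc k\<close>, the limit of the images is also the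
    limit of the approximate fixed points.\<close>
  obtain w k where w: "continuous_on {0..T} w" "strict_mono (k :: nat \<Rightarrow> nat)"
    "\<And>e. 0 < e \<Longrightarrow> \<exists>M. \<forall>n x. n \<ge> M \<and> x \<in> {0..T} \<longrightarrow> norm (N (U (k n)) x - w x) < e"
  proof (rule Arzela_Ascoli[of "{0..T}" "\<lambda>n. N (U n)" B])
    show "norm (N (U n) x) \<le> B" if "x \<in> {0..T}" for n x
      using bound[OF U(1), of x n] that by simp
    fix x e :: real assume x: "x \<in> {0..T}" and e: "0 < e"
    show "\<exists>d>0. \<forall>n y. y \<in> {0..T} \<and> norm (x - y) < d \<longrightarrow> norm (N (U n) x - N (U n) y) < e"
    proof (intro exI[of _ "e / (\<Lambda> + 1)"] conjI allI impI)
      fix n y assume y: "y \<in> {0..T} \<and> norm (x - y) < e / (\<Lambda> + 1)"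
      have "\<bar>N (U n) x - N (U n) y\<bar> \<le> \<Lambda> * \<bar>x - y\<bar>"
        by (rule lip[OF U(1) x]) (use y in auto)
      also have "\<dots> \<le> \<Lambda> * (e / (\<Lambda> + 1))" using y \<Lambda> by (intro mult_left_mono) auto
      also have "\<dots> < e" using e \<Lambda> by (simp add: field_simps)
      finally show "norm (N (U n) x - N (U n) y) < e" by simp
    qed (use e \<Lambda> in simp)
  qed auto
  have close: "\<exists>n. \<forall>t\<in>{0..T}. \<bar>N (U n) t - w t\<bar> \<le> e \<and> \<bar>U n t - w t\<bar> \<le> e" if e: "e > 0" for e
  proof -
    obtain M where M: "\<And>n x. n \<ge> M \<Longrightarrow> x \<in> {0..T} \<Longrightarrow> \<bar>N (U (k n)) x - w x\<bar> < e / 2"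
      using w(3)[of "e / 2"] e by auto
    obtain m where m: "6 / e < real m" using reals_Archimedean2 by blast
    define n where "n = max M m"
    have "real n \<le> real (k n)" using seq_suble[OF w(2)] by simp
    then have "6 / e \<le> real (Suc (k n))" using m by (simp add: n_def)
    then have "3 / real (Suc (k n)) \<le> e / 2" using e by (simp add: field_simps)
    moreover have "n \<ge> M" by (simp add: n_def)
    ultimately show ?thesis using U(2)[of _ "k n"] M[of n] e
      by (intro exI[of _ "k n"] ballI) (smt (verit) field_sum_of_halves)
  qed
  have wB: "\<bar>w t\<bar> \<le> B" if t: "t \<in> {0..T}" for t
  proof (rule field_le_epsilon)
    fix e :: real assume "e > 0"
    then obtain n where "\<forall>t\<in>{0..T}. \<bar>U n t - w t\<bar> \<le> e" using close by blast
    then show "\<bar>w t\<bar> \<le> B + e" using t U(1)[of n] unfolding cball_C_def by (smt (verit) mem_Collect_eq)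
  qed
  have wX: "w \<in> cball_C T B" using w(1) wB by (simp add: cball_C_def)
  have "\<bar>N w t - w t\<bar> \<le> 0" if t: "t \<in> {0..T}" for t
  proof (rule field_le_epsilon)
    fix e :: real assume "e > 0"
    then have e2: "e / 2 > 0" by simp
    obtain \<delta> where \<delta>: "\<delta> > 0" "\<And>u v. u \<in> cball_C T B \<and> v \<in> cball_C T B \<and>
           (\<forall>t\<in>{0..T}. \<bar>u t - v t\<bar> \<le> \<delta>) \<Longrightarrow> (\<forall>t\<in>{0..T}. \<bar>N u t - N v t\<bar> \<le> e / 2)"
      using uc[OF e2] by blast
    obtain n where n: "\<forall>t\<in>{0..T}. \<bar>N (U n) t - w t\<bar> \<le> min \<delta> (e / 2) \<and> \<bar>U n t - w t\<bar> \<le> min \<delta> (e / 2)"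
      using close[of "min \<delta> (e / 2)"] e2 \<delta>(1) by auto
    have "\<forall>t\<in>{0..T}. \<bar>N (U n) t - N w t\<bar> \<le> e / 2"
      by (rule \<delta>(2)) (use U(1) wX n in auto)
    moreover have "\<bar>N (U n) t - w t\<bar> \<le> e / 2" using n t by simp
    ultimately show "\<bar>N w t - w t\<bar> \<le> 0 + e" using t by (smt (verit) field_sum_of_halves)
  qed
  then show ?thesis using wX by (intro bexI[of _ w]) auto
qed

section \<open>Suprema and clipping\<close>

definition sup_on :: "real \<Rightarrow> (real \<Rightarrow> real) \<Rightarrow> real" where
  "sup_on T w = Sup (w ` {0..T})"

lemma sup_on_attained:
  assumes T: "T \<ge> 0" and w: "continuous_on {0..T} w"
  obtains t where "t \<in> {0..T}" "w t = sup_on T w" "\<And>s. s \<in> {0..T} \<Longrightarrow> w s \<le> sup_on T w"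
proof -
  obtain t where t: "t \<in> {0..T}" "\<And>s. s \<in> {0..T} \<Longrightarrow> w s \<le> w t"
    using continuous_attains_sup[OF compact_Icc _ w] T by auto
  have "sup_on T w = w t"
    unfolding sup_on_def by (rule cSup_eq_maximum) (use t in auto)
  then show thesis using that t by metis
qed

lemma sup_on_upper:
  assumes "continuous_on {0..T} w" "s \<in> {0..T}"
  shows "w s \<le> sup_on T w"
  using sup_on_attained[of T w] assms by (metis atLeastAtMost_iff order_trans)

lemma sup_on_cong:
  assumes "\<And>t. t \<in> {0..T} \<Longrightarrow> w t = v t"
  shows "sup_on T w = sup_on T v"
  unfolding sup_on_def using assms by (metis (no_types, lifting) image_cong)

lemma sup_on_add_const:
  assumes T: "T \<ge> 0" and w: "continuous_on {0..T} w"
  shows "sup_on T (\<lambda>t. w t + c) = sup_on T w + c"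
proof -
  obtain t where "t \<in> {0..T}" "w t = sup_on T w" "\<And>s. s \<in> {0..T} \<Longrightarrow> w s \<le> sup_on T w"
    using sup_on_attained[OF T w] by blast
  then show ?thesis
    unfolding sup_on_def[of T "\<lambda>t. w t + c"] by (intro cSup_eq_maximum) force+
qed

lemma sup_on_diff_le:
  assumes T: "T \<ge> 0" and w: "continuous_on {0..T} w" and v: "continuous_on {0..T} v"
    and e: "\<And>t. t \<in> {0..T} \<Longrightarrow> \<bar>w t - v t\<bar> \<le> e"
  shows "\<bar>sup_on T w - sup_on T v\<bar> \<le> e"
proof -
  obtain t where t: "t \<in> {0..T}" "w t = sup_on T w"
    using sup_on_attained[OF T w] by blast
  obtain s where s: "s \<in> {0..T}" "v s = sup_on T v"
    using sup_on_attained[OF T v] by blast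
  show ?thesis
    using sup_on_upper[OF v t(1)] sup_on_upper[OF w s(1)] e[OF t(1)] e[OF s(1)] t(2) s(2) by linarith
qed

definition clip :: "real \<Rightarrow> real \<Rightarrow> real \<Rightarrow> real" where
  "clip lo hi x = max lo (min hi x)"

lemma clip_bounds: "lo \<le> hi \<Longrightarrow> lo \<le> clip lo hi x" "lo \<le> hi \<Longrightarrow> clip lo hi x \<le> hi"
  by (auto simp: clip_def)

lemma clip_id: "lo \<le> x \<Longrightarrow> x \<le> hi \<Longrightarrow> clip lo hi x = x"
  by (auto simp: clip_def)

lemma clip_diff_le: "\<bar>clip lo hi x - clip lo hi y\<bar> \<le> \<bar>x - y\<bar>"
  by (auto simp: clip_def min_def max_def)

lemma continuous_on_clip_comp:
  assumes "continuous_on UNIV (g :: real \<Rightarrow> real)"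
  shows "continuous_on UNIV (\<lambda>x. g (clip lo hi x))"
  using assms unfolding clip_def
  by (intro continuous_on_compose2[OF assms] continuous_intros) auto

lemma continuous_on_Icc_bounded:
  fixes g :: "real \<Rightarrow> real"
  assumes "continuous_on {l..h} g"
  obtains K where "K \<ge> 0" "\<And>x. x \<in> {l..h} \<Longrightarrow> \<bar>g x\<bar> \<le> K"
proof -
  have "bounded (g ` {l..h})"
    by (rule compact_imp_bounded[OF compact_continuous_image[OF assms compact_Icc]])
  then obtain K where "\<forall>x\<in>{l..h}. \<bar>g x\<bar> \<le> K" by (auto simp: bounded_iff)
  then show thesis by (intro that[of "\<bar>K\<bar>"]) (auto dest: bspec intro: order_trans)
qed

lemma clip_comp_bounded:
  assumes "continuous_on UNIV (g :: real \<Rightarrow> real)" "lo \<le> hi"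
  obtains K where "\<And>x. \<bar>g (clip lo hi x)\<bar> \<le> K"
proof -
  obtain K where K: "\<And>x. x \<in> {lo..hi} \<Longrightarrow> \<bar>g x\<bar> \<le> K"
    using continuous_on_Icc_bounded[OF continuous_on_subset[OF assms(1) subset_UNIV]] by blast
  show thesis by (rule that[of K], rule K) (use clip_bounds[OF assms(2)] in auto)
qed

section \<open>Weak solutions\<close>

text \<open>Sign and bound of \<open>a\<close> hold everywhere here; such a representative is chosen
  when the theorem is deduced. \<open>E_T\<close> expresses that the forcing has mean zero,
  \<open>a_mean\<close> that \<open>a\<close> has mean one.\<close>

locale periodic_problem =
  fixes T A :: real and \<phi> \<psi> a E :: "real \<Rightarrow> real"
  assumes T_pos: "T > 0"
    and psi_mono: "strict_mono \<psi>" and psi_cont: "continuous_on UNIV \<psi>"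
    and psi_phi: "\<And>x. \<psi> (\<phi> x) = x" and phi_psi: "\<And>x. \<phi> (\<psi> x) = x" and psi_0: "\<psi> 0 = 0"
    and a_int: "a integrable_on {0..T}" and a_nonneg: "\<And>t. 0 \<le> a t" and a_le: "\<And>t. a t \<le> A"
    and a_mean: "integral {0..T} a = T"
    and E_cont: "continuous_on {0..T} E" and E_0: "E 0 = 0" and E_T: "E T = 0"
begin

section \<open>Integrals and means with the weight \<open>a\<close>\<close>

definition wint :: "(real \<Rightarrow> real) \<Rightarrow> real \<Rightarrow> real" where
  "wint w t = integral {0..t} (\<lambda>x. a x * w x)"

text \<open>The expectation for the probability density \<open>a / T\<close> on
  \<open>{0..T}\<close>.\<close>

definition wmean :: "(real \<Rightarrow> real) \<Rightarrow> real" where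
  "wmean w = wint w T / T"

lemma T_nonneg: "T \<ge> 0" using T_pos by simp

lemma a_abs_int: "a absolutely_integrable_on {0..T}"
  using nonnegative_absolutely_integrable_1[OF a_int] a_nonneg by blast

lemma weighted_integrable:
  assumes w: "continuous_on {0..T} w" and "0 \<le> s" "t \<le> T"
  shows "(\<lambda>x. a x * w x) integrable_on {s..t}"
proof -
  have "(\<lambda>x. w x * a x) absolutely_integrable_on {0..T}"
  proof (rule absolutely_integrable_bounded_measurable_product_real[OF _ _ _ a_abs_int])
    show "w \<in> borel_measurable (lebesgue_on {0..T})"
      using continuous_imp_measurable_on_sets_lebesgue[OF w] by simp
    show "bounded (w ` {0..T})"
      by (rule compact_imp_bounded[OF compact_continuous_image[OF w compact_Icc]])
  qed simp
  then have "(\<lambda>x. a x * w x) integrable_on {0..T}"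
    using set_lebesgue_integral_eq_integral(1) by (simp add: mult.commute)
  then show ?thesis
    by (rule integrable_subinterval_real) (use assms in auto)
qed

lemma wint_0 [simp]: "wint w 0 = 0"
  by (simp add: wint_def)

lemma wint_diff:
  assumes w: "continuous_on {0..T} w" and st: "0 \<le> s" "s \<le> t" "t \<le> T"
  shows "wint w t - wint w s = integral {s..t} (\<lambda>x. a x * w x)"
  using Henstock_Kurzweil_Integration.integral_combine[OF st(1,2), of "\<lambda>x. a x * w x"]
    weighted_integrable[OF w, of 0 t] st
  by (simp add: wint_def)

lemma continuous_on_wint:
  assumes "continuous_on {0..T} w"
  shows "continuous_on {0..T} (wint w)"
  unfolding wint_def by (rule indefinite_integral_continuous_1) (rule weighted_integrable[OF assms], auto)

lemma wint_mono:
  assumes w: "continuous_on {0..T} w" and v: "continuous_on {0..T} v" and t: "t \<in> {0..T}"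
    and le: "\<And>x. x \<in> {0..t} \<Longrightarrow> w x \<le> v x"
  shows "wint w t \<le> wint v t"
  unfolding wint_def
  by (rule integral_le) (use weighted_integrable[OF w] weighted_integrable[OF v] t le a_nonneg
      in \<open>auto intro: mult_left_mono\<close>)

lemma wint_const_T [simp]: "wint (\<lambda>_. c) T = c * T"
  using a_mean by (simp add: wint_def)

lemma wint_one_bounds:
  assumes "t \<in> {0..T}"
  shows "0 \<le> integral {0..t} a" "integral {0..t} a \<le> T"
proof -
  have i: "a integrable_on {0..t}"
    by (rule integrable_subinterval_real[OF a_int]) (use assms in auto)
  show "0 \<le> integral {0..t} a"
    by (rule integral_nonneg[OF i]) (use a_nonneg in auto)
  have "integral {0..t} a \<le> integral {0..T} a"
    by (rule integral_subset_le[OF _ i a_int]) (use assms a_nonneg in auto)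
  then show "integral {0..t} a \<le> T" using a_mean by simp
qed

lemma wint_add_const:
  assumes w: "continuous_on {0..T} w" and t: "t \<in> {0..T}"
  shows "wint (\<lambda>x. w x + c) t = wint w t + c * integral {0..t} a"
proof -
  have i: "a integrable_on {0..t}"
    by (rule integrable_subinterval_real[OF a_int]) (use t in auto)
  have "integral {0..t} (\<lambda>x. a x * w x + c * a x) = wint w t + c * integral {0..t} a"
    using weighted_integrable[OF w, of 0 t] t i
    by (subst Henstock_Kurzweil_Integration.integral_add)
      (auto simp: wint_def intro: integrable_on_mult_right)
  then show ?thesis by (simp add: wint_def algebra_simps)
qed

lemma wint_diff_le:
  assumes w: "continuous_on {0..T} w" and v: "continuous_on {0..T} v" and t: "t \<in> {0..T}"
    and e: "\<And>x. x \<in> {0..T} \<Longrightarrow> \<bar>w x - v x\<bar> \<le> e"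
  shows "\<bar>wint w t - wint v t\<bar> \<le> e * T"
proof -
  have "0 \<le> e" using e[OF t] by (meson abs_ge_zero order_trans)
  then have e2: "e * integral {0..t} a \<le> e * T"
    using wint_one_bounds[OF t] by (intro mult_left_mono) auto
  have e': "w x \<le> v x + e" "v x \<le> w x + e" if "x \<in> {0..t}" for x
    using e[of x] that t by auto
  have "wint w t \<le> wint (\<lambda>x. v x + e) t"
    by (rule wint_mono[OF w _ t e'(1)]) (intro continuous_intros v)
  moreover have "wint v t \<le> wint (\<lambda>x. w x + e) t"
    by (rule wint_mono[OF v _ t e'(2)]) (intro continuous_intros w)
  ultimately show ?thesis
    using wint_add_const[OF v t, of e] wint_add_const[OF w t, of e] e2 by linarith
qed

lemma wmean_mono:
  assumes "continuous_on {0..T} w" "continuous_on {0..T} v" "\<And>x. x \<in> {0..T} \<Longrightarrow> w x \<le> v x"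
  shows "wmean w \<le> wmean v"
  using wint_mono[OF assms(1,2), of T] assms(3) T_pos by (auto simp: wmean_def divide_right_mono)

lemma wmean_const [simp]: "wmean (\<lambda>_. c) = c"
  using T_pos by (simp add: wmean_def)

lemma wmean_diff_le:
  assumes "continuous_on {0..T} w" "continuous_on {0..T} v" "\<And>x. x \<in> {0..T} \<Longrightarrow> \<bar>w x - v x\<bar> \<le> e"
  shows "\<bar>wmean w - wmean v\<bar> \<le> e"
  using wint_diff_le[OF assms(1,2) _ assms(3), of T] T_pos
  by (simp add: wmean_def flip: diff_divide_distrib) (simp add: abs_divide divide_le_eq)

lemma wmean_ge:
  assumes "continuous_on {0..T} w" "\<And>x. x \<in> {0..T} \<Longrightarrow> c \<le> w x"
  shows "c \<le> wmean w"
  using wmean_mono[of "\<lambda>_. c" w] assms by simp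

text \<open>The weight may vanish on large sets; strictness comes from the minimum of
  \<open>w\<close>, which is attained and hence a constant above \<open>c\<close>.\<close>

lemma wmean_gt:
  assumes w: "continuous_on {0..T} w" and c: "\<And>x. x \<in> {0..T} \<Longrightarrow> c < w x"
  shows "c < wmean w"
proof -
  obtain t where t: "t \<in> {0..T}" "\<And>s. s \<in> {0..T} \<Longrightarrow> w t \<le> w s"
    using continuous_attains_inf[OF compact_Icc _ w] T_pos by auto
  show ?thesis using c[OF t(1)] wmean_ge[OF w, of "w t"] t(2) by simp
qed

lemma wmean_lt:
  assumes w: "continuous_on {0..T} w" and c: "\<And>x. x \<in> {0..T} \<Longrightarrow> w x < c"
  shows "wmean w < c"
proof -
  obtain t where t: "t \<in> {0..T}" "\<And>s. s \<in> {0..T} \<Longrightarrow> w s \<le> w t"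
    using continuous_attains_sup[OF compact_Icc _ w] T_pos by auto
  show ?thesis using c[OF t(1)] wmean_mono[OF w, of "\<lambda>_. w t"] t(2) by simp
qed

lemma wint_cong:
  assumes "t \<in> {0..T}" "\<And>x. x \<in> {0..T} \<Longrightarrow> w x = v x"
  shows "wint w t = wint v t"
  unfolding wint_def by (rule integral_cong) (use assms in auto)

lemma wmean_cong:
  assumes "\<And>x. x \<in> {0..T} \<Longrightarrow> w x = v x"
  shows "wmean w = wmean v"
  using wint_cong[OF _ assms, of T] T_pos by (simp add: wmean_def)

text \<open>With \<open>F' = f\<close> and \<open>E' = e\<close>, the equation says that \<open>\<phi> (u') + F u - E\<close>
  has derivative \<open>s - a * q u\<close>, and periodicity forces \<open>s\<close> to be the mean of \<open>a * q u\<close>.\<close>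

definition drift :: "(real \<Rightarrow> real) \<Rightarrow> (real \<Rightarrow> real) \<Rightarrow> (real \<Rightarrow> real) \<Rightarrow> real \<Rightarrow> real" where
  "drift q F u t = wmean (\<lambda>x. q (u x)) * t - wint (\<lambda>x. q (u x)) t - F (u t) + E t"

text \<open>\<open>k\<close> is the integration constant of the equation for
  \<open>\<phi> (u')\<close>. Periodicity of \<open>u'\<close> is built in: with the mean as
  \<open>s\<close>, \<open>u 0 = u T\<close> forces equal values of \<open>drift\<close> at 0 and
  \<open>T\<close> (\<open>drift_T\<close>).\<close>

definition weak_solution ::
    "(real \<Rightarrow> real) \<Rightarrow> (real \<Rightarrow> real) \<Rightarrow> real \<Rightarrow> (real \<Rightarrow> real) \<Rightarrow> bool" where
  "weak_solution q F s u \<longleftrightarrow> s = wmean (\<lambda>x. q (u x)) \<and> u 0 = u T \<and>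
     (\<exists>k. \<forall>t\<in>{0..T}. (u has_real_derivative \<psi> (drift q F u t + k)) (at t within {0..T}))"

lemma weak_solution_continuous:
  "weak_solution q F s u \<Longrightarrow> continuous_on {0..T} u"
  unfolding weak_solution_def by (elim conjE exE) (rule DERIV_continuous_on, rule bspec)

text \<open>Only values on the range of \<open>u\<close> enter. This is how truncated nonlinearities
  are exchanged for the original ones once the range is known.\<close>

lemma weak_solution_cong:
  assumes "\<And>t. t \<in> {0..T} \<Longrightarrow> q (u t) = q' (u t)" "\<And>t. t \<in> {0..T} \<Longrightarrow> F (u t) = F' (u t)"
  shows "weak_solution q F s u \<longleftrightarrow> weak_solution q' F' s u"
proof -
  have m: "wmean (\<lambda>x. q (u x)) = wmean (\<lambda>x. q' (u x))" by (rule wmean_cong) (rule assms)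
  have "drift q F u t = drift q' F' u t" if "t \<in> {0..T}" for t
    using m assms wint_cong[OF that, of "\<lambda>x. q (u x)" "\<lambda>x. q' (u x)"] that by (simp add: drift_def)
  then show ?thesis using m by (simp add: weak_solution_def)
qed

lemma continuous_on_comp: "continuous_on UNIV q \<Longrightarrow> continuous_on {0..T} u \<Longrightarrow> continuous_on {0..T} (\<lambda>x. q (u x))"
  for q u :: "real \<Rightarrow> real"
  by (rule continuous_on_compose2[of UNIV q]) auto

lemma continuous_on_drift:
  assumes "continuous_on UNIV q" "continuous_on UNIV F" "continuous_on {0..T} u"
  shows "continuous_on {0..T} (drift q F u)"
  unfolding drift_def
  using continuous_on_comp[OF assms(1,3)] continuous_on_comp[OF assms(2,3)]
  by (intro continuous_intros continuous_on_wint E_cont)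

lemma psi_le_iff: "\<psi> x \<le> \<psi> y \<longleftrightarrow> x \<le> y" and psi_less_iff: "\<psi> x < \<psi> y \<longleftrightarrow> x < y"
  using psi_mono by (auto simp: strict_mono_less_eq strict_mono_less)

text \<open>\<open>x\<close> and \<open>\<psi> x\<close> have the same sign, so the product
  dominates for \<open>\<bar>x\<bar> \<ge> M\<close>; on the compact rest \<psi> is bounded by
  \<open>v\<close> and \<open>C = M * v\<close> absorbs it. With \<open>\<psi> x\<close> in the role
  of \<open>u'\<close>, this will control the integral of \<open>\<bar>u'\<bar>\<close>.\<close>

lemma psi_superlinear:
  assumes M: "M > 0"
  obtains C where "C \<ge> 0" "\<And>x. M * \<bar>\<psi> x\<bar> \<le> x * \<psi> x + C"
proof -
  define v where "v = max (\<psi> M) (- \<psi> (- M))"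
  have v: "\<psi> M \<le> v" "- \<psi> (- M) \<le> v" by (auto simp: v_def)
  have "0 \<le> \<psi> M" using psi_le_iff[of 0 M] psi_0 M by simp
  then have v0: "v \<ge> 0" using v by simp
  show thesis
  proof (rule that[of "M * v"])
    fix x
    have sg: "0 \<le> x \<Longrightarrow> 0 \<le> \<psi> x" "x \<le> 0 \<Longrightarrow> \<psi> x \<le> 0"
      using psi_le_iff[of 0 x] psi_le_iff[of x 0] psi_0 by auto
    have Mv: "0 \<le> M * v" using M v0 by simp
    consider "x \<ge> M" | "x \<le> - M" | "- M \<le> x" "x \<le> M" by linarith
    then show "M * \<bar>\<psi> x\<bar> \<le> x * \<psi> x + M * v"
    proof cases
      case 1
      then have "M * \<psi> x \<le> x * \<psi> x" using sg M by (intro mult_right_mono) auto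
      then show ?thesis using sg M 1 Mv by simp
    next
      case 2
      then have "M * (- \<psi> x) \<le> (- x) * (- \<psi> x)" using sg M by (intro mult_right_mono) auto
      then show ?thesis using sg M 2 Mv by simp
    next
      case 3
      then have "\<bar>\<psi> x\<bar> \<le> v" using v psi_le_iff by (smt (verit))
      then have "M * \<bar>\<psi> x\<bar> \<le> M * v" using M by simp
      moreover have "0 \<le> x * \<psi> x" using sg by (cases "0 \<le> x") (auto simp: mult_nonpos_nonpos)
      ultimately show ?thesis by linarith
    qed
  qed (use M v0 in simp)
qed

text \<open>If \<open>H\<close> is a primitive of \<open>G\<close>, the integrand is the derivative
  of \<open>H \<circ> u\<close>, which has equal end values. \<open>H\<close> is needed only on a
  compact interval that contains the range of \<open>u\<close>.\<close>

lemma periodic_exact_integral: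
  assumes G: "continuous_on UNIV G" and u: "\<And>t. t \<in> {0..T} \<Longrightarrow> (u has_real_derivative d t) (at t within {0..T})"
    and per: "u 0 = u T"
  shows "((\<lambda>t. G (u t) * d t) has_integral 0) {0..T}"
proof -
  have uc: "continuous_on {0..T} u" by (rule DERIV_continuous_on[OF u])
  then obtain B where "\<And>t. t \<in> {0..T} \<Longrightarrow> \<bar>u t\<bar> \<le> B"
    using continuous_on_Icc_bounded by blast
  then have sub: "u ` {0..T} \<subseteq> {-B..B}" by (fastforce simp: abs_le_iff)
  obtain H where H: "\<And>x. x \<in> {-B..B} \<Longrightarrow> (H has_vector_derivative G x) (at x within {-B..B})"
    using antiderivative_continuous[of "-B" B G] G continuous_on_subset by blast
  have "(H \<circ> u has_vector_derivative G (u t) * d t) (at t within {0..T})" if t: "t \<in> {0..T}" for t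
  proof -
    have "(H has_real_derivative G (u t)) (at (u t) within {-B..B})"
      using H[of "u t"] subsetD[OF sub imageI[OF t]]
      by (simp add: has_real_derivative_iff_has_vector_derivative)
    then have "(H has_real_derivative G (u t)) (at (u t) within u ` {0..T})"
      using sub by (rule DERIV_subset)
    then show ?thesis
      using DERIV_image_chain[OF _ u[OF t]] by (simp add: has_real_derivative_iff_has_vector_derivative)
  qed
  then have "((\<lambda>t. G (u t) * d t) has_integral ((H \<circ> u) T - (H \<circ> u) 0)) {0..T}"
    by (rule fundamental_theorem_of_calculus[OF T_nonneg])
  then show ?thesis using per by simp
qed

text \<open>Multiplying by \<open>u'\<close> and integrating over a period removes \<open>F\<close>, so the oscillation
  bound depends neither on \<open>F\<close> nor on an upper bound for \<open>q\<close>.\<close>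

lemma oscillation_bound:
  assumes Q: "Q \<ge> 0"
  obtains D where "D \<ge> 0"
    "\<And>q F s u t t'. \<lbrakk>continuous_on UNIV q; continuous_on UNIV F; \<And>x. - Q \<le> q x; \<bar>s\<bar> \<le> S;
       weak_solution q F s u; t \<in> {0..T}; t' \<in> {0..T}\<rbrakk> \<Longrightarrow> \<bar>u t - u t'\<bar> \<le> D"
proof -
  obtain Eb where Eb0: "Eb \<ge> 0" and Eb: "\<And>t. t \<in> {0..T} \<Longrightarrow> \<bar>E t\<bar> \<le> Eb"
    using continuous_on_Icc_bounded[OF E_cont] by blast
  \<comment> \<open>\<open>K\<close> will bound \<open>P\<close>. As \<open>q + Q\<close> is
    nonnegative, its weighted integral up to \<open>t\<close> lies between 0 and its value
    \<open>(s + Q) * T\<close> over the whole period, so the mean replaces an upper bound of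
    \<open>q\<close>.\<close>
  define K where "K = \<bar>S\<bar> * T + T * (\<bar>S\<bar> + 2 * Q) + Eb"
  have K0: "K \<ge> 0" using Eb0 Q T_pos by (simp add: K_def)
  \<comment> \<open>The surplus 1 over the bound \<open>K\<close> of \<open>P\<close> leaves one
    copy of the integral of \<open>\<bar>u'\<bar>\<close> on the left when the two estimates are
    combined.\<close>
  obtain C where C: "C \<ge> 0" "\<And>x. (K + 1) * \<bar>\<psi> x\<bar> \<le> x * \<psi> x + C"
    using psi_superlinear[of "K + 1"] K0 by auto
  show thesis
  proof (rule that[of "C * T"])
    show "0 \<le> C * T" using C T_pos by simp
    fix q F s u t t'
    assume q: "continuous_on UNIV q" and F: "continuous_on UNIV F" and qQ: "\<And>x. - Q \<le> q x"
      and s: "\<bar>s\<bar> \<le> S" and ws: "weak_solution q F s u" and t: "t \<in> {0..T}" "t' \<in> {0..T}"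
    note uc = weak_solution_continuous[OF ws]
    note quc = continuous_on_comp[OF q uc]
    obtain k where k: "\<And>t. t \<in> {0..T} \<Longrightarrow> (u has_real_derivative \<psi> (drift q F u t + k)) (at t within {0..T})"
      and sm: "s = wmean (\<lambda>x. q (u x))" and per: "u 0 = u T"
      using ws unfolding weak_solution_def by blast
    define z where "z t = drift q F u t + k" for t
    define d where "d t = \<psi> (z t)" for t
    define P where "P t = s * t - wint (\<lambda>x. q (u x)) t + E t" for t
    have du: "(u has_real_derivative d t) (at t within {0..T})" if "t \<in> {0..T}" for t
      using k[OF that] by (simp add: d_def z_def)
    have zP: "z t = P t + (k - F (u t))" for t by (simp add: z_def P_def drift_def sm)
    have PK: "\<bar>P t\<bar> \<le> K" if t: "t \<in> {0..T}" for t
    proof -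
      have i1: "0 \<le> integral {0..t} a" "integral {0..t} a \<le> T" by (rule wint_one_bounds[OF t])+
      have qQc: "continuous_on {0..T} (\<lambda>x. q (u x) + Q)" by (intro continuous_intros quc)
      have qQ0: "0 \<le> q x + Q" for x using qQ[of x] by simp
      have "0 \<le> wint (\<lambda>x. q (u x) + Q) t"
        unfolding wint_def
        by (rule integral_nonneg) (use t weighted_integrable[OF qQc] a_nonneg qQ0 in auto)
      moreover have "wint (\<lambda>x. q (u x) + Q) t \<le> wint (\<lambda>x. q (u x) + Q) T"
        unfolding wint_def
        by (rule integral_subset_le) (use t weighted_integrable[OF qQc] a_nonneg qQ0 in auto)
      moreover have "wint (\<lambda>x. q (u x) + Q) T = s * T + Q * T"
        using wint_add_const[OF quc, of T Q] T_pos a_mean sm by (simp add: wmean_def)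
      moreover have "0 \<le> Q * integral {0..t} a" "Q * integral {0..t} a \<le> Q * T"
        using i1 Q by (auto intro: mult_left_mono)
      moreover have "s * T \<le> \<bar>S\<bar> * T" using s T_pos by (intro mult_right_mono) auto
      moreover have "\<bar>s * t\<bar> \<le> \<bar>S\<bar> * T"
        unfolding abs_mult using s t by (intro mult_mono) auto
      moreover have "0 \<le> Q * T" using Q T_pos by simp
      moreover have "K = 2 * (\<bar>S\<bar> * T) + 2 * (Q * T) + Eb" by (simp add: K_def algebra_simps)
      ultimately show ?thesis
        using wint_add_const[OF quc t, of Q] Eb[OF t] unfolding P_def by linarith
    qed
    have zc: "continuous_on {0..T} z"
      unfolding z_def by (intro continuous_intros continuous_on_drift q F uc)
    have dc: "continuous_on {0..T} d"
      unfolding d_def by (rule continuous_on_comp[OF psi_cont zc])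
    have Pc: "continuous_on {0..T} P"
      unfolding P_def by (intro continuous_intros continuous_on_wint quc E_cont)
    \<comment> \<open>No bound on \<open>k\<close> is known beforehand; as part of a function of
      \<open>u\<close> it drops out together with \<open>F\<close>.\<close>
    have ex: "((\<lambda>t. (k - F (u t)) * d t) has_integral 0) {0..T}"
      by (rule periodic_exact_integral[of "\<lambda>x. k - F x", OF _ du per]) (intro continuous_intros F)
    have i_abs: "(\<lambda>t. \<bar>d t\<bar>) integrable_on {0..T}"
      by (intro integrable_continuous_real continuous_intros dc)
    have i_Pd: "(\<lambda>t. P t * d t) integrable_on {0..T}"
      by (intro integrable_continuous_real continuous_intros dc Pc)
    have "(\<lambda>t. P t * d t + (k - F (u t)) * d t) = (\<lambda>t. z t * d t)"
      by (rule ext) (simp add: zP algebra_simps)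
    then have zd: "((\<lambda>t. z t * d t) has_integral (integral {0..T} (\<lambda>t. P t * d t))) {0..T}"
      using has_integral_add[OF integrable_integral[OF i_Pd] ex] by simp
    have "integral {0..T} (\<lambda>t. (K + 1) * \<bar>d t\<bar>) \<le> integral {0..T} (\<lambda>t. z t * d t + C)"
      by (rule integral_le) (use i_abs zd C(2) in \<open>auto simp: d_def intro!: integrable_add integrable_on_mult_right\<close>)
    also have "\<dots> = integral {0..T} (\<lambda>t. P t * d t) + C * T"
      using has_integral_add[OF zd has_integral_const_real[of C 0 T]] T_pos
      by (simp add: integral_unique mult.commute)
    also have "integral {0..T} (\<lambda>t. P t * d t) \<le> integral {0..T} (\<lambda>t. K * \<bar>d t\<bar>)"
    proof (rule integral_le[OF i_Pd])
      show "(\<lambda>t. K * \<bar>d t\<bar>) integrable_on {0..T}" using i_abs by (rule integrable_on_mult_right)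
      fix t assume "t \<in> {0..T}"
      then have "\<bar>P t\<bar> * \<bar>d t\<bar> \<le> K * \<bar>d t\<bar>" using PK by (intro mult_right_mono) auto
      then show "P t * d t \<le> K * \<bar>d t\<bar>" by (metis abs_ge_self abs_mult order_trans)
    qed
    finally have var: "integral {0..T} (\<lambda>t. \<bar>d t\<bar>) \<le> C * T"
      unfolding Henstock_Kurzweil_Integration.integral_mult_right by (simp add: algebra_simps)
    have osc: "\<bar>u y - u x\<bar> \<le> C * T" if xy: "0 \<le> x" "x \<le> y" "y \<le> T" for x y
    proof -
      have sub: "{x..y} \<subseteq> {0..T}" using xy by auto
      have "(d has_integral (u y - u x)) {x..y}"
        by (rule fundamental_theorem_of_calculus)
          (use xy sub du in \<open>auto simp flip: has_real_derivative_iff_has_vector_derivative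
            intro: DERIV_subset[OF _ sub]\<close>)
      then have "\<bar>u y - u x\<bar> \<le> integral {x..y} (\<lambda>t. \<bar>d t\<bar>)"
        using integral_norm_bound_integral[of d "{x..y}" "\<lambda>t. \<bar>d t\<bar>"]
          integrable_subinterval_real[OF i_abs sub] by (auto simp: has_integral_iff)
      also have "\<dots> \<le> integral {0..T} (\<lambda>t. \<bar>d t\<bar>)"
        by (rule integral_subset_le[OF sub]) (use integrable_subinterval_real[OF i_abs sub] i_abs in auto)
      finally show ?thesis using var by simp
    qed
    show "\<bar>u t - u t'\<bar> \<le> C * T"
      using osc[of t t'] osc[of t' t] t by (cases "t \<le> t'") (auto simp: abs_minus_commute)
  qed
qed

end

section \<open>The fixed point map\<close>

context periodic_problem
begin

text \<open>The integration constant that makes the primitive return to its initial value. For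
  continuous \<open>p\<close> it exists, and it is unique because \<psi> is strictly
  increasing.\<close>

definition balance :: "(real \<Rightarrow> real) \<Rightarrow> real" where
  "balance p = (SOME k. integral {0..T} (\<lambda>t. \<psi> (p t + k)) = 0)"

lemma continuous_on_psi_comp:
  assumes "continuous_on S p"
  shows "continuous_on S (\<lambda>t. \<psi> (p t + k))"
  by (rule continuous_on_compose2[OF psi_cont]) (auto intro!: continuous_intros assms)

text \<open>Otherwise \<open>p + k < r + l\<close> on the whole interval, and the two integrals
  would differ. The case \<open>\<delta> = 0\<close> gives uniqueness, the general case Lipschitz
  dependence of \<open>balance\<close> on \<open>p\<close> in the sup norm.\<close>

lemma balance_cmp:
  assumes p: "continuous_on {0..T} p" and r: "continuous_on {0..T} r"
    and le: "\<And>t. t \<in> {0..T} \<Longrightarrow> p t \<le> r t + \<delta>"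
    and kp: "integral {0..T} (\<lambda>t. \<psi> (p t + k)) = 0" and kr: "integral {0..T} (\<lambda>t. \<psi> (r t + l)) = 0"
  shows "l \<le> k + \<delta>"
proof (rule ccontr)
  assume "\<not> l \<le> k + \<delta>"
  then have "\<psi> (p t + k) < \<psi> (r t + l)" if "t \<in> {0..T}" for t
    using le[OF that] psi_less_iff by simp
  then have "integral {0..T} (\<lambda>t. \<psi> (p t + k)) < integral {0..T} (\<lambda>t. \<psi> (r t + l))"
    using T_pos by (intro integral_less_real continuous_on_psi_comp p r) auto
  then show False using kp kr by simp
qed

text \<open>Intermediate value theorem: for \<open>k = B\<close> and \<open>k = - B\<close> the
  integrand has a constant sign.\<close>

lemma balance_exists:
  assumes p: "continuous_on {0..T} p" and B: "\<And>t. t \<in> {0..T} \<Longrightarrow> \<bar>p t\<bar> \<le> B"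
  shows "\<exists>k. \<bar>k\<bar> \<le> B \<and> integral {0..T} (\<lambda>t. \<psi> (p t + k)) = 0"
proof -
  have B0: "B \<ge> 0" using B[of 0] T_pos by auto
  define J where "J k = integral {0..T} (\<lambda>t. \<psi> (p t + k))" for k
  have "continuous_on ({-B..B} \<times> cbox 0 T) (\<lambda>(k, t). \<psi> (p t + k))"
  proof -
    have "continuous_on ({-B..B} \<times> cbox 0 T) (\<lambda>x. p (snd x))"
      by (rule continuous_on_compose2[OF p]) (auto intro!: continuous_intros)
    then have "continuous_on ({-B..B} \<times> cbox 0 T) (\<lambda>x. \<psi> (p (snd x) + fst x))"
      by (intro continuous_on_compose2[OF psi_cont] continuous_intros) auto
    then show ?thesis by (simp add: case_prod_unfold)
  qed
  then have Jc: "continuous_on {-B..B} J"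
    unfolding J_def using integral_continuous_on_param[of "{-B..B}" 0 T "\<lambda>k t. \<psi> (p t + k)"] by simp
  have "J (-B) \<le> 0"
  proof -
    have "J (-B) \<le> integral {0..T} (\<lambda>t. 0)"
      unfolding J_def
    proof (rule integral_le)
      show "(\<lambda>t. \<psi> (p t + - B)) integrable_on {0..T}"
        by (rule integrable_continuous_real[OF continuous_on_psi_comp[OF p]])
      fix t assume "t \<in> {0..T}"
      then have "p t + - B \<le> 0" using B[of t] by (simp add: abs_le_iff)
      then show "\<psi> (p t + - B) \<le> 0" using psi_le_iff psi_0 by metis
    qed (rule integrable_0)
    then show ?thesis by simp
  qed
  moreover have "0 \<le> J B"
  proof -
    have "integral {0..T} (\<lambda>t. 0) \<le> J B"
      unfolding J_def
    proof (rule integral_le)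
      fix t assume "t \<in> {0..T}"
      then have "0 \<le> p t + B" using B[of t] by (simp add: abs_le_iff)
      then show "0 \<le> \<psi> (p t + B)" using psi_le_iff psi_0 by metis
    qed (use integrable_continuous_real[OF continuous_on_psi_comp[OF p]] in auto)
    then show ?thesis by simp
  qed
  ultimately obtain k where "-B \<le> k" "k \<le> B" "J k = 0"
    using IVT'[of J "-B" 0 B] Jc B0 by auto
  then show ?thesis by (intro exI[of _ k]) (auto simp: J_def)
qed

lemma balance_zero:
  assumes "continuous_on {0..T} p"
  shows "integral {0..T} (\<lambda>t. \<psi> (p t + balance p)) = 0"
proof -
  obtain B where "\<And>t. t \<in> {0..T} \<Longrightarrow> \<bar>p t\<bar> \<le> B"
    using continuous_on_Icc_bounded[OF assms] by blast
  from balance_exists[OF assms this] obtain k where "integral {0..T} (\<lambda>t. \<psi> (p t + k)) = 0"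
    by blast
  then show ?thesis
    unfolding balance_def by (rule someI[of "\<lambda>k. integral {0..T} (\<lambda>t. \<psi> (p t + k)) = 0"])
qed

lemma balance_unique:
  assumes p: "continuous_on {0..T} p" and "integral {0..T} (\<lambda>t. \<psi> (p t + k)) = 0"
  shows "balance p = k"
  using balance_cmp[OF p p, of 0, OF _ balance_zero[OF p] assms(2)]
    balance_cmp[OF p p, of 0, OF _ assms(2) balance_zero[OF p]] by simp

lemma balance_bound:
  assumes p: "continuous_on {0..T} p" and B: "\<And>t. t \<in> {0..T} \<Longrightarrow> \<bar>p t\<bar> \<le> B"
  shows "\<bar>balance p\<bar> \<le> B"
  using balance_exists[OF p B] balance_unique[OF p] by metis

lemma balance_diff_le:
  assumes p: "continuous_on {0..T} p" and r: "continuous_on {0..T} r"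
    and d: "\<And>t. t \<in> {0..T} \<Longrightarrow> \<bar>p t - r t\<bar> \<le> \<delta>"
  shows "\<bar>balance p - balance r\<bar> \<le> \<delta>"
proof -
  have "balance r \<le> balance p + \<delta>"
    by (rule balance_cmp[OF p r _ balance_zero[OF p] balance_zero[OF r]]) (use d in \<open>force simp: abs_le_iff\<close>)
  moreover have "balance p \<le> balance r + \<delta>"
    by (rule balance_cmp[OF r p _ balance_zero[OF r] balance_zero[OF p]]) (use d in \<open>force simp: abs_le_iff\<close>)
  ultimately show ?thesis by linarith
qed

definition primitive :: "(real \<Rightarrow> real) \<Rightarrow> real \<Rightarrow> real" where
  "primitive p t = integral {0..t} (\<lambda>x. \<psi> (p x + balance p))"

lemma primitive_0 [simp]: "primitive p 0 = 0"
  by (simp add: primitive_def)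

lemma primitive_T: "continuous_on {0..T} p \<Longrightarrow> primitive p T = 0"
  by (simp add: primitive_def balance_zero)

lemma primitive_deriv:
  assumes p: "continuous_on {0..T} p" and t: "t \<in> {0..T}"
  shows "(primitive p has_real_derivative \<psi> (p t + balance p)) (at t within {0..T})"
  unfolding primitive_def
  by (rule integral_has_real_derivative[OF continuous_on_psi_comp[OF p] t])

lemma continuous_on_primitive:
  "continuous_on {0..T} p \<Longrightarrow> continuous_on {0..T} (primitive p)"
  by (rule DERIV_continuous_on[OF primitive_deriv])

lemma primitive_Lipschitz:
  assumes p: "continuous_on {0..T} p" and \<Lambda>: "\<And>t. t \<in> {0..T} \<Longrightarrow> \<bar>\<psi> (p t + balance p)\<bar> \<le> \<Lambda>"
    and t: "t \<in> {0..T}" "t' \<in> {0..T}"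
  shows "\<bar>primitive p t - primitive p t'\<bar> \<le> \<Lambda> * \<bar>t - t'\<bar>"
  using field_differentiable_bound[of "{0..T}" "primitive p" "\<lambda>t. \<psi> (p t + balance p)" \<Lambda> t t']
    primitive_deriv[OF p] \<Lambda> t by simp

lemma primitive_diff_le:
  assumes p: "continuous_on {0..T} p" and r: "continuous_on {0..T} r"
    and d: "\<And>t. t \<in> {0..T} \<Longrightarrow> \<bar>\<psi> (p t + balance p) - \<psi> (r t + balance r)\<bar> \<le> \<eta>"
    and t: "t \<in> {0..T}"
  shows "\<bar>primitive p t - primitive r t\<bar> \<le> \<eta> * T"
proof -
  have "\<bar>(primitive p t - primitive r t) - (primitive p 0 - primitive r 0)\<bar> \<le> \<eta> * \<bar>t - 0\<bar>"
    using field_differentiable_bound[of "{0..T}" "\<lambda>t. primitive p t - primitive r t"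
        "\<lambda>t. \<psi> (p t + balance p) - \<psi> (r t + balance r)" \<eta> t 0]
      DERIV_diff[OF primitive_deriv[OF p] primitive_deriv[OF r]] d t T_pos by simp
  also have "\<dots> \<le> \<eta> * T"
    using t d[OF t] by (intro mult_left_mono) (auto intro: order_trans[OF abs_ge_zero])
  finally show ?thesis by simp
qed

end

text \<open>Instances have truncated nonlinearities, whence the bounds. \<beta> is the reference
  curve above which levels are measured.\<close>

locale shift_map = periodic_problem +
  fixes q F \<beta> :: "real \<Rightarrow> real" and lo hi \<kappa> target Q B\<^sub>F :: real
  assumes q_cont: "continuous_on UNIV q" and F_cont: "continuous_on UNIV F"
    and q_bound: "\<And>x. \<bar>q x\<bar> \<le> Q" and F_bound: "\<And>x. \<bar>F x\<bar> \<le> B\<^sub>F"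
    and beta_cont: "continuous_on {0..T} \<beta>" and lo_le_hi: "lo \<le> hi"
begin

text \<open>The updated level. If it agrees with the old one, then this is \<open>lo\<close> or
  \<open>hi\<close>, or \<open>\<kappa> = 0\<close>, or the mean equals \<open>target\<close>. Equal
  bounds \<open>lo = hi\<close> prescribe the level; the nonzero values 1 and -1 of \<kappa> choose
  the direction in which a wrong mean moves it.\<close>

definition level :: "(real \<Rightarrow> real) \<Rightarrow> real" where
  "level u = clip lo hi (sup_on T (\<lambda>t. u t - \<beta> t) + \<kappa> * (wmean (\<lambda>x. q (u x)) - target))"

text \<open>A periodic primitive is determined up to a vertical translation. The second summand
  fixes the translation by making the supremum of \<open>shift u - \<beta>\<close> equal to
  \<open>level u\<close>, so function and level are updated together.\<close>

definition shift :: "(real \<Rightarrow> real) \<Rightarrow> real \<Rightarrow> real" where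
  "shift u t = primitive (drift q F u) t
     + (level u - sup_on T (\<lambda>x. primitive (drift q F u) x - \<beta> x))"

lemma drift_bounded: "\<exists>K\<ge>0. \<forall>u. continuous_on {0..T} u \<longrightarrow> (\<forall>t\<in>{0..T}. \<bar>drift q F u t\<bar> \<le> K)"
proof -
  obtain K\<^sub>E where E: "\<And>t. t \<in> {0..T} \<Longrightarrow> \<bar>E t\<bar> \<le> K\<^sub>E"
    using continuous_on_Icc_bounded[OF E_cont] by blast
  have "\<bar>drift q F u t\<bar> \<le> Q * T + Q * T + B\<^sub>F + K\<^sub>E" if u: "continuous_on {0..T} u" and t: "t \<in> {0..T}" for u t
  proof -
    note c = continuous_on_comp[OF q_cont u]
    have "\<bar>wmean (\<lambda>x. q (u x)) - wmean (\<lambda>_. 0)\<bar> \<le> Q"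
      by (rule wmean_diff_le[OF c]) (use q_bound in auto)
    then have "\<bar>wmean (\<lambda>x. q (u x)) * t\<bar> \<le> Q * T"
      unfolding abs_mult using t by (intro mult_mono) auto
    moreover have "\<bar>wint (\<lambda>x. q (u x)) t - wint (\<lambda>_. 0) t\<bar> \<le> Q * T"
      by (rule wint_diff_le[OF c _ t]) (use q_bound in auto)
    then have "\<bar>wint (\<lambda>x. q (u x)) t\<bar> \<le> Q * T" by (simp add: wint_def)
    ultimately show ?thesis
      unfolding drift_def using E[OF t] F_bound[of "u t"] by linarith
  qed
  then show ?thesis
    by (intro exI[of _ "\<bar>Q * T + Q * T + B\<^sub>F + K\<^sub>E\<bar>"]) (auto intro: order_trans[OF _ abs_ge_self])
qed

lemma shift_bounds:
  obtains B \<Lambda> where "B > 0"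
    "\<And>u t. continuous_on {0..T} u \<Longrightarrow> t \<in> {0..T} \<Longrightarrow> \<bar>shift u t\<bar> \<le> B"
    "\<And>u t t'. continuous_on {0..T} u \<Longrightarrow> t \<in> {0..T} \<Longrightarrow> t' \<in> {0..T} \<Longrightarrow>
       \<bar>shift u t - shift u t'\<bar> \<le> \<Lambda> * \<bar>t - t'\<bar>"
proof -
  obtain K where K: "K \<ge> 0" "\<And>u t. continuous_on {0..T} u \<Longrightarrow> t \<in> {0..T} \<Longrightarrow> \<bar>drift q F u t\<bar> \<le> K"
    using drift_bounded by blast
  \<comment> \<open>\<open>balance\<close> obeys the same bound \<open>K\<close> as the drift, so
    the arguments of \<psi> stay within \<open>2 * K\<close>.\<close>
  obtain \<Lambda> where \<Lambda>: "\<Lambda> \<ge> 0" "\<And>x. x \<in> {- (2 * K)..2 * K} \<Longrightarrow> \<bar>\<psi> x\<bar> \<le> \<Lambda>"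
    using continuous_on_Icc_bounded[OF continuous_on_subset[OF psi_cont subset_UNIV]] by blast
  obtain K\<^sub>\<beta> where K\<beta>: "\<And>t. t \<in> {0..T} \<Longrightarrow> \<bar>\<beta> t\<bar> \<le> K\<^sub>\<beta>" "K\<^sub>\<beta> \<ge> 0"
    using continuous_on_Icc_bounded[OF beta_cont] by blast
  have lip: "\<bar>primitive (drift q F u) t - primitive (drift q F u) t'\<bar> \<le> \<Lambda> * \<bar>t - t'\<bar>"
    if u: "continuous_on {0..T} u" and t: "t \<in> {0..T}" "t' \<in> {0..T}" for u t t'
  proof (rule primitive_Lipschitz[OF continuous_on_drift[OF q_cont F_cont u] _ t])
    fix t assume "t \<in> {0..T}"
    then have "\<bar>drift q F u t\<bar> \<le> K" "\<bar>balance (drift q F u)\<bar> \<le> K"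
      using K(2)[OF u] balance_bound[OF continuous_on_drift[OF q_cont F_cont u]] by auto
    then show "\<bar>\<psi> (drift q F u t + balance (drift q F u))\<bar> \<le> \<Lambda>"
      by (intro \<Lambda>(2)) auto
  qed
  define B where "B = 2 * (\<Lambda> * T) + K\<^sub>\<beta> + \<bar>lo\<bar> + \<bar>hi\<bar> + 1"
  show thesis
  proof (rule that[of B \<Lambda>])
    show "B > 0" using \<Lambda>(1) T_pos K\<beta>(2) by (auto simp: B_def intro!: add_nonneg_pos add_nonneg_nonneg)
  next
    fix u :: "real \<Rightarrow> real" and t assume u: "continuous_on {0..T} u" and t: "t \<in> {0..T}"
    let ?V = "primitive (drift q F u)"
    have pc: "continuous_on {0..T} ?V"
      by (rule continuous_on_primitive[OF continuous_on_drift[OF q_cont F_cont u]])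
    have V: "\<bar>?V x\<bar> \<le> \<Lambda> * T" if "x \<in> {0..T}" for x
    proof -
      have "\<bar>?V x - ?V 0\<bar> \<le> \<Lambda> * \<bar>x - 0\<bar>" by (rule lip[OF u]) (use that T_pos in auto)
      also have "\<dots> \<le> \<Lambda> * T" using that \<Lambda>(1) by (intro mult_left_mono) auto
      finally show ?thesis by simp
    qed
    have Vb: "continuous_on {0..T} (\<lambda>x. ?V x - \<beta> x)" by (intro continuous_intros pc beta_cont)
    obtain x where x: "x \<in> {0..T}" "?V x - \<beta> x = sup_on T (\<lambda>x. ?V x - \<beta> x)"
      using sup_on_attained[OF T_nonneg Vb] by blast
    have "lo \<le> level u" "level u \<le> hi"
      using clip_bounds[OF lo_le_hi] by (auto simp: level_def)
    then show "\<bar>shift u t\<bar> \<le> B"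
      using V[OF t] V[OF x(1)] K\<beta>(1)[OF x(1)] x(2) unfolding shift_def B_def by linarith
  next
    fix u :: "real \<Rightarrow> real" and t t' assume "continuous_on {0..T} u" "t \<in> {0..T}" "t' \<in> {0..T}"
    then show "\<bar>shift u t - shift u t'\<bar> \<le> \<Lambda> * \<bar>t - t'\<bar>"
      using lip by (simp add: shift_def)
  qed
qed

text \<open>The statement on means is included because limits of solutions must also carry the limit
  of their means.\<close>

lemma shift_uniformly_continuous:
  assumes e: "e > 0"
  shows "\<exists>\<delta>>0. \<forall>u v. u \<in> cball_C T B \<and> v \<in> cball_C T B \<and> (\<forall>t\<in>{0..T}. \<bar>u t - v t\<bar> \<le> \<delta>) \<longrightarrow>
    (\<forall>t\<in>{0..T}. \<bar>shift u t - shift v t\<bar> \<le> e) \<and> \<bar>wmean (\<lambda>x. q (u x)) - wmean (\<lambda>x. q (v x))\<bar> \<le> e"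
proof -
  have uc: "\<exists>\<delta>>0. \<forall>x\<in>{-K..K}. \<forall>y\<in>{-K..K}. \<bar>x - y\<bar> \<le> \<delta> \<longrightarrow> \<bar>g x - g y\<bar> \<le> \<epsilon>"
    if g: "continuous_on UNIV g" and \<epsilon>: "\<epsilon> > 0" for g :: "real \<Rightarrow> real" and K \<epsilon>
  proof -
    have "uniformly_continuous_on {-K..K} g"
      by (rule compact_uniformly_continuous[OF continuous_on_subset[OF g]]) auto
    then obtain \<delta> where "\<delta> > 0" "\<And>x y. x \<in> {-K..K} \<Longrightarrow> y \<in> {-K..K} \<Longrightarrow> \<bar>x - y\<bar> < \<delta> \<Longrightarrow> \<bar>g x - g y\<bar> < \<epsilon>"
      unfolding uniformly_continuous_on_def dist_real_def using \<epsilon> by metis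
    then show ?thesis by (intro exI[of _ "\<delta> / 2"]) force
  qed
  obtain K where K: "K \<ge> 0" "\<And>u t. continuous_on {0..T} u \<Longrightarrow> t \<in> {0..T} \<Longrightarrow> \<bar>drift q F u t\<bar> \<le> K"
    using drift_bounded by blast
  \<comment> \<open>Of \<open>e\<close>, one quarter goes to the primitive, one to its supremum, one
    to the supremum of \<open>u - \<beta>\<close> and one to the mean. The argument of \<psi> may
    move by \<zeta>, half of it through the drift and half through \<open>balance\<close>.\<close>
  define \<eta> where "\<eta> = e / (4 * T)"
  have "\<eta> > 0" using e T_pos by (simp add: \<eta>_def)
  then obtain \<zeta> where \<zeta>: "\<zeta> > 0" "\<And>x y. x \<in> {-(2*K)..2*K} \<Longrightarrow> y \<in> {-(2*K)..2*K} \<Longrightarrow> \<bar>x - y\<bar> \<le> \<zeta> \<Longrightarrow> \<bar>\<psi> x - \<psi> y\<bar> \<le> \<eta>"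
    using uc[OF psi_cont] by blast
  define \<eta>q where "\<eta>q = min (min e (e / (4 * (\<bar>\<kappa>\<bar> + 1)))) (\<zeta> / (8 * T))"
  have \<eta>q: "\<eta>q > 0" "\<eta>q \<le> e" "\<eta>q \<le> e / (4 * (\<bar>\<kappa>\<bar> + 1))" "\<eta>q \<le> \<zeta> / (8 * T)"
    using e \<zeta>(1) T_pos by (auto simp: \<eta>q_def)
  have \<eta>qT: "\<eta>q * T \<le> \<zeta> / 8" using \<eta>q(4) T_pos by (simp add: field_simps)
  have "\<bar>\<kappa>\<bar> * \<eta>q \<le> (\<bar>\<kappa>\<bar> + 1) * \<eta>q" using \<eta>q(1) by simp
  also have "\<dots> \<le> e / 4" using \<eta>q(3) by (simp add: field_simps)
  finally have \<eta>q\<kappa>: "\<bar>\<kappa>\<bar> * \<eta>q \<le> e / 4" .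
  obtain \<delta>q where \<delta>q: "\<delta>q > 0" "\<And>x y. x \<in> {-B..B} \<Longrightarrow> y \<in> {-B..B} \<Longrightarrow> \<bar>x - y\<bar> \<le> \<delta>q \<Longrightarrow> \<bar>q x - q y\<bar> \<le> \<eta>q"
    using uc[OF q_cont \<eta>q(1)] by blast
  have "\<zeta> / 8 > 0" using \<zeta>(1) by simp
  then obtain \<delta>F where \<delta>F: "\<delta>F > 0" "\<And>x y. x \<in> {-B..B} \<Longrightarrow> y \<in> {-B..B} \<Longrightarrow> \<bar>x - y\<bar> \<le> \<delta>F \<Longrightarrow> \<bar>F x - F y\<bar> \<le> \<zeta> / 8"
    using uc[OF F_cont] by blast
  define \<delta> where "\<delta> = min (min \<delta>q \<delta>F) (e / 4)"
  have \<delta>: "\<delta> > 0" "\<delta> \<le> \<delta>q" "\<delta> \<le> \<delta>F" "\<delta> \<le> e / 4" using \<delta>q(1) \<delta>F(1) e by (auto simp: \<delta>_def)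
  show ?thesis
  proof (intro exI[of _ \<delta>] conjI[OF \<delta>(1)] allI impI, elim conjE, intro conjI)
    fix u v assume "u \<in> cball_C T B" "v \<in> cball_C T B" and uv: "\<forall>t\<in>{0..T}. \<bar>u t - v t\<bar> \<le> \<delta>"
    then have u: "continuous_on {0..T} u" "\<And>t. t \<in> {0..T} \<Longrightarrow> u t \<in> {-B..B}"
      and v: "continuous_on {0..T} v" "\<And>t. t \<in> {0..T} \<Longrightarrow> v t \<in> {-B..B}"
      by (auto simp: cball_C_def abs_le_iff) (metis atLeastAtMost_iff minus_le_iff)+
    note qu = continuous_on_comp[OF q_cont u(1)] and qv = continuous_on_comp[OF q_cont v(1)]
    have dq: "\<bar>q (u t) - q (v t)\<bar> \<le> \<eta>q" if "t \<in> {0..T}" for t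
      by (rule \<delta>q(2)) (use u v uv \<delta>(2) that in \<open>auto intro: order_trans\<close>)
    have dF: "\<bar>F (u t) - F (v t)\<bar> \<le> \<zeta> / 8" if "t \<in> {0..T}" for t
      by (rule \<delta>F(2)) (use u v uv \<delta>(3) that in \<open>auto intro: order_trans\<close>)
    have dm: "\<bar>wmean (\<lambda>x. q (u x)) - wmean (\<lambda>x. q (v x))\<bar> \<le> \<eta>q"
      by (rule wmean_diff_le[OF qu qv dq])
    let ?p = "drift q F u" and ?r = "drift q F v"
    have pc: "continuous_on {0..T} ?p" and rc: "continuous_on {0..T} ?r"
      by (rule continuous_on_drift[OF q_cont F_cont u(1)] continuous_on_drift[OF q_cont F_cont v(1)])+
    have dd: "\<bar>?p t - ?r t\<bar> \<le> \<zeta> / 2" if t: "t \<in> {0..T}" for t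
    proof -
      have "\<bar>(wmean (\<lambda>x. q (u x)) - wmean (\<lambda>x. q (v x))) * t\<bar> \<le> \<eta>q * T"
        unfolding abs_mult using dm t by (intro mult_mono) auto
      then have "\<bar>wmean (\<lambda>x. q (u x)) * t - wmean (\<lambda>x. q (v x)) * t\<bar> \<le> \<eta>q * T"
        by (simp add: left_diff_distrib)
      moreover have "\<bar>wint (\<lambda>x. q (u x)) t - wint (\<lambda>x. q (v x)) t\<bar> \<le> \<eta>q * T"
        by (rule wint_diff_le[OF qu qv t dq])
      ultimately show ?thesis
        using \<eta>qT dF[OF t] \<zeta>(1) unfolding drift_def by linarith
    qed
    have db: "\<bar>balance ?p - balance ?r\<bar> \<le> \<zeta> / 2" by (rule balance_diff_le[OF pc rc dd])
    have dV: "\<bar>primitive ?p t - primitive ?r t\<bar> \<le> e / 4" if t: "t \<in> {0..T}" for t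
    proof -
      have "\<bar>primitive ?p t - primitive ?r t\<bar> \<le> \<eta> * T"
      proof (rule primitive_diff_le[OF pc rc _ t])
        fix t assume t: "t \<in> {0..T}"
        have "\<bar>?p t\<bar> \<le> K" "\<bar>?r t\<bar> \<le> K" "\<bar>balance ?p\<bar> \<le> K" "\<bar>balance ?r\<bar> \<le> K"
          using K(2)[OF u(1)] K(2)[OF v(1)] t balance_bound[OF pc] balance_bound[OF rc] by auto
        then show "\<bar>\<psi> (?p t + balance ?p) - \<psi> (?r t + balance ?r)\<bar> \<le> \<eta>"
          using dd[OF t] db by (intro \<zeta>(2)) (simp_all only: atLeastAtMost_iff, linarith+)
      qed
      then show ?thesis using T_pos by (simp add: \<eta>_def)
    qed
    have s1: "\<bar>sup_on T (\<lambda>x. primitive ?p x - \<beta> x) - sup_on T (\<lambda>x. primitive ?r x - \<beta> x)\<bar> \<le> e / 4"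
      using dV by (intro sup_on_diff_le T_nonneg continuous_intros continuous_on_primitive pc rc beta_cont) auto
    have s2: "\<bar>sup_on T (\<lambda>t. u t - \<beta> t) - sup_on T (\<lambda>t. v t - \<beta> t)\<bar> \<le> \<delta>"
      using uv by (intro sup_on_diff_le T_nonneg continuous_intros u v beta_cont) auto
    have "\<bar>\<kappa> * (wmean (\<lambda>x. q (u x)) - wmean (\<lambda>x. q (v x)))\<bar> \<le> \<bar>\<kappa>\<bar> * \<eta>q"
      unfolding abs_mult using dm by (intro mult_left_mono) auto
    then have s3: "\<bar>\<kappa> * (wmean (\<lambda>x. q (u x)) - target) - \<kappa> * (wmean (\<lambda>x. q (v x)) - target)\<bar> \<le> e / 4"
      using \<eta>q\<kappa> by (simp add: algebra_simps)
    have "\<bar>level u - level v\<bar> \<le> e / 4 + e / 4"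
      unfolding level_def by (rule order_trans[OF clip_diff_le]) (use s2 s3 \<delta>(4) in linarith)
    show "\<forall>t\<in>{0..T}. \<bar>shift u t - shift v t\<bar> \<le> e"
    proof (intro ballI)
      fix t assume "t \<in> {0..T}"
      from dV[OF this] s1 show "\<bar>shift u t - shift v t\<bar> \<le> e"
        using \<open>\<bar>level u - level v\<bar> \<le> e / 4 + e / 4\<close> unfolding shift_def by linarith
    qed
    show "\<bar>wmean (\<lambda>x. q (u x)) - wmean (\<lambda>x. q (v x))\<bar> \<le> e" using dm \<eta>q(2) by simp
  qed
qed

lemma fixed_point_weak_solution:
  assumes u: "continuous_on {0..T} u" and fp: "\<And>t. t \<in> {0..T} \<Longrightarrow> shift u t = u t"
  shows "weak_solution q F (wmean (\<lambda>x. q (u x))) u" "sup_on T (\<lambda>t. u t - \<beta> t) = level u"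
proof -
  let ?V = "primitive (drift q F u)"
  have dc: "continuous_on {0..T} (drift q F u)" by (rule continuous_on_drift[OF q_cont F_cont u])
  define c where "c = level u - sup_on T (\<lambda>x. ?V x - \<beta> x)"
  have uV: "u t = ?V t + c" if "t \<in> {0..T}" for t
    using fp[OF that] by (simp add: shift_def c_def)
  have Vb: "continuous_on {0..T} (\<lambda>x. ?V x - \<beta> x)"
    by (intro continuous_intros continuous_on_primitive dc beta_cont)
  have "sup_on T (\<lambda>t. u t - \<beta> t) = sup_on T (\<lambda>t. (?V t - \<beta> t) + c)"
    by (rule sup_on_cong) (simp add: uV)
  then show "sup_on T (\<lambda>t. u t - \<beta> t) = level u"
    using sup_on_add_const[OF T_nonneg Vb, of c] by (simp add: c_def)
  have "(u has_real_derivative \<psi> (drift q F u t + balance (drift q F u))) (at t within {0..T})"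
    if t: "t \<in> {0..T}" for t
  proof -
    have "((\<lambda>t. ?V t + c) has_real_derivative \<psi> (drift q F u t + balance (drift q F u))) (at t within {0..T})"
      using DERIV_add[OF primitive_deriv[OF dc t] DERIV_const[of c]] by simp
    then show ?thesis
      by (rule has_field_derivative_transform_within[OF _ zero_less_one t]) (simp add: uV)
  qed
  moreover have "u 0 = u T" using uV[of 0] uV[of T] primitive_T[OF dc] T_pos by simp
  ultimately show "weak_solution q F (wmean (\<lambda>x. q (u x))) u"
    unfolding weak_solution_def by blast
qed

text \<open>By uniqueness of \<open>balance\<close> the integration constant of a solution is the
  one used in \<open>shift\<close>. Solutions thus inherit the Lipschitz bound and the continuity of
  the map.\<close>

lemma weak_solution_fixed_point:
  assumes ws: "weak_solution q F s u" and lev: "level u = sup_on T (\<lambda>t. u t - \<beta> t)" and t: "t \<in> {0..T}"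
  shows "shift u t = u t"
proof -
  let ?V = "primitive (drift q F u)"
  note u = weak_solution_continuous[OF ws]
  have dc: "continuous_on {0..T} (drift q F u)" by (rule continuous_on_drift[OF q_cont F_cont u])
  obtain k where k: "\<And>t. t \<in> {0..T} \<Longrightarrow> (u has_real_derivative \<psi> (drift q F u t + k)) (at t within {0..T})"
    and per: "u 0 = u T"
    using ws unfolding weak_solution_def by blast
  have I: "((\<lambda>t. \<psi> (drift q F u t + k)) has_integral (u x - u 0)) {0..x}" if x: "x \<in> {0..T}" for x
  proof (rule fundamental_theorem_of_calculus)
    fix y assume "y \<in> {0..x}"
    then show "(u has_vector_derivative \<psi> (drift q F u y + k)) (at y within {0..x})"
      using k[of y] x DERIV_subset[of u _ y "{0..T}" "{0..x}"]
      by (auto simp flip: has_real_derivative_iff_has_vector_derivative)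
  qed (use x in auto)
  have "balance (drift q F u) = k"
    using I[of T] per T_pos by (intro balance_unique[OF dc]) (auto simp: has_integral_iff)
  then have V: "?V x = u x - u 0" if "x \<in> {0..T}" for x
    using I[OF that] by (auto simp: primitive_def has_integral_iff)
  have ub: "continuous_on {0..T} (\<lambda>x. u x - \<beta> x)" by (intro continuous_intros u beta_cont)
  have "sup_on T (\<lambda>x. ?V x - \<beta> x) = sup_on T (\<lambda>x. (u x - \<beta> x) + (- u 0))"
    by (rule sup_on_cong) (simp add: V)
  then have "sup_on T (\<lambda>x. ?V x - \<beta> x) = sup_on T (\<lambda>x. u x - \<beta> x) - u 0"
    using sup_on_add_const[OF T_nonneg ub, of "- u 0"] by simp
  then show ?thesis using V[OF t] lev by (simp add: shift_def)
qed

lemma fixed_point_exists: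
  "\<exists>u. continuous_on {0..T} u \<and> (\<forall>t\<in>{0..T}. shift u t = u t)"
proof -
  obtain B \<Lambda> where B: "B > 0"
    "\<And>u t. continuous_on {0..T} u \<Longrightarrow> t \<in> {0..T} \<Longrightarrow> \<bar>shift u t\<bar> \<le> B"
    "\<And>u t t'. continuous_on {0..T} u \<Longrightarrow> t \<in> {0..T} \<Longrightarrow> t' \<in> {0..T} \<Longrightarrow>
       \<bar>shift u t - shift u t'\<bar> \<le> \<Lambda> * \<bar>t - t'\<bar>"
    using shift_bounds by blast
  have "\<exists>u\<in>cball_C T B. \<forall>t\<in>{0..T}. shift u t = u t"
  proof (rule schauder_Lipschitz[where \<Lambda> = \<Lambda>, OF T_pos B(1)])
    fix e :: real assume "e > 0"
    from shift_uniformly_continuous[OF this]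
    show "\<exists>\<delta>>0. \<forall>u v. u \<in> cball_C T B \<and> v \<in> cball_C T B \<and> (\<forall>t\<in>{0..T}. \<bar>u t - v t\<bar> \<le> \<delta>) \<longrightarrow>
      (\<forall>t\<in>{0..T}. \<bar>shift u t - shift v t\<bar> \<le> e)" by blast
  qed (use B in \<open>auto simp: cball_C_def\<close>)
  then show ?thesis by (auto simp: cball_C_def)
qed

text \<open>As fixed points, the solutions share a Lipschitz constant. A subsequence converges
  uniformly, and continuity of \<open>shift\<close> and of the mean carries both equations to the
  limit.\<close>

lemma weak_solutions_closed:
  assumes ws: "\<And>n. weak_solution q F (\<sigma> n) (U n)"
    and lev: "\<And>n. level (U n) = sup_on T (\<lambda>t. U n t - \<beta> t)"
    and lim: "\<sigma> \<longlonglongrightarrow> s"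
    and M: "\<And>n t. t \<in> {0..T} \<Longrightarrow> \<bar>U n t\<bar> \<le> M"
  obtains u where "weak_solution q F s u" "\<And>t. t \<in> {0..T} \<Longrightarrow> \<bar>u t\<bar> \<le> M"
proof -
  obtain B \<Lambda> where B: "B > 0"
    "\<And>u t. continuous_on {0..T} u \<Longrightarrow> t \<in> {0..T} \<Longrightarrow> \<bar>shift u t\<bar> \<le> B"
    "\<And>u t t'. continuous_on {0..T} u \<Longrightarrow> t \<in> {0..T} \<Longrightarrow> t' \<in> {0..T} \<Longrightarrow>
       \<bar>shift u t - shift u t'\<bar> \<le> \<Lambda> * \<bar>t - t'\<bar>"
    using shift_bounds by blast
  have fp: "shift (U n) t = U n t" if "t \<in> {0..T}" for n t
    by (rule weak_solution_fixed_point[OF ws lev that])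
  have Uc: "continuous_on {0..T} (U n)" for n by (rule weak_solution_continuous[OF ws])
  have lip: "\<bar>U n t - U n t'\<bar> \<le> \<Lambda> * \<bar>t - t'\<bar>" if "t \<in> {0..T}" "t' \<in> {0..T}" for n t t'
    using B(3)[OF Uc that] fp that by simp
  have \<Lambda>0: "\<Lambda> \<ge> 0"
    using lip[of T 0 0] T_pos by (auto simp: zero_le_mult_iff dest: order_trans[OF abs_ge_zero])
  obtain u r where u: "continuous_on {0..T} u" "strict_mono (r :: nat \<Rightarrow> nat)"
    "\<And>e. 0 < e \<Longrightarrow> \<exists>N. \<forall>n x. n \<ge> N \<and> x \<in> {0..T} \<longrightarrow> norm (U (r n) x - u x) < e"
  proof (rule Arzela_Ascoli[of "{0..T}" U M])
    show "norm (U n x) \<le> M" if "x \<in> {0..T}" for n x using M[OF that] by simp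
    fix x e :: real assume x: "x \<in> {0..T}" and e: "0 < e"
    show "\<exists>d>0. \<forall>n y. y \<in> {0..T} \<and> norm (x - y) < d \<longrightarrow> norm (U n x - U n y) < e"
    proof (intro exI[of _ "e / (\<Lambda> + 1)"] conjI allI impI)
      fix n y assume y: "y \<in> {0..T} \<and> norm (x - y) < e / (\<Lambda> + 1)"
      have "\<bar>U n x - U n y\<bar> \<le> \<Lambda> * \<bar>x - y\<bar>" using lip x y by blast
      also have "\<dots> \<le> \<Lambda> * (e / (\<Lambda> + 1))" using y \<Lambda>0 by (intro mult_left_mono) auto
      also have "\<dots> < e" using e \<Lambda>0 by (simp add: field_simps)
      finally show "norm (U n x - U n y) < e" by simp
    qed (use e \<Lambda>0 in simp)
  qed auto
  have uM: "\<bar>u t\<bar> \<le> M" if t: "t \<in> {0..T}" for t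
  proof (rule field_le_epsilon)
    fix e :: real assume "e > 0"
    from u(3)[OF this] obtain n where "\<bar>U (r n) t - u t\<bar> < e" using t by auto
    then show "\<bar>u t\<bar> \<le> M + e" using M[OF t, of "r n"] by linarith
  qed
  have UX: "U n \<in> cball_C T M" for n using Uc M by (simp add: cball_C_def)
  have uX: "u \<in> cball_C T M" using u(1) uM by (simp add: cball_C_def)
  have ev: "\<exists>N. \<forall>n\<ge>N. (\<forall>t\<in>{0..T}. \<bar>U (r n) t - u t\<bar> \<le> e) \<and> (\<forall>t\<in>{0..T}. \<bar>shift (U (r n)) t - shift u t\<bar> \<le> e)
      \<and> \<bar>wmean (\<lambda>x. q (U (r n) x)) - wmean (\<lambda>x. q (u x))\<bar> \<le> e" if e: "e > 0" for e
  proof -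
    obtain \<delta> where \<delta>: "\<delta> > 0" "\<And>u v. u \<in> cball_C T M \<and> v \<in> cball_C T M \<and> (\<forall>t\<in>{0..T}. \<bar>u t - v t\<bar> \<le> \<delta>) \<Longrightarrow>
       (\<forall>t\<in>{0..T}. \<bar>shift u t - shift v t\<bar> \<le> e) \<and> \<bar>wmean (\<lambda>x. q (u x)) - wmean (\<lambda>x. q (v x))\<bar> \<le> e"
      using shift_uniformly_continuous[OF e, of M] by blast
    obtain N where N: "\<And>n x. n \<ge> N \<Longrightarrow> x \<in> {0..T} \<Longrightarrow> \<bar>U (r n) x - u x\<bar> < min \<delta> e"
      using u(3)[of "min \<delta> e"] \<delta>(1) e by auto
    show ?thesis
    proof (intro exI[of _ N] allI impI)
      fix n assume n: "n \<ge> N"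
      have "\<forall>t\<in>{0..T}. \<bar>U (r n) t - u t\<bar> \<le> min \<delta> e" using N[OF n] by (auto intro: less_imp_le)
      then show "(\<forall>t\<in>{0..T}. \<bar>U (r n) t - u t\<bar> \<le> e) \<and> (\<forall>t\<in>{0..T}. \<bar>shift (U (r n)) t - shift u t\<bar> \<le> e)
          \<and> \<bar>wmean (\<lambda>x. q (U (r n) x)) - wmean (\<lambda>x. q (u x))\<bar> \<le> e"
        using \<delta>(2)[of "U (r n)" u] UX uX by simp
    qed
  qed
  have fpu: "shift u t = u t" if t: "t \<in> {0..T}" for t
  proof -
    have "\<bar>shift u t - u t\<bar> \<le> 0"
    proof (rule field_le_epsilon)
      fix e :: real assume "e > 0"
      then have "e / 2 > 0" by simp
      from ev[OF this] obtain n where "\<bar>U (r n) t - u t\<bar> \<le> e / 2" "\<bar>shift (U (r n)) t - shift u t\<bar> \<le> e / 2"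
        using t by blast
      then show "\<bar>shift u t - u t\<bar> \<le> 0 + e" using fp[OF t, of "r n"] by linarith
    qed
    then show ?thesis by simp
  qed
  have "(\<lambda>n. \<sigma> (r n)) \<longlonglongrightarrow> wmean (\<lambda>x. q (u x))"
  proof (rule LIMSEQ_I)
    fix e :: real assume "e > 0"
    then have "e / 2 > 0" by simp
    from ev[OF this] obtain N where "\<forall>n\<ge>N. \<bar>wmean (\<lambda>x. q (U (r n) x)) - wmean (\<lambda>x. q (u x))\<bar> \<le> e / 2"
      by blast
    moreover have "\<sigma> n = wmean (\<lambda>x. q (U n x))" for n
      using ws[of n] by (simp add: weak_solution_def)
    ultimately show "\<exists>N. \<forall>n\<ge>N. norm (\<sigma> (r n) - wmean (\<lambda>x. q (u x))) < e"
      using \<open>e > 0\<close> by (intro exI[of _ N]) force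
  qed
  then have "s = wmean (\<lambda>x. q (u x))"
    using LIMSEQ_subseq_LIMSEQ[OF lim u(2)] LIMSEQ_unique by (fastforce simp: comp_def)
  then show thesis
    using that fixed_point_weak_solution(1)[OF u(1) fpu] uM by blast
qed

end

section \<open>Solutions at a prescribed level\<close>

context periodic_problem
begin

text \<open>Existence for an unbounded \<open>F\<close>: the fixed point is taken for a clipped
  \<open>F\<close> and then seen to avoid the clipped range.\<close>

lemma weak_solution_at_level:
  assumes q: "continuous_on UNIV q" and Q: "\<And>x. \<bar>q x\<bar> \<le> Q" and F: "continuous_on UNIV F"
    and \<beta>: "continuous_on {0..T} \<beta>" and lh: "lo \<le> hi"
  obtains u s where "weak_solution q F s u" "\<bar>s\<bar> \<le> Q"
    "sup_on T (\<lambda>t. u t - \<beta> t) = clip lo hi (sup_on T (\<lambda>t. u t - \<beta> t) + \<kappa> * (s - target))"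
proof -
  have Q0: "0 \<le> Q" using Q[of 0] by simp
  have Qq: "- Q \<le> q x" for x using Q[of x] by (simp add: abs_le_iff)
  obtain D where D: "D \<ge> 0"
    "\<And>q F s u t t'. \<lbrakk>continuous_on UNIV q; continuous_on UNIV F; \<And>x. - Q \<le> q x; \<bar>s\<bar> \<le> Q;
       weak_solution q F s u; t \<in> {0..T}; t' \<in> {0..T}\<rbrakk> \<Longrightarrow> \<bar>u t - u t'\<bar> \<le> D"
    using oscillation_bound[OF Q0, of Q] by blast
  obtain K where K: "K \<ge> 0" "\<And>t. t \<in> {0..T} \<Longrightarrow> \<bar>\<beta> t\<bar> \<le> K"
    using continuous_on_Icc_bounded[OF \<beta>] by blast
  \<comment> \<open>There is no circularity: \<open>D\<close> serves every continuous
    \<open>F\<close>, so \<open>M\<close> can be fixed before \<open>F\<close> is clipped at it. The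
    level confines \<open>u\<close> at one point, and \<open>D\<close> confines it everywhere
    else.\<close>
  define M where "M = \<bar>lo\<bar> + \<bar>hi\<bar> + K + D"
  have M0: "- M \<le> M" using K(1) D(1) by (simp add: M_def)
  define F' where "F' x = F (clip (- M) M x)" for x
  have F': "continuous_on UNIV F'" unfolding F'_def by (rule continuous_on_clip_comp[OF F])
  obtain B where B: "\<And>x. \<bar>F' x\<bar> \<le> B" unfolding F'_def using clip_comp_bounded[OF F M0] by blast
  interpret S: shift_map T A \<phi> \<psi> a E q F' \<beta> lo hi \<kappa> target Q B
    by unfold_locales (rule q F' Q B \<beta> lh)+
  obtain u where u: "continuous_on {0..T} u" "\<And>t. t \<in> {0..T} \<Longrightarrow> S.shift u t = u t"
    using S.fixed_point_exists by blast
  define s where "s = wmean (\<lambda>x. q (u x))"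
  have ws: "weak_solution q F' s u" and lev: "sup_on T (\<lambda>t. u t - \<beta> t) = S.level u"
    using S.fixed_point_weak_solution[OF u] by (simp_all add: s_def)
  have "\<bar>s - wmean (\<lambda>_. 0)\<bar> \<le> Q"
    unfolding s_def by (rule wmean_diff_le[OF continuous_on_comp[OF q u(1)]]) (use Q in auto)
  then have sQ: "\<bar>s\<bar> \<le> Q" by simp
  have ub: "continuous_on {0..T} (\<lambda>t. u t - \<beta> t)" by (intro continuous_intros u \<beta>)
  obtain x where x: "x \<in> {0..T}" "u x - \<beta> x = sup_on T (\<lambda>t. u t - \<beta> t)"
    using sup_on_attained[OF T_nonneg ub] by blast
  have "lo \<le> S.level u" "S.level u \<le> hi"
    using clip_bounds[OF lh] by (auto simp: S.level_def)
  then have "lo \<le> u x - \<beta> x" "u x - \<beta> x \<le> hi"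
    unfolding x(2) lev by auto
  then have uM: "\<bar>u t\<bar> \<le> M" if "t \<in> {0..T}" for t
    using D(2)[OF q F' Qq sQ ws that x(1)] K(2)[OF x(1)] unfolding M_def by linarith
  have "F' (u t) = F (u t)" if "t \<in> {0..T}" for t
    using uM[OF that] by (simp add: F'_def clip_id abs_le_iff)
  then have "weak_solution q F s u"
    using ws weak_solution_cong[where u = u and q = q and q' = q and F = F' and F' = F, OF refl] by simp
  then show thesis using that sQ lev unfolding S.level_def s_def by blast
qed

lemma weak_solutions_limit:
  assumes q: "continuous_on UNIV q" and F: "continuous_on UNIV F"
    and ws: "\<And>n. weak_solution q F (\<sigma> n) (U n)" and lim: "\<sigma> \<longlonglongrightarrow> s"
    and M: "\<And>n t. t \<in> {0..T} \<Longrightarrow> \<bar>U n t\<bar> \<le> M"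
  obtains u where "weak_solution q F s u"
proof -
  have "0 \<le> M" using M[of 0] T_pos by (auto intro: order_trans[OF abs_ge_zero])
  then have MM: "- M \<le> M" by simp
  define q' where "q' x = q (clip (- M) M x)" for x
  define F' where "F' x = F (clip (- M) M x)" for x
  have q': "continuous_on UNIV q'" unfolding q'_def by (rule continuous_on_clip_comp[OF q])
  have F': "continuous_on UNIV F'" unfolding F'_def by (rule continuous_on_clip_comp[OF F])
  obtain B where B: "\<And>x. \<bar>F' x\<bar> \<le> B" unfolding F'_def using clip_comp_bounded[OF F MM] by blast
  obtain Q where Q: "\<And>x. \<bar>q' x\<bar> \<le> Q" unfolding q'_def using clip_comp_bounded[OF q MM] by blast
  have cong: "weak_solution q F r w \<longleftrightarrow> weak_solution q' F' r w"
    if w: "\<And>t. t \<in> {0..T} \<Longrightarrow> \<bar>w t\<bar> \<le> M" for r w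
  proof (rule weak_solution_cong)
    fix t assume "t \<in> {0..T}"
    from w[OF this] show "q (w t) = q' (w t)" "F (w t) = F' (w t)"
      by (simp_all add: F'_def q'_def clip_id abs_le_iff)
  qed
  \<comment> \<open>With \<beta> and \<kappa> zero and bounds \<open>- M\<close> and
    \<open>M\<close>, the level condition holds for every continuous function bounded by
    \<open>M\<close>.\<close>
  interpret S: shift_map T A \<phi> \<psi> a E q' F' "\<lambda>_. 0" "- M" M 0 0 Q B
    by unfold_locales (rule q' F' Q B continuous_on_const MM)+
  have ws': "weak_solution q' F' (\<sigma> n) (U n)" for n using ws cong M by blast
  have lev: "S.level (U n) = sup_on T (\<lambda>t. U n t - 0)" for n
  proof -
    obtain x where "x \<in> {0..T}" "U n x = sup_on T (U n)"
      using sup_on_attained[OF T_nonneg weak_solution_continuous[OF ws[of n]]] by blast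
    then have "\<bar>sup_on T (U n)\<bar> \<le> M" using M by metis
    then show ?thesis by (simp add: S.level_def clip_id abs_le_iff)
  qed
  obtain u where "weak_solution q' F' s u" "\<And>t. t \<in> {0..T} \<Longrightarrow> \<bar>u t\<bar> \<le> M"
    using S.weak_solutions_closed[OF ws' lev lim M] by blast
  then show thesis using that cong by blast
qed

section \<open>Comparison of touching solutions\<close>

lemma drift_T: "drift q F u T = drift q F u 0" if "u 0 = u T"
  using that T_pos by (simp add: drift_def wmean_def E_0 E_T)

text \<open>If \<open>u\<close> touches \<open>v\<close> from below while \<open>s > s'\<close>, then \<open>u'\<close> exceeds \<open>v'\<close> immediately to
  the right of the contact point: the difference of \<open>s\<close> and \<open>s'\<close> dominates the terms coming
  from \<open>F\<close> and \<open>q\<close>, which are of smaller order there.\<close>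

lemma weak_solution_touching:
  assumes q: "continuous_on UNIV q" and F: "\<And>x. (F has_real_derivative f x) (at x)"
    and u: "weak_solution q F s u" and v: "weak_solution q F s' v"
    and le: "\<And>t. t \<in> {0..T} \<Longrightarrow> u t \<le> v t" and t0: "t0 \<in> {0..T}" "u t0 = v t0"
  shows "s \<le> s'"
proof (rule ccontr)
  assume "\<not> s \<le> s'"
  \<comment> \<open>To the right of the contact point the gain is
    \<open>4 * \<epsilon> * (t - t1)\<close>; \<open>q\<close> and \<open>F\<close> may each consume
    \<open>\<epsilon> * (t - t1)\<close> of it.\<close>
  define \<epsilon> where "\<epsilon> = (s - s') / 4"
  have \<epsilon>: "\<epsilon> > 0" using \<open>\<not> s \<le> s'\<close> by (simp add: \<epsilon>_def)
  note uc = weak_solution_continuous[OF u] and vc = weak_solution_continuous[OF v]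
  obtain k where k: "\<And>t. t \<in> {0..T} \<Longrightarrow> (u has_real_derivative \<psi> (drift q F u t + k)) (at t within {0..T})"
    and sm: "s = wmean (\<lambda>x. q (u x))" and uper: "u 0 = u T"
    using u unfolding weak_solution_def by blast
  obtain l where l: "\<And>t. t \<in> {0..T} \<Longrightarrow> (v has_real_derivative \<psi> (drift q F v t + l)) (at t within {0..T})"
    and sm': "s' = wmean (\<lambda>x. q (v x))" and vper: "v 0 = v T"
    using v unfolding weak_solution_def by blast
  define zu where "zu t = drift q F u t + k" for t
  define zv where "zv t = drift q F v t + l" for t
  define g where "g t = u t - v t" for t
  have gd: "(g has_real_derivative \<psi> (zu t) - \<psi> (zv t)) (at t within {0..T})" if "t \<in> {0..T}" for t
    unfolding g_def zu_def zv_def by (rule DERIV_diff[OF k[OF that] l[OF that]])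
  have g0: "g t \<le> 0" if "t \<in> {0..T}" for t using le[OF that] by (simp add: g_def)
  have right: "\<psi> (zu t) - \<psi> (zv t) \<le> 0" if t: "t \<in> {0..T}" "t < T" "g t = 0" for t
  proof (rule ccontr)
    assume "\<not> ?thesis"
    then obtain d where d: "d > 0" "\<And>h. h > 0 \<Longrightarrow> t + h \<in> {0..T} \<Longrightarrow> h < d \<Longrightarrow> g t < g (t + h)"
      using has_real_derivative_pos_inc_right[OF gd[OF t(1)]] by auto
    define h where "h = min (d / 2) (T - t)"
    have "h > 0" "h < d" "t + h \<in> {0..T}" using d(1) t by (auto simp: h_def)
    then show False using d(2)[of h] g0[of "t + h"] t by simp
  qed
  have left: "\<psi> (zu t) - \<psi> (zv t) \<ge> 0" if t: "t \<in> {0..T}" "0 < t" "g t = 0" for t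
  proof (rule ccontr)
    assume "\<not> ?thesis"
    then obtain d where d: "d > 0" "\<And>h. h > 0 \<Longrightarrow> t - h \<in> {0..T} \<Longrightarrow> h < d \<Longrightarrow> g t < g (t - h)"
      using has_real_derivative_neg_dec_left[OF gd[OF t(1)]] by auto
    define h where "h = min (d / 2) t"
    have "h > 0" "h < d" "t - h \<in> {0..T}" using d(1) t by (auto simp: h_def)
    then show False using d(2)[of h] g0[of "t - h"] t by simp
  qed
  have zT: "zu T = zu 0" "zv T = zv 0"
    using drift_T[of u, OF uper] drift_T[of v, OF vper] by (simp_all add: zu_def zv_def)
  \<comment> \<open>At an interior contact both one-sided conditions hold at \<open>t0\<close>.
    Otherwise periodicity makes both ends contacts, and the condition to the right of 0 combines
    with the one to the left of \<open>T\<close>. Taking 0 there leaves room to the right.\<close>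
  have "\<exists>t\<in>{0..T}. t < T \<and> g t = 0 \<and> \<psi> (zu t) = \<psi> (zv t)"
  proof (cases "0 < t0 \<and> t0 < T")
    case True
    then show ?thesis using left[OF t0(1)] right[OF t0(1)] t0 by (intro bexI[of _ t0]) (auto simp: g_def)
  next
    case False
    then have "g 0 = 0" "g T = 0" using t0 uper vper by (auto simp: g_def)
    then show ?thesis using right[of 0] left[of T] T_pos zT by (intro bexI[of _ 0]) auto
  qed
  then obtain t1 where t1: "t1 \<in> {0..T}" "t1 < T" "g t1 = 0" "\<psi> (zu t1) = \<psi> (zv t1)" by blast
  have z1: "zu t1 = zv t1" using t1(4) psi_mono by (simp add: strict_mono_eq)
  have uv1: "u t1 = v t1" using t1(3) by (simp add: g_def)
  define R where "R t = F (u t) - F (v t)" for t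
  \<comment> \<open>Values and slopes of \<open>u\<close> and \<open>v\<close> agree at
    \<open>t1\<close>, so \<open>F u - F v\<close> vanishes there to first order.\<close>
  have "(R has_real_derivative f (u t1) * \<psi> (zu t1) - f (v t1) * \<psi> (zv t1)) (at t1 within {0..T})"
    unfolding R_def zu_def zv_def
    by (intro DERIV_diff DERIV_chain2[OF F k[OF t1(1)]] DERIV_chain2[OF F l[OF t1(1)]])
  then have "(R has_real_derivative 0) (at t1 within {0..T})" by (simp add: uv1 t1(4))
  then obtain d1 where d1: "d1 > 0"
    "\<And>t. t \<in> {0..T} \<Longrightarrow> 0 < \<bar>t - t1\<bar> \<Longrightarrow> \<bar>t - t1\<bar> < d1 \<Longrightarrow> \<bar>(R t - R t1) / (t - t1)\<bar> < \<epsilon>"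
    unfolding has_field_derivative_iff Lim_within dist_real_def using \<epsilon> by (metis diff_zero)
  define A' where "A' = \<bar>A\<bar> + 1"
  have A': "A' > 0" "a t \<le> A'" for t
    using a_le[of t] by (auto simp: A'_def)
  have wc: "continuous_on {0..T} (\<lambda>x. q (u x) - q (v x))"
    by (intro continuous_intros continuous_on_comp[OF q uc] continuous_on_comp[OF q vc])
  have "\<epsilon> / A' > 0" using \<epsilon> A' by simp
  then obtain d2 where d2: "d2 > 0"
    "\<And>t. t \<in> {0..T} \<Longrightarrow> \<bar>t - t1\<bar> < d2 \<Longrightarrow> \<bar>(q (u t) - q (v t)) - (q (u t1) - q (v t1))\<bar> < \<epsilon> / A'"
    using wc t1(1) unfolding continuous_on_iff dist_real_def by blast
  define d where "d = min (min d1 d2) (T - t1)"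
  have d: "d > 0" "d \<le> d1" "d \<le> d2" "d \<le> T - t1" using d1(1) d2(1) t1(2) by (auto simp: d_def)
  have pos: "\<psi> (zu t) - \<psi> (zv t) > 0" if t: "t1 < t" "t < t1 + d" for t
  proof -
    have tT: "t \<in> {0..T}" and ht: "0 < t - t1" using t d t1(1) by auto
    have "\<bar>(R t - R t1) / (t - t1)\<bar> < \<epsilon>" by (rule d1(2)[OF tT]) (use t d in auto)
    then have "\<bar>R t - R t1\<bar> < \<epsilon> * (t - t1)" using ht by (simp add: abs_divide divide_less_eq)
    then have R: "R t \<le> \<epsilon> * (t - t1)" using uv1 by (simp add: R_def)
    have I: "integral {t1..t} (\<lambda>x. a x * q (u x)) - integral {t1..t} (\<lambda>x. a x * q (v x)) \<le> \<epsilon> * (t - t1)"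
    proof -
      have iu: "(\<lambda>x. a x * q (u x)) integrable_on {t1..t}" and iv: "(\<lambda>x. a x * q (v x)) integrable_on {t1..t}"
        using weighted_integrable[OF continuous_on_comp[OF q uc]] weighted_integrable[OF continuous_on_comp[OF q vc]]
          t1(1) tT by auto
      have "integral {t1..t} (\<lambda>x. a x * q (u x) - a x * q (v x)) \<le> integral {t1..t} (\<lambda>x. \<epsilon>)"
      proof (rule integral_le)
        show "(\<lambda>x. a x * q (u x) - a x * q (v x)) integrable_on {t1..t}" by (rule integrable_diff[OF iu iv])
        fix x assume x: "x \<in> {t1..t}"
        have "\<bar>(q (u x) - q (v x)) - (q (u t1) - q (v t1))\<bar> < \<epsilon> / A'"
          by (rule d2(2)) (use x t1(1) tT t d in auto)
        then have "q (u x) - q (v x) \<le> \<epsilon> / A'" using uv1 by simp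
        then have "a x * (q (u x) - q (v x)) \<le> a x * (\<epsilon> / A')" using a_nonneg by (intro mult_left_mono) auto
        also have "\<dots> \<le> A' * (\<epsilon> / A')" using A' \<epsilon> by (intro mult_right_mono) auto
        finally show "a x * q (u x) - a x * q (v x) \<le> \<epsilon>" using A' by (simp add: algebra_simps)
      qed (rule integrable_const_ivl)
      then show ?thesis using ht Henstock_Kurzweil_Integration.integral_diff[OF iu iv] by (simp add: mult.commute)
    qed
    have wu: "wint (\<lambda>x. q (u x)) t - wint (\<lambda>x. q (u x)) t1 = integral {t1..t} (\<lambda>x. a x * q (u x))"
      by (rule wint_diff[OF continuous_on_comp[OF q uc]]) (use t1(1) tT t in auto)
    have wv: "wint (\<lambda>x. q (v x)) t - wint (\<lambda>x. q (v x)) t1 = integral {t1..t} (\<lambda>x. a x * q (v x))"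
      by (rule wint_diff[OF continuous_on_comp[OF q vc]]) (use t1(1) tT t in auto)
    have "zu t - zv t = (zu t - zu t1) - (zv t - zv t1)" using z1 by simp
    also have "\<dots> = (s - s') * (t - t1)
        - (integral {t1..t} (\<lambda>x. a x * q (u x)) - integral {t1..t} (\<lambda>x. a x * q (v x))) - R t"
      using wu wv uv1 by (simp add: zu_def zv_def drift_def R_def sm[symmetric] sm'[symmetric] algebra_simps)
    also have "\<dots> \<ge> 4 * (\<epsilon> * (t - t1)) - \<epsilon> * (t - t1) - \<epsilon> * (t - t1)"
      using I R by (simp add: \<epsilon>_def)
    finally have "zu t - zv t > 0" using mult_pos_pos[OF \<epsilon> ht] by linarith
    then show ?thesis using psi_less_iff by simp
  qed
  define t2 where "t2 = t1 + d / 2"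
  have t2: "t1 < t2" "t2 < t1 + d" "t2 < T" using d by (auto simp: t2_def)
  have "g t1 < g t2"
  proof (rule DERIV_pos_imp_increasing_open[OF t2(1)])
    show "continuous_on {t1..t2} g"
      unfolding g_def by (rule continuous_on_subset[of "{0..T}"]) (use uc vc t1(1) t2 in \<open>auto intro!: continuous_intros\<close>)
    fix x assume x: "t1 < x" "x < t2"
    then have xT: "0 < x" "x < T" using t1(1) t2 by auto
    then have "at x within {0..T} = at x" by (intro at_within_interior) simp
    then have "(g has_real_derivative \<psi> (zu x) - \<psi> (zv x)) (at x)" using gd[of x] xT by simp
    moreover have "\<psi> (zu x) - \<psi> (zv x) > 0" by (rule pos) (use x t2 in auto)
    ultimately show "\<exists>y. (g has_real_derivative y) (at x) \<and> y > 0" by blast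
  qed
  then show False using t1(3) g0[of t2] t1(1) t2 by simp
qed

section \<open>The alternative for weak solutions\<close>

lemma weak_solution_multiplicity:
  assumes q: "continuous_on UNIV q" and F: "\<And>x. (F has_real_derivative f x) (at x)"
    and q_minus: "filterlim q at_top at_bot"
    and q_mono: "strict_mono_on {R..} q" and q_lim: "(q \<longlongrightarrow> \<omega>) at_top"
  shows "\<exists>s0<\<omega>. (\<forall>s<s0. \<not> (\<exists>u. weak_solution q F s u)) \<and> (\<exists>u. weak_solution q F s0 u) \<and>
     (\<forall>s. s0 < s \<and> s < \<omega> \<longrightarrow> (\<exists>u1 u2. weak_solution q F s u1 \<and> weak_solution q F s u2 \<and>
        (\<exists>t\<in>{0..T}. u1 t \<noteq> u2 t))) \<and>
     (\<forall>s\<ge>\<omega>. \<exists>u. weak_solution q F s u)"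
proof -
  have Fc: "continuous_on UNIV F" using F by (intro DERIV_continuous_on) (auto intro: DERIV_subset)
  have q_lt: "q x < \<omega>" if "R \<le> x" for x
  proof -
    have "q x < q (x + 1)" using q_mono that by (auto simp: strict_mono_on_def)
    moreover have "q (x + 1) \<le> \<omega>"
    proof (rule tendsto_lowerbound[OF q_lim])
      show "eventually (\<lambda>y. q (x + 1) \<le> q y) at_top"
        using eventually_ge_at_top[of "x + 1"]
      proof eventually_elim
        fix y assume "x + 1 \<le> y"
        then show "q (x + 1) \<le> q y"
          using q_mono that by (cases "x + 1 = y") (auto simp: strict_mono_on_def intro: less_imp_le)
      qed
    qed simp
    ultimately show ?thesis by simp
  qed
  have q_left: "\<exists>r. \<forall>x\<le>r. s < q x" for s
    using q_minus by (simp add: filterlim_at_top_dense eventually_at_bot_linorder)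
  have q_right: "\<exists>r. \<forall>x\<ge>r. s < q x" if "s < \<omega>" for s
    using order_tendstoD(1)[OF q_lim that] by (simp add: eventually_at_top_linorder)
  have q_mid: "\<exists>K. \<forall>x\<in>{l..h}. \<bar>q x\<bar> \<le> K" for l h
    using continuous_on_Icc_bounded[OF continuous_on_subset[OF q subset_UNIV]] by metis
  obtain Q where Q0: "Q \<ge> 0" and Q: "\<And>x. - Q \<le> q x"
  proof -
    obtain l where l: "\<And>x. x \<le> l \<Longrightarrow> 0 < q x" using q_left[of 0] by blast
    obtain h where h: "\<And>x. x \<ge> h \<Longrightarrow> \<omega> - 1 < q x" using q_right[of "\<omega> - 1"] by auto
    obtain K where K: "\<And>x. x \<in> {l..h} \<Longrightarrow> \<bar>q x\<bar> \<le> K" using q_mid by blast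
    have "- (\<bar>K\<bar> + \<bar>\<omega> - 1\<bar>) \<le> q x" for x
    proof -
      consider "x \<le> l" | "x \<ge> h" | "x \<in> {l..h}" by fastforce
      then show ?thesis using l[of x] h[of x] K[of x] by cases auto
    qed
    then show thesis by (intro that[of "\<bar>K\<bar> + \<bar>\<omega> - 1\<bar>"]) auto
  qed
  have q_up: "\<exists>L. \<forall>x\<ge>r. q x \<le> L" for r
  proof -
    obtain K where K: "\<And>x. x \<in> {r..R} \<Longrightarrow> \<bar>q x\<bar> \<le> K" using q_mid by blast
    have "q x \<le> max K \<omega>" if "x \<ge> r" for x
      using K[of x] q_lt[of x] that by (cases "R \<le> x") auto
    then show ?thesis by blast
  qed
  \<comment> \<open>Cutting from above at \<open>L \<ge> 0\<close> keeps the lower bound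
    \<open>- Q\<close>, so an oscillation bound for a given range of \<open>s\<close> is independent
    of \<open>L\<close>.\<close>
  define trunc where "trunc L x = min (q x) L" for L x
  have trunc_cont: "continuous_on UNIV (trunc L)" for L
    unfolding trunc_def by (intro continuous_intros q)
  have trunc_bound: "\<bar>trunc L x\<bar> \<le> Q + \<bar>L\<bar>" for L x
    using Q[of x] Q0 by (auto simp: trunc_def min_def)
  have trunc_ge: "- Q \<le> trunc L x" if "L \<ge> 0" for L x
    using Q[of x] Q0 that by (auto simp: trunc_def)
  have trunc_weak: "weak_solution (trunc L) F s u \<longleftrightarrow> weak_solution q F s u"
    if "\<And>t. t \<in> {0..T} \<Longrightarrow> q (u t) \<le> L" for L s u
    by (rule weak_solution_cong) (use that in \<open>simp_all add: trunc_def\<close>)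
  have mean: "s = wmean (\<lambda>x. p (u x))" and comp_cont: "continuous_on {0..T} (\<lambda>x. p (u x))"
    if "weak_solution p F s u" "continuous_on UNIV p" for p s u
    using that continuous_on_comp[OF that(2) weak_solution_continuous[OF that(1)]]
    by (auto simp: weak_solution_def)
  define \<Sigma> where "\<Sigma> = {s. \<exists>u. weak_solution q F s u}"
  have "\<exists>s<\<omega>. s \<in> \<Sigma>"
  proof -
    \<comment> \<open>Prescribing the supremum \<open>R + D\<close> keeps the whole solution above
      \<open>R\<close>. There \<open>q < \<omega> \<le> L\<close>, so the truncation is inactive and
      the mean is less than \<omega>.\<close>
    define L where "L = \<bar>\<omega>\<bar>"
    obtain D where D: "D \<ge> 0"
      "\<And>q F s u t t'. \<lbrakk>continuous_on UNIV q; continuous_on UNIV F; \<And>x. - Q \<le> q x; \<bar>s\<bar> \<le> Q + \<bar>L\<bar>;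
         weak_solution q F s u; t \<in> {0..T}; t' \<in> {0..T}\<rbrakk> \<Longrightarrow> \<bar>u t - u t'\<bar> \<le> D"
      using oscillation_bound[OF Q0, of "Q + \<bar>L\<bar>"] by blast
    obtain u s where us: "weak_solution (trunc L) F s u" "\<bar>s\<bar> \<le> Q + \<bar>L\<bar>"
      "sup_on T (\<lambda>t. u t - 0) = clip (R + D) (R + D) (sup_on T (\<lambda>t. u t - 0) + 0 * (s - 0))"
      using weak_solution_at_level[OF trunc_cont trunc_bound Fc continuous_on_const order_refl] by blast
    have "sup_on T u = R + D" using us(3) by (simp add: clip_def)
    then obtain x where x: "x \<in> {0..T}" "u x = R + D"
      using sup_on_attained[OF T_nonneg weak_solution_continuous[OF us(1)]] by metis
    have uR: "R \<le> u t" if "t \<in> {0..T}" for t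
      using D(2)[OF trunc_cont Fc trunc_ge us(2,1) x(1) that] x(2) by (auto simp: L_def)
    have "q (u t) \<le> L" if "t \<in> {0..T}" for t using q_lt[OF uR[OF that]] by (simp add: L_def)
    then have ws: "weak_solution q F s u" using us(1) trunc_weak by blast
    have "s < \<omega>"
      unfolding mean[OF ws q] by (rule wmean_lt[OF comp_cont[OF ws q]]) (rule q_lt[OF uR])
    then show ?thesis using ws by (auto simp: \<Sigma>_def)
  qed
  then obtain s1 where s1: "s1 < \<omega>" "s1 \<in> \<Sigma>" by blast
  have "- Q \<le> s" if s: "s \<in> \<Sigma>" for s
  proof -
    obtain u where ws: "weak_solution q F s u" using s by (auto simp: \<Sigma>_def)
    show ?thesis unfolding mean[OF ws q] by (rule wmean_ge[OF comp_cont[OF ws q] Q])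
  qed
  then have bdd: "bdd_below \<Sigma>" by (meson bdd_belowI)
  define s0 where "s0 = Inf \<Sigma>"
  have s0_le: "s0 \<le> s" if "s \<in> \<Sigma>" for s unfolding s0_def by (rule cInf_lower[OF that bdd])
  have s0: "s0 < \<omega>" using s0_le[OF s1(2)] s1(1) by simp
  have "s0 \<in> \<Sigma>"
  proof -
    \<comment> \<open>A bound for the means of a minimising sequence that stays below \<omega>;
      outside a compact interval \<open>q\<close> then exceeds \<open>m\<close> on both
      sides.\<close>
    define m where "m = (s0 + \<omega>) / 2"
    have m: "s0 < m" "m < \<omega>" using s0 by (auto simp: m_def)
    have "\<exists>s u. weak_solution q F s u \<and> s0 \<le> s \<and> s < s0 + (m - s0) / real (Suc n)" for n
    proof -
      have "Inf \<Sigma> < s0 + (m - s0) / real (Suc n)" using m(1) by (simp add: s0_def[symmetric])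
      from cInf_lessD[OF _ this] s1(2) obtain s where "s \<in> \<Sigma>" "s < s0 + (m - s0) / real (Suc n)"
        by blast
      then show ?thesis using s0_le[of s] by (auto simp: \<Sigma>_def)
    qed
    then obtain \<sigma> U where \<sigma>: "\<And>n. weak_solution q F (\<sigma> n) (U n)" "\<And>n. s0 \<le> \<sigma> n"
      "\<And>n. \<sigma> n < s0 + (m - s0) / real (Suc n)"
      by metis
    have lim: "\<sigma> \<longlonglongrightarrow> s0"
    proof (rule tendsto_sandwich[OF _ _ tendsto_const])
      show "(\<lambda>n. s0 + (m - s0) / real (Suc n)) \<longlonglongrightarrow> s0"
        using tendsto_add[OF tendsto_const[of s0] tendsto_mult[OF tendsto_const[of "m - s0"] lim_inverse_n'[THEN LIMSEQ_Suc]]]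
        by simp
    qed (use \<sigma> in \<open>auto intro!: always_eventually less_imp_le\<close>)
    have \<sigma>m: "\<sigma> n < m" for n
    proof -
      have "(m - s0) / real (Suc n) \<le> m - s0" using m(1) by (simp add: divide_le_eq mult_le_cancel_left1)
      then show ?thesis using \<sigma>(3)[of n] by linarith
    qed
    have \<sigma>S: "\<bar>\<sigma> n\<bar> \<le> \<bar>s0\<bar> + \<bar>m\<bar>" for n using \<sigma>(2)[of n] \<sigma>m[of n] by linarith
    obtain D where D: "D \<ge> 0"
      "\<And>q F s u t t'. \<lbrakk>continuous_on UNIV q; continuous_on UNIV F; \<And>x. - Q \<le> q x; \<bar>s\<bar> \<le> \<bar>s0\<bar> + \<bar>m\<bar>;
         weak_solution q F s u; t \<in> {0..T}; t' \<in> {0..T}\<rbrakk> \<Longrightarrow> \<bar>u t - u t'\<bar> \<le> D"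
      using oscillation_bound[OF Q0, of "\<bar>s0\<bar> + \<bar>m\<bar>"] by blast
    obtain r1 where r1: "\<And>x. x \<le> r1 \<Longrightarrow> m < q x" using q_left by blast
    obtain r2 where r2: "\<And>x. x \<ge> r2 \<Longrightarrow> m < q x" using q_right[OF m(2)] by blast
    have "\<bar>U n t\<bar> \<le> \<bar>r1\<bar> + \<bar>r2\<bar> + D" if t: "t \<in> {0..T}" for n t
    proof -
      \<comment> \<open>This pins one value of \<open>U n\<close> between \<open>r1\<close> and
        \<open>r2\<close>; the oscillation bound turns it into a bound uniform in
        \<open>n\<close>.\<close>
      have "\<exists>x\<in>{0..T}. q (U n x) \<le> m"
      proof (rule ccontr)
        assume "\<not> ?thesis"
        then have "m < wmean (\<lambda>x. q (U n x))"
          by (intro wmean_gt comp_cont[OF \<sigma>(1) q]) (meson not_le)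
        then show False using mean[OF \<sigma>(1)[of n] q] \<sigma>m[of n] by simp
      qed
      then obtain x where x: "x \<in> {0..T}" "q (U n x) \<le> m" by blast
      then have "r1 < U n x" "U n x < r2" using r1[of "U n x"] r2[of "U n x"] by linarith+
      then show ?thesis using D(2)[OF q Fc Q \<sigma>S \<sigma>(1) t x(1), of n] by linarith
    qed
    then obtain u where "weak_solution q F s0 u"
      using weak_solutions_limit[OF q Fc \<sigma>(1) lim] by blast
    then show ?thesis by (auto simp: \<Sigma>_def)
  qed
  then obtain \<beta> where \<beta>: "weak_solution q F s0 \<beta>" by (auto simp: \<Sigma>_def)
  note \<beta>c = weak_solution_continuous[OF \<beta>]
  obtain K where K: "K \<ge> 0" "\<And>t. t \<in> {0..T} \<Longrightarrow> \<bar>\<beta> t\<bar> \<le> K"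
    using continuous_on_Icc_bounded[OF \<beta>c] by blast
  have gap_cont: "continuous_on {0..T} (\<lambda>t. u t - \<beta> t)" if "weak_solution p F s u" for p s u
    by (intro continuous_intros weak_solution_continuous[OF that] \<beta>c)
  \<comment> \<open>Between \<open>lo\<close> and 0 the level moves by \<open>s' - s\<close>,
    between 0 and \<open>hi\<close> by \<open>s - s'\<close>. At level 0 touching gives
    \<open>s' \<le> s0 < s\<close>; at the far end \<open>s < s'\<close>. Either end is thus moved
    inwards and is no fixed point, and an interior fixed level forces \<open>s' = s\<close>.\<close>
  have sides: "(\<exists>u. weak_solution q F s u \<and> sup_on T (\<lambda>t. u t - \<beta> t) < 0) \<and>
      (s < \<omega> \<longrightarrow> (\<exists>u. weak_solution q F s u \<and> sup_on T (\<lambda>t. u t - \<beta> t) > 0))" if s: "s0 < s" for s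
  proof -
    obtain D where D: "D \<ge> 0"
      "\<And>q F s' u t t'. \<lbrakk>continuous_on UNIV q; continuous_on UNIV F; \<And>x. - Q \<le> q x; \<bar>s'\<bar> \<le> \<bar>s\<bar>;
         weak_solution q F s' u; t \<in> {0..T}; t' \<in> {0..T}\<rbrakk> \<Longrightarrow> \<bar>u t - u t'\<bar> \<le> D"
      using oscillation_bound[OF Q0, of "\<bar>s\<bar>"] by blast
    obtain r1 where r1: "\<And>x. x \<le> r1 \<Longrightarrow> s < q x" using q_left by blast
    \<comment> \<open>The half-line contains the range of \<beta>, which is at least
      \<open>- K\<close>, and that of any solution with mean \<open>s\<close>, which is at least
      \<open>r1 - D\<close>. Hence truncation at \<open>L\<close> affects neither.\<close>
    obtain L0 where L0: "\<And>x. x \<ge> min (r1 - D) (- K) \<Longrightarrow> q x \<le> L0" using q_up by blast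
    define L where "L = max L0 (\<bar>s\<bar> + 1)"
    have L: "L \<ge> 0" "s < L" "L0 \<le> L" by (auto simp: L_def)
    have "q (\<beta> t) \<le> L" if "t \<in> {0..T}" for t
    proof -
      have "min (r1 - D) (- K) \<le> \<beta> t" using K(2)[OF that] by linarith
      then show ?thesis using L0 L(3) by (meson order_trans)
    qed
    then have \<beta>L: "weak_solution (trunc L) F s0 \<beta>" using \<beta> trunc_weak by blast
    \<comment> \<open>A lower bound of \<open>u\<close> is enough, since \<open>q\<close> is bounded
      above on right half-lines; the argument therefore covers \<open>s \<ge> \<omega>\<close> as
      well.\<close>
    have untrunc: "weak_solution q F s u" if ws: "weak_solution (trunc L) F s u" for u
    proof -
      have "\<exists>x\<in>{0..T}. trunc L (u x) \<le> s"
      proof (rule ccontr)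
        assume "\<not> ?thesis"
        then have "s < wmean (\<lambda>x. trunc L (u x))"
          by (intro wmean_gt comp_cont[OF ws trunc_cont]) (meson not_le)
        then show False using mean[OF ws trunc_cont] by simp
      qed
      then obtain x where x: "x \<in> {0..T}" "trunc L (u x) \<le> s" by blast
      then have "q (u x) \<le> s" using L(2) by (auto simp: trunc_def min_def split: if_splits)
      then have "r1 < u x" using r1[of "u x"] by linarith
      then have "r1 - D \<le> u t" if "t \<in> {0..T}" for t
        using D(2)[OF trunc_cont Fc trunc_ge[OF L(1)] order_refl ws x(1) that] by linarith
      then have "q (u t) \<le> L" if "t \<in> {0..T}" for t
        using L0[of "u t"] L(3) that by (meson min.coboundedI1 order_trans)
      then show ?thesis using ws trunc_weak by blast
    qed
    have touch: "s' \<le> s0" if ws: "weak_solution (trunc L) F s' u" and z: "sup_on T (\<lambda>t. u t - \<beta> t) = 0" for s' u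
    proof -
      obtain t0 where t0: "t0 \<in> {0..T}" "u t0 - \<beta> t0 = sup_on T (\<lambda>t. u t - \<beta> t)"
        using sup_on_attained[OF T_nonneg gap_cont[OF ws]] by blast
      show ?thesis
        by (rule weak_solution_touching[OF trunc_cont F ws \<beta>L _ t0(1)])
          (use t0(2) z sup_on_upper[OF gap_cont[OF ws]] in auto)
    qed
    \<comment> \<open>At level \<open>lo\<close> the solution lies below \<open>r1\<close>, where
      \<open>q\<close> exceeds \<open>s\<close>.\<close>
    define lo where "lo = min (- 1) (r1 - K)"
    have lo: "lo < 0" "lo \<le> r1 - K" by (auto simp: lo_def)
    obtain u s' where u: "weak_solution (trunc L) F s' u" "\<bar>s'\<bar> \<le> Q + \<bar>L\<bar>"
      "sup_on T (\<lambda>t. u t - \<beta> t) = clip lo 0 (sup_on T (\<lambda>t. u t - \<beta> t) + 1 * (s' - s))"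
      using weak_solution_at_level[OF trunc_cont trunc_bound Fc \<beta>c less_imp_le[OF lo(1)]] by blast
    define c where "c = sup_on T (\<lambda>t. u t - \<beta> t)"
    have c: "c = clip lo 0 (c + (s' - s))" using u(3) by (simp add: c_def)
    have "c \<noteq> 0"
    proof
      assume "c = 0"
      then have "s' < s" using touch[OF u(1)] s by (simp add: c_def)
      then show False using c \<open>c = 0\<close> lo(1) by (simp add: clip_def)
    qed
    moreover have "c \<noteq> lo"
    proof
      assume "c = lo"
      have "s < trunc L (u t)" if t: "t \<in> {0..T}" for t
      proof -
        have "u t \<le> \<beta> t + lo" using sup_on_upper[OF gap_cont[OF u(1)] t] \<open>c = lo\<close> by (simp add: c_def)
        then have "u t \<le> r1" using K(2)[OF t] lo(2) by linarith
        then show ?thesis using r1 L(2) by (simp add: trunc_def)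
      qed
      then have "s < s'" unfolding mean[OF u(1) trunc_cont] by (intro wmean_gt comp_cont[OF u(1) trunc_cont])
      then show False using c \<open>c = lo\<close> lo(1) by (auto simp: clip_def)
    qed
    ultimately have "s' = s" "c < 0" using c lo(1) by (auto simp: clip_def min_def max_def split: if_splits)
    then have left: "\<exists>u. weak_solution q F s u \<and> sup_on T (\<lambda>t. u t - \<beta> t) < 0"
      using untrunc u(1) by (auto simp: c_def)
    have "\<exists>u. weak_solution q F s u \<and> sup_on T (\<lambda>t. u t - \<beta> t) > 0" if s\<omega>: "s < \<omega>"
    proof -
      obtain r2 where r2: "\<And>x. x \<ge> r2 \<Longrightarrow> s < q x" using q_right[OF s\<omega>] by blast
      \<comment> \<open>The mean \<open>s'\<close> is not yet known to be \<open>s\<close>, so the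
        oscillation bound must admit every mean of the truncated problem.\<close>
      obtain D' where D': "D' \<ge> 0"
        "\<And>q F s' u t t'. \<lbrakk>continuous_on UNIV q; continuous_on UNIV F; \<And>x. - Q \<le> q x; \<bar>s'\<bar> \<le> Q + \<bar>L\<bar>;
           weak_solution q F s' u; t \<in> {0..T}; t' \<in> {0..T}\<rbrakk> \<Longrightarrow> \<bar>u t - u t'\<bar> \<le> D'"
        using oscillation_bound[OF Q0, of "Q + \<bar>L\<bar>"] by blast
      \<comment> \<open>At level \<open>hi\<close> some value of \<open>u\<close> is at least
        \<open>hi - K\<close>, so all are at least \<open>hi - K - D'\<close>, which exceeds
        \<open>r2\<close>; there \<open>q\<close> is above \<open>s\<close>.\<close>
      define hi where "hi = \<bar>r2\<bar> + K + D' + 1"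
      have hi: "hi > 0" using K(1) D'(1) by (simp add: hi_def)
      obtain u s' where u: "weak_solution (trunc L) F s' u" "\<bar>s'\<bar> \<le> Q + \<bar>L\<bar>"
        "sup_on T (\<lambda>t. u t - \<beta> t) = clip 0 hi (sup_on T (\<lambda>t. u t - \<beta> t) + (- 1) * (s' - s))"
        using weak_solution_at_level[OF trunc_cont trunc_bound Fc \<beta>c less_imp_le[OF hi]] by blast
      define c where "c = sup_on T (\<lambda>t. u t - \<beta> t)"
      have c: "c = clip 0 hi (c - (s' - s))" using u(3) by (simp add: c_def algebra_simps)
      have "c \<noteq> 0"
      proof
        assume "c = 0"
        then have "s' < s" using touch[OF u(1)] s by (simp add: c_def)
        then show False using c \<open>c = 0\<close> hi by (auto simp: clip_def)
      qed
      moreover have "c \<noteq> hi"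
      proof
        assume "c = hi"
        obtain x where x: "x \<in> {0..T}" "u x - \<beta> x = sup_on T (\<lambda>t. u t - \<beta> t)"
          using sup_on_attained[OF T_nonneg gap_cont[OF u(1)]] by blast
        have "s < trunc L (u t)" if t: "t \<in> {0..T}" for t
        proof -
          have "u x = hi + \<beta> x" using x(2) \<open>c = hi\<close> by (simp add: c_def)
          then have "r2 \<le> u t"
            using D'(2)[OF trunc_cont Fc trunc_ge[OF L(1)] u(2,1) x(1) t] K(2)[OF x(1)]
            unfolding hi_def by linarith
          then show ?thesis using r2 L(2) by (simp add: trunc_def)
        qed
        then have "s < s'" unfolding mean[OF u(1) trunc_cont] by (intro wmean_gt comp_cont[OF u(1) trunc_cont])
        then show False using c \<open>c = hi\<close> hi by (auto simp: clip_def)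
      qed
      ultimately have "s' = s" "c > 0" using c hi by (auto simp: clip_def min_def max_def split: if_splits)
      then show ?thesis using untrunc u(1) by (auto simp: c_def)
    qed
    with left show ?thesis by blast
  qed
  show ?thesis
  proof (intro exI[of _ s0] conjI allI impI)
    show "s0 < \<omega>" by (rule s0)
    show "\<nexists>u. weak_solution q F s u" if "s < s0" for s
      using s0_le[of s] that by (auto simp: \<Sigma>_def)
    show "\<exists>u. weak_solution q F s0 u" using \<beta> by blast
    show "\<exists>u. weak_solution q F s u" if "\<omega> \<le> s" for s
      using sides[of s] s0 that by fastforce
    fix s assume s: "s0 < s \<and> s < \<omega>"
    obtain u1 where u1: "weak_solution q F s u1" "sup_on T (\<lambda>t. u1 t - \<beta> t) < 0" using sides s by blast
    obtain u2 where u2: "weak_solution q F s u2" "sup_on T (\<lambda>t. u2 t - \<beta> t) > 0" using sides s by blast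
    have "\<exists>t\<in>{0..T}. u1 t \<noteq> u2 t"
    proof (rule ccontr)
      assume "\<not> ?thesis"
      then have "sup_on T (\<lambda>t. u1 t - \<beta> t) = sup_on T (\<lambda>t. u2 t - \<beta> t)"
        by (intro sup_on_cong) auto
      then show False using u1(2) u2(2) by simp
    qed
    then show "\<exists>u1 u2. weak_solution q F s u1 \<and> weak_solution q F s u2 \<and> (\<exists>t\<in>{0..T}. u1 t \<noteq> u2 t)"
      using u1(1) u2(1) by blast
  qed
qed

end

section \<open>Weak and periodic solutions\<close>

locale phi_equation = periodic_problem +
  fixes f F e :: "real \<Rightarrow> real" and B\<^sub>e :: real
  assumes f_cont: "continuous_on UNIV f" and F_deriv: "\<And>x. (F has_real_derivative f x) (at x)"
    and e_int: "e integrable_on {0..T}" and e_le: "\<And>t. \<bar>e t\<bar> \<le> B\<^sub>e"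
    and E_eq: "\<And>t. t \<in> {0..T} \<Longrightarrow> E t = integral {0..t} e"
begin

lemma F_cont: "continuous_on UNIV F"
  using F_deriv by (intro DERIV_continuous_on) (auto intro: DERIV_subset)

text \<open>\<open>drift\<close> with \<open>s\<close> as a free parameter: for a periodic solution
  \<open>s\<close> is recognised as the mean only after integration over a period.\<close>

definition momentum :: "(real \<Rightarrow> real) \<Rightarrow> real \<Rightarrow> (real \<Rightarrow> real) \<Rightarrow> real \<Rightarrow> real" where
  "momentum q s u t = s * t - wint (\<lambda>x. q (u x)) t - F (u t) + E t"

lemma momentum_mean: "momentum q (wmean (\<lambda>x. q (u x))) u = drift q F u"
  by (rule ext) (simp add: momentum_def drift_def)

text \<open>It is even Lipschitz: the integral terms have bounded integrands, and \<open>F u\<close>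
  has the bounded derivative \<open>f u * u'\<close>.\<close>

lemma momentum_absolutely_continuous:
  assumes q: "continuous_on UNIV q" and du: "\<And>t. t \<in> {0..T} \<Longrightarrow> (u has_real_derivative d t) (at t within {0..T})"
    and dc: "continuous_on {0..T} d"
  shows "absolutely_continuous_on 0 T (momentum q s u)"
proof -
  have uc: "continuous_on {0..T} u" by (rule DERIV_continuous_on[OF du])
  note quc = continuous_on_comp[OF q uc]
  obtain Q where Q: "Q \<ge> 0" "\<And>t. t \<in> {0..T} \<Longrightarrow> \<bar>q (u t)\<bar> \<le> Q"
    using continuous_on_Icc_bounded[OF quc] by blast
  have fdc: "continuous_on {0..T} (\<lambda>t. f (u t) * d t)"
    by (intro continuous_on_mult continuous_on_comp[OF f_cont uc] dc)
  obtain K where K: "\<And>t. t \<in> {0..T} \<Longrightarrow> \<bar>f (u t) * d t\<bar> \<le> K"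
    using continuous_on_Icc_bounded[OF fdc] by blast
  have A0: "0 \<le> A" using a_nonneg[of 0] a_le[of 0] by linarith
  define L where "L = \<bar>s\<bar> + A * Q + K + B\<^sub>e"
  have half: "\<bar>momentum q s u y - momentum q s u x\<bar> \<le> L * (y - x)" if xy: "0 \<le> x" "x \<le> y" "y \<le> T" for x y
  proof -
    have "\<bar>integral {x..y} (\<lambda>z. a z * q (u z))\<bar> \<le> (A * Q) * (y - x)"
    proof -
      have "\<bar>integral {x..y} (\<lambda>z. a z * q (u z))\<bar> \<le> integral {x..y} (\<lambda>z. A * Q)"
      proof (rule integral_norm_bound_integral[where f = "\<lambda>z. a z * q (u z)", unfolded real_norm_def])
        show "(\<lambda>z. a z * q (u z)) integrable_on {x..y}" by (rule weighted_integrable[OF quc xy(1,3)])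
        fix z assume "z \<in> {x..y}"
        then show "\<bar>a z * q (u z)\<bar> \<le> A * Q"
          unfolding abs_mult using xy Q a_nonneg a_le A0 by (intro mult_mono) auto
      qed (rule integrable_const_ivl)
      then show ?thesis using xy by (simp add: algebra_simps)
    qed
    then have 1: "\<bar>wint (\<lambda>x. q (u x)) y - wint (\<lambda>x. q (u x)) x\<bar> \<le> (A * Q) * (y - x)"
      by (simp add: wint_diff[OF quc xy])
    have "\<bar>F (u y) - F (u x)\<bar> \<le> K * \<bar>y - x\<bar>"
    proof (rule field_differentiable_bound[of "{0..T}" "\<lambda>t. F (u t)" "\<lambda>t. f (u t) * d t", unfolded real_norm_def])
      show "((\<lambda>t. F (u t)) has_real_derivative f (u z) * d z) (at z within {0..T})" if "z \<in> {0..T}" for z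
        by (rule DERIV_chain2[OF F_deriv du[OF that]])
    qed (use K xy in auto)
    then have 2: "\<bar>F (u y) - F (u x)\<bar> \<le> K * (y - x)" using xy by simp
    have 3: "\<bar>E y - E x\<bar> \<le> B\<^sub>e * (y - x)"
    proof -
      have "integral {0..x} e + integral {x..y} e = integral {0..y} e"
        by (rule Henstock_Kurzweil_Integration.integral_combine)
          (use xy in \<open>auto intro: integrable_subinterval_real[OF e_int]\<close>)
      then have "E y - E x = integral {x..y} e" using E_eq[of x] E_eq[of y] xy by simp
      moreover have "\<bar>integral {x..y} e\<bar> \<le> integral {x..y} (\<lambda>_. B\<^sub>e)"
        by (rule integral_norm_bound_integral[where f = e, unfolded real_norm_def])
          (use e_le xy in \<open>auto intro: integrable_subinterval_real[OF e_int]\<close>)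
      ultimately show ?thesis using xy by (simp add: mult.commute)
    qed
    have 4: "\<bar>s * y - s * x\<bar> \<le> \<bar>s\<bar> * (y - x)" using xy by (simp add: abs_mult flip: right_diff_distrib)
    have "L * (y - x) = \<bar>s\<bar> * (y - x) + (A * Q) * (y - x) + K * (y - x) + B\<^sub>e * (y - x)"
      by (simp add: L_def algebra_simps)
    then show ?thesis using 1 2 3 4 unfolding momentum_def by linarith
  qed
  show ?thesis
  proof (rule absolutely_continuous_on_Lipschitz[where L = L])
    fix x y assume "x \<in> {0..T}" "y \<in> {0..T}"
    then show "\<bar>momentum q s u x - momentum q s u y\<bar> \<le> L * \<bar>x - y\<bar>"
      using half[of x y] half[of y x] by (cases "x \<le> y") (auto simp: abs_minus_commute)
  qed
qed

lemma momentum_derivative_AE: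
  assumes q: "continuous_on UNIV q" and du: "\<And>t. t \<in> {0..T} \<Longrightarrow> (u has_real_derivative d t) (at t within {0..T})"
  shows "AE t in lebesgue. t \<in> {0..T} \<longrightarrow>
    (momentum q s u has_real_derivative s - a t * q (u t) - f (u t) * d t + e t) (at t within {0..T})"
proof -
  have uc: "continuous_on {0..T} u" by (rule DERIV_continuous_on[OF du])
  have w: "(\<lambda>x. a x * q (u x)) integrable_on {0..T}"
    by (rule weighted_integrable[OF continuous_on_comp[OF q uc]]) auto
  show ?thesis
    using indefinite_integral_has_real_derivative_AE[OF w] indefinite_integral_has_real_derivative_AE[OF e_int]
  proof eventually_elim
    case (elim t)
    show ?case
    proof
      assume t: "t \<in> {0..T}"
      have E: "(E has_real_derivative e t) (at t within {0..T})"
        by (rule has_field_derivative_transform_within[OF _ zero_less_one t, of "\<lambda>x. integral {0..x} e"])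
          (use elim(2) t E_eq in auto)
      have W: "(wint (\<lambda>x. q (u x)) has_real_derivative a t * q (u t)) (at t within {0..T})"
        using elim(1) t unfolding wint_def by simp
      have S: "((\<lambda>t. s * t) has_real_derivative s) (at t within {0..T})"
        by (auto intro!: derivative_eq_intros)
      have "((\<lambda>t. s * t - wint (\<lambda>x. q (u x)) t - F (u t) + E t) has_real_derivative
          s - a t * q (u t) - f (u t) * d t + e t) (at t within {0..T})"
        by (intro DERIV_add DERIV_diff S W E DERIV_chain2[OF F_deriv du[OF t]])
      then show "(momentum q s u has_real_derivative s - a t * q (u t) - f (u t) * d t + e t) (at t within {0..T})"
        unfolding momentum_def .
    qed
  qed
qed

lemma weak_solution_imp_periodic_solution:
  assumes q: "continuous_on UNIV q" and ws: "weak_solution q F s u"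
  shows "periodic_solution \<phi> f a q e T s u"
proof -
  obtain k where k: "\<And>t. t \<in> {0..T} \<Longrightarrow> (u has_real_derivative \<psi> (drift q F u t + k)) (at t within {0..T})"
    and sm: "s = wmean (\<lambda>x. q (u x))" and per: "u 0 = u T"
    using ws unfolding weak_solution_def by blast
  define d where "d t = \<psi> (drift q F u t + k)" for t
  have dc: "continuous_on {0..T} d"
    unfolding d_def
    by (rule continuous_on_psi_comp[OF continuous_on_drift[OF q F_cont weak_solution_continuous[OF ws]]])
  have du: "(u has_real_derivative d t) (at t within {0..T})" if "t \<in> {0..T}" for t
    using k[OF that] by (simp add: d_def)
  have md: "AE t in lebesgue. t \<in> {0..T} \<longrightarrow>
      (momentum q s u has_real_derivative s - a t * q (u t) - f (u t) * d t + e t) (at t within {0..T})"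
    by (rule momentum_derivative_AE[OF q du])
  have \<phi>d: "\<phi> (d t) = momentum q s u t - (- k)" for t
    by (simp add: d_def phi_psi sm momentum_mean)
  show ?thesis
    unfolding periodic_solution_def
  proof (intro exI[of _ d] conjI ballI du dc per)
    show "d 0 = d T" by (simp add: d_def drift_T[of u, OF per])
    show "absolutely_continuous_on 0 T (\<lambda>t. \<phi> (d t))"
      unfolding \<phi>d
      by (intro absolutely_continuous_on_diff momentum_absolutely_continuous[OF q du dc]
          absolutely_continuous_on_Lipschitz[of _ _ _ 0]) auto
    show "AE t in lebesgue. t \<in> {0..T} \<longrightarrow>
        (\<exists>r. ((\<lambda>\<tau>. \<phi> (d \<tau>)) has_real_derivative r) (at t within {0..T}) \<and>
             r + f (u t) * d t + a t * q (u t) = s + e t)"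
      using md
    proof eventually_elim
      case (elim t)
      show ?case
      proof
        assume t: "t \<in> {0..T}"
        have "((\<lambda>\<tau>. \<phi> (d \<tau>)) has_real_derivative (s - a t * q (u t) - f (u t) * d t + e t) - 0) (at t within {0..T})"
          unfolding \<phi>d using elim t by (intro DERIV_diff DERIV_const) auto
        then show "\<exists>r. ((\<lambda>\<tau>. \<phi> (d \<tau>)) has_real_derivative r) (at t within {0..T}) \<and>
             r + f (u t) * d t + a t * q (u t) = s + e t"
          by (intro exI conjI) auto
      qed
    qed
  qed
qed

text \<open>\<open>\<phi> (u')\<close> minus \<open>momentum\<close> is absolutely continuous with
  derivative zero almost everywhere, hence constant. Comparing its end values identifies
  \<open>s\<close> as the mean, and applying \<psi> recovers \<open>u'\<close>.\<close>

lemma periodic_solution_imp_weak_solution: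
  assumes q: "continuous_on UNIV q" and ps: "periodic_solution \<phi> f a q e T s u"
  shows "weak_solution q F s u"
proof -
  obtain d where du: "\<And>t. t \<in> {0..T} \<Longrightarrow> (u has_real_derivative d t) (at t within {0..T})"
    and dc: "continuous_on {0..T} d" and per: "u 0 = u T" "d 0 = d T"
    and ac: "absolutely_continuous_on 0 T (\<lambda>t. \<phi> (d t))"
    and ode: "AE t in lebesgue. t \<in> {0..T} \<longrightarrow>
        (\<exists>r. ((\<lambda>\<tau>. \<phi> (d \<tau>)) has_real_derivative r) (at t within {0..T}) \<and>
             r + f (u t) * d t + a t * q (u t) = s + e t)"
    using ps unfolding periodic_solution_def by blast
  have md: "AE t in lebesgue. t \<in> {0..T} \<longrightarrow>
      (momentum q s u has_real_derivative s - a t * q (u t) - f (u t) * d t + e t) (at t within {0..T})"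
    by (rule momentum_derivative_AE[OF q du])
  define h where "h t = \<phi> (d t) - momentum q s u t" for t
  have hac: "absolutely_continuous_on 0 T h"
    unfolding h_def by (intro absolutely_continuous_on_diff ac momentum_absolutely_continuous[OF q du dc])
  have hd: "AE t in lebesgue. t \<in> {0..T} \<longrightarrow> (h has_real_derivative 0) (at t within {0..T})"
    using ode md
  proof eventually_elim
    case (elim t)
    show ?case
    proof
      assume t: "t \<in> {0..T}"
      then obtain r where r: "((\<lambda>\<tau>. \<phi> (d \<tau>)) has_real_derivative r) (at t within {0..T})"
        "r + f (u t) * d t + a t * q (u t) = s + e t" using elim(1) by blast
      have "(h has_real_derivative r - (s - a t * q (u t) - f (u t) * d t + e t)) (at t within {0..T})"
        unfolding h_def using r(1) elim(2) t by (intro DERIV_diff) auto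
      then show "(h has_real_derivative 0) (at t within {0..T})" using r(2) by (simp add: algebra_simps)
    qed
  qed
  \<comment> \<open>The zero derivative lemma compares end values only, so it is applied on each
    \<open>{0..x}\<close>.\<close>
  have const: "h x = h 0" if x: "x \<in> {0..T}" for x
  proof (rule absolutely_continuous_zero_derivative_AE[where h = h])
    show "absolutely_continuous_on 0 x h"
      by (rule absolutely_continuous_on_subset[OF hac]) (use x in auto)
    show "AE t in lebesgue. t \<in> {0..x} \<longrightarrow> (h has_real_derivative 0) (at t within {0..x})"
      using hd by eventually_elim (use x in \<open>auto intro: DERIV_subset\<close>)
  qed (use x in auto)
  have "h T = h 0" using const[of T] T_pos by simp
  then have "momentum q s u T = momentum q s u 0" using per by (simp add: h_def)
  then have sm: "s = wmean (\<lambda>x. q (u x))"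
    using per T_pos by (simp add: momentum_def E_0 E_T wmean_def field_simps)
  have "\<psi> (drift q F u t + h 0) = d t" if "t \<in> {0..T}" for t
  proof -
    have "drift q F u t + h 0 = \<phi> (d t)"
      using const[OF that] by (simp add: h_def sm momentum_mean algebra_simps)
    then show ?thesis by (simp add: psi_phi)
  qed
  then show ?thesis
    unfolding weak_solution_def using sm per(1) du by (intro conjI exI[of _ "h 0"]) auto
qed

end

section \<open>Representatives, antiderivatives and the theorem\<close>

lemma periodic_solution_cong_AE:
  assumes "AE t in lebesgue. t \<in> {0..T} \<longrightarrow> a t = a' t \<and> e t = e' t"
    and ps: "periodic_solution \<phi> f a q e T s u"
  shows "periodic_solution \<phi> f a' q e' T s u"
proof -
  obtain d where d: "\<forall>t\<in>{0..T}. (u has_real_derivative d t) (at t within {0..T})"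
    "continuous_on {0..T} d" "u 0 = u T" "d 0 = d T" "absolutely_continuous_on 0 T (\<lambda>t. \<phi> (d t))"
    and ode: "AE t in lebesgue. t \<in> {0..T} \<longrightarrow>
        (\<exists>r. ((\<lambda>\<tau>. \<phi> (d \<tau>)) has_real_derivative r) (at t within {0..T}) \<and>
             r + f (u t) * d t + a t * q (u t) = s + e t)"
    using ps unfolding periodic_solution_def by blast
  have "AE t in lebesgue. t \<in> {0..T} \<longrightarrow>
        (\<exists>r. ((\<lambda>\<tau>. \<phi> (d \<tau>)) has_real_derivative r) (at t within {0..T}) \<and>
             r + f (u t) * d t + a' t * q (u t) = s + e' t)"
    using ode assms(1) by eventually_elim auto
  then show ?thesis unfolding periodic_solution_def using d by blast
qed

text \<open>Extension by zero and clipping at an essential bound change the function on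
  \<open>{0..T}\<close> only on a null set, and make it bounded everywhere.\<close>

lemma Linfty_on_bounded_representative:
  assumes "Linfty_on T g"
  obtains g' M where "AE t in lebesgue. t \<in> {0..T} \<longrightarrow> g t = g' t" "\<And>t. \<bar>g' t\<bar> \<le> M"
    "g' absolutely_integrable_on {0..T}" "(LINT t:{0..T}|lebesgue. g t) = integral {0..T} g'"
proof -
  obtain M where M: "AE t in lebesgue. t \<in> {0..T} \<longrightarrow> \<bar>g t\<bar> \<le> M"
    and meas: "(\<lambda>x. indicat_real {0..T} x *\<^sub>R g x) \<in> borel_measurable lebesgue"
    using assms unfolding Linfty_on_def set_borel_measurable_def by blast
  define g' where "g' x = max (- \<bar>M\<bar>) (min \<bar>M\<bar> (indicat_real {0..T} x *\<^sub>R g x))" for x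
  have g'm: "g' \<in> borel_measurable lebesgue"
    unfolding g'_def using meas by (intro borel_measurable_max borel_measurable_min) auto
  have g'M: "\<bar>g' t\<bar> \<le> \<bar>M\<bar>" for t by (auto simp: g'_def)
  have ae: "AE t in lebesgue. t \<in> {0..T} \<longrightarrow> g t = g' t"
    using M by eventually_elim (auto simp: g'_def)
  have int: "g' absolutely_integrable_on {0..T}"
  proof (rule measurable_bounded_by_integrable_imp_absolutely_integrable)
    show "g' \<in> borel_measurable (lebesgue_on {0..T})"
      using g'm by (simp add: measurable_restrict_space1)
    show "(\<lambda>_. \<bar>M\<bar>) integrable_on {0..T}" by (rule integrable_const_ivl)
  qed (use g'M in auto)
  have "(LINT t:{0..T}|lebesgue. g t) = (LINT t:{0..T}|lebesgue. g' t)"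
    unfolding set_lebesgue_integral_def
  proof (rule integral_cong_AE[OF meas])
    show "(\<lambda>x. indicat_real {0..T} x *\<^sub>R g' x) \<in> borel_measurable lebesgue"
      using int by (simp add: set_integrable_def borel_measurable_integrable)
    show "AE x in lebesgue. indicat_real {0..T} x *\<^sub>R g x = indicat_real {0..T} x *\<^sub>R g' x"
      using ae by eventually_elim (auto simp: indicator_def)
  qed
  then show thesis
    using that[OF ae g'M int] set_lebesgue_integral_eq_integral(2)[OF int] by simp
qed

text \<open>One of the two integrals in \<open>F\<close> always runs over an empty or one-point
  interval and vanishes, so \<open>F\<close> is the oriented integral from 0 on the whole line. Near
  \<open>x\<close> it differs by a constant from the integral from \<open>- M\<close>.\<close>

lemma antiderivative_exists:
  fixes f :: "real \<Rightarrow> real"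
  assumes f: "continuous_on UNIV f"
  obtains F where "\<And>x. (F has_real_derivative f x) (at x)"
proof -
  define F where "F x = integral {0..x} f - integral {x..0} f" for x
  have int: "f integrable_on {x..y}" for x y
    by (rule integrable_continuous_real[OF continuous_on_subset[OF f subset_UNIV]])
  have "(F has_real_derivative f x) (at x)" for x
  proof -
    define M where "M = \<bar>x\<bar> + 1"
    have M: "- M < 0" "- M < x" "x < M" "0 < M" by (auto simp: M_def)
    have F: "F y = integral {- M..y} f - integral {- M..0} f" if y: "y \<in> {- M<..<M}" for y
    proof (cases "0 \<le> y")
      case True
      then have "integral {- M..0} f + integral {0..y} f = integral {- M..y} f"
        using M by (intro Henstock_Kurzweil_Integration.integral_combine int) auto
      moreover have "integral {y..0} f = 0" using True by (cases "y = 0") auto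
      ultimately show ?thesis by (simp add: F_def)
    next
      case False
      then have "integral {- M..y} f + integral {y..0} f = integral {- M..0} f"
        using y by (intro Henstock_Kurzweil_Integration.integral_combine int) auto
      then show ?thesis using False by (simp add: F_def)
    qed
    have "((\<lambda>y. integral {- M..y} f) has_real_derivative f x) (at x within {- M..M})"
      by (rule integral_has_real_derivative[OF continuous_on_subset[OF f subset_UNIV]]) (use M in auto)
    moreover have "at x within {- M..M} = at x" by (rule at_within_interior) (use M in simp)
    ultimately have "((\<lambda>y. integral {- M..y} f - integral {- M..0} f) has_real_derivative f x - 0) (at x)"
      by (intro DERIV_diff DERIV_const) simp
    then have "((\<lambda>y. integral {- M..y} f - integral {- M..0} f) has_real_derivative f x) (at x)" by simp
    then show ?thesis
      by (rule has_field_derivative_transform_within_open[where S = "{- M<..<M}"]) (use M F in auto)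
  qed
  then show thesis using that by blast
qed

theorem theorem1p3:
  fixes T :: real and \<phi> f q a e :: "real \<Rightarrow> real" and \<omega> :: real
  assumes T_pos: "T > 0"
    and phi_mono: "strict_mono \<phi>"
    and phi_homeo: "\<exists>\<psi>. homeomorphism UNIV UNIV \<phi> \<psi>"
    and phi_0: "\<phi> 0 = 0"
    and f_cont: "continuous_on UNIV f"
    and q_cont: "continuous_on UNIV q"
    and a_Linf: "Linfty_on T a"
    and e_Linf: "Linfty_on T e"
    and a_nonneg: "AE t in lebesgue. t \<in> {0..T} \<longrightarrow> a t \<ge> 0"
    and a_mean: "(LINT t:{0..T}|lebesgue. a t) / T = 1"
    and e_mean: "(LINT t:{0..T}|lebesgue. e t) / T = 0"
    and q_minus: "filterlim q at_top at_bot"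
    and q_plus_mono: "\<exists>R. strict_mono_on {R..} q"
    and q_plus_lim: "(q \<longlongrightarrow> \<omega>) at_top"
  shows "\<exists>s0 < \<omega>.
     (\<forall>s < s0. \<not> (\<exists>u. periodic_solution \<phi> f a q e T s u)) \<and>
     (\<exists>u. periodic_solution \<phi> f a q e T s0 u) \<and>
     (\<forall>s. s0 < s \<and> s < \<omega> \<longrightarrow>
        (\<exists>u1 u2. periodic_solution \<phi> f a q e T s u1 \<and>
                 periodic_solution \<phi> f a q e T s u2 \<and>
                 (\<exists>t\<in>{0..T}. u1 t \<noteq> u2 t))) \<and>
     (\<forall>s \<ge> \<omega>. \<exists>u. periodic_solution \<phi> f a q e T s u)"
proof -
  obtain \<psi> where \<psi>: "homeomorphism UNIV UNIV \<phi> \<psi>" using phi_homeo by blast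
  then have \<psi>c: "continuous_on UNIV \<psi>" and \<psi>\<phi>: "\<And>x. \<psi> (\<phi> x) = x" and \<phi>\<psi>: "\<And>x. \<phi> (\<psi> x) = x"
    by (auto simp: homeomorphism_def)
  have \<psi>m: "strict_mono \<psi>"
    using phi_mono \<phi>\<psi> by (metis strict_mono_def strict_mono_less)
  obtain R where R: "strict_mono_on {R..} q" using q_plus_mono by blast
  obtain a1 A where a1: "AE t in lebesgue. t \<in> {0..T} \<longrightarrow> a t = a1 t" "\<And>t. \<bar>a1 t\<bar> \<le> A"
    "a1 absolutely_integrable_on {0..T}" "(LINT t:{0..T}|lebesgue. a t) = integral {0..T} a1"
    using Linfty_on_bounded_representative[OF a_Linf] by blast
  obtain e' B where e': "AE t in lebesgue. t \<in> {0..T} \<longrightarrow> e t = e' t" "\<And>t. \<bar>e' t\<bar> \<le> B"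
    "e' absolutely_integrable_on {0..T}" "(LINT t:{0..T}|lebesgue. e t) = integral {0..T} e'"
    using Linfty_on_bounded_representative[OF e_Linf] by blast
  \<comment> \<open>The sign, given almost everywhere, is made to hold everywhere without changing
    the integral.\<close>
  define a' where "a' t = max 0 (a1 t)" for t
  have ae1: "AE t in lebesgue. t \<in> {0..T} \<longrightarrow> a1 t = a' t"
    using a1(1) a_nonneg by eventually_elim (auto simp: a'_def)
  have a'i: "a' integrable_on {0..T}"
    unfolding a'_def
    by (rule set_lebesgue_integral_eq_integral(1)[OF absolutely_integrable_max_1[OF absolutely_integrable_on_const a1(3)]]) auto
  have "integral {0..T} a' = integral {0..T} a1"
  proof -
    obtain N where N: "N \<in> null_sets lebesgue" "\<And>t. t \<notin> N \<Longrightarrow> t \<in> {0..T} \<longrightarrow> a1 t = a' t"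
      using ae1 unfolding completion.AE_iff_null_sets by auto
    show ?thesis
      by (rule integral_spike[of N]) (use N negligible_iff_null_sets in auto)
  qed
  also have "\<dots> = T" using a1(4) a_mean T_pos by (simp add: field_simps)
  finally have a'T: "integral {0..T} a' = T" .
  have e'i: "e' integrable_on {0..T}" using e'(3) by (rule set_lebesgue_integral_eq_integral(1))
  define E where "E t = integral {0..t} e'" for t
  obtain F where F: "\<And>x. (F has_real_derivative f x) (at x)"
    using antiderivative_exists[OF f_cont] by blast
  interpret phi_equation T A \<phi> \<psi> a' E f F e' B
  proof unfold_locales
    show "continuous_on {0..T} E"
      unfolding E_def by (rule indefinite_integral_continuous_1[OF e'i])
    show "E T = 0" using e'(4) e_mean T_pos by (simp add: E_def)
    show "\<psi> 0 = 0" using \<psi>\<phi>[of 0] phi_0 by simp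
    show "a' t \<le> A" for t using a1(2)[of t] by (auto simp: a'_def)
  qed (use T_pos \<psi>m \<psi>c \<psi>\<phi> \<phi>\<psi> a'i a'T f_cont F e'i e'(2) in \<open>auto simp: E_def a'_def\<close>)
  have ae: "AE t in lebesgue. t \<in> {0..T} \<longrightarrow> a t = a' t \<and> e t = e' t"
    using a1(1) ae1 e'(1) by eventually_elim auto
  then have ae': "AE t in lebesgue. t \<in> {0..T} \<longrightarrow> a' t = a t \<and> e' t = e t"
    by eventually_elim auto
  have "periodic_solution \<phi> f a q e T s u \<longleftrightarrow> weak_solution q F s u" for s u
    using periodic_solution_cong_AE[OF ae] periodic_solution_cong_AE[OF ae']
      weak_solution_imp_periodic_solution[OF q_cont] periodic_solution_imp_weak_solution[OF q_cont] by blast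
  then show ?thesis
    using weak_solution_multiplicity[OF q_cont F q_minus R q_plus_lim] by simp
qed

end
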